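(* Fix $0<c_m<c_M$, $\varepsilon>0$, $V>0$, and let $$\mathscr{K}_V=\{c(y):\ c_m\le c(y)\le c_M,\ 0<y<H,\ TV(c)\le V\},$$ where $TV(c)$ is the total variation of $c$. For every $c\in\mathscr{K}_V$ consider the set $\mathscr{A}^c_\varepsilon$ of pairs $(\mu_k,\lambda)$ and the associated eigenfunctions $v_\lambda(x',y)=\phi_k(x')u_{\lambda,k}(y)$ of $A=-\nabla\cdot\tilde c\,\nabla$. For a nonempty interval $(a,b)\subseteq(0,H)$ let $\omega=\omega'\times(a,b)\subseteq\Omega$, where $\omega'\subseteq\Omega'$ is a nonempty open set. If $\omega'\neq\Omega'$, assume that the family $\{\phi_k\}_{k=1}^\infty$ of eigenfunctions of the Laplacian in $\Omega'$ does not concentrate in $\Omega'\setminus\omega'$, i.e. $\liminf_{k\to\infty}\|\phi_k\|^2_{L^2(\omega')}/\|\phi_k\|^2_{L^2(\Omega')}>0$. Then there exists $\mathfrak{f}_\omega>0$ such that $$\mathfrak{f}_\omega\le\frac{\|v_\lambda\|_{L^2(\omega)}}{\|v_\lambda\|_{L^2(\Omega)}}\le 1$$ uniformly for all $c\in\mathscr{K}_V$ and all $(\mu_k,\lambda)\in\mathscr{A}^c_\varepsilon$.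
   Context: $\Omega'\subset\mathbb{R}^d$ ($d\ge1$) is a fixed bounded smooth open domain, $H>0$ is fixed, $\Omega=\Omega'\times(0,H)$ with coordinates $x=(x',y)$. $\{(\mu_k^2,\phi_k)\}_{k\ge1}$ is the sequence of eigenvalues (nondecreasing, with multiplicity, $\mu_k>0$) and $L^2$-normalized eigenfunctions (forming an orthonormal basis of $L^2(\Omega')$) of the Dirichlet Laplacian $-\Delta_{x'}$ in $L^2(\Omega')$. For a coefficient $c=c(y)$ set $\tilde c(x',y)=c(y)$; $A=-\nabla\cdot\tilde c\,\nabla$ is the self-adjoint operator in $L^2(\Omega)$ with homogeneous Dirichlet boundary conditions. By separation of variables $A$ is unitarily equivalent to $\bigoplus_{k\ge1}A_k$ on $\bigoplus_k L^2(0,H)$, where $$A_k=c(y)\mu_k^2-\frac{d}{dy}c(y)\frac{d}{dy},\qquad D(A_k)=\{u\in H^1_0(0,H):\ cu'\in H^1(0,H)\}.$$ The (simple) eigenvalues of $A_k$ in increasing order are $\beta_{k,1}<\beta_{k,2}<\cdots$. If $\lambda=\beta_{k,\ell}$, $u_{\lambda,k}$ denotes the (real) eigenfunction of $A_k$ for $\lambda$, normalized in $L^2(0,H)$, and $v_\lambda(x',y)=\phi_k(x')u_{\lambda,k}(y)$ is the corresponding eigenfunction of $A$ (an eigenvalue of $A$ may correspond to several pairs $(k,\ell)$; $v_\lambda$ refers to the pair under consideration). For $\varepsilon>0$, $\mathscr{A}^c_\varepsilon=\bigcup_{k\ge1}\{(\mu_k,\lambda):\ \lambda=\beta_{k,\ell}\text{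 for some }\ell\ge1,\ \lambda\ge(c_M+\varepsilon)\mu_k^2\}$, with $c_M$ the fixed upper bound. *)

theory Defs
  imports "HOL-Analysis.Analysis"
begin

text \<open>All \<open>L\<^sup>2\<close> spaces are real. Elements are represented by functions on the whole space, of which
  only the restriction to \<open>U\<close> matters.\<close>

definition L2 :: "'a::euclidean_space set \<Rightarrow> ('a \<Rightarrow> real) set" where
  "L2 U = {f \<in> borel_measurable (lebesgue_on U). integrable (lebesgue_on U) (\<lambda>x. (f x)\<^sup>2)}"

definition L2_inner :: "'a::euclidean_space set \<Rightarrow> ('a \<Rightarrow> real) \<Rightarrow> ('a \<Rightarrow> real) \<Rightarrow> real" where
  "L2_inner U f g = (\<integral>x. f x * g x \<partial>(lebesgue_on U))"

definition L2_norm :: "'a::euclidean_space set \<Rightarrow> ('a \<Rightarrow> real) \<Rightarrow> real" where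
  "L2_norm U f = sqrt (\<integral>x. (f x)\<^sup>2 \<partial>(lebesgue_on U))"

definition pderiv :: "'a::euclidean_space \<Rightarrow> ('a \<Rightarrow> real) \<Rightarrow> 'a \<Rightarrow> real" where
  "pderiv b f x = frechet_derivative f (at x) b"

primrec times_cont_diff :: "nat \<Rightarrow> ('a::euclidean_space \<Rightarrow> real) \<Rightarrow> bool" where
  "times_cont_diff 0 f \<longleftrightarrow> continuous_on UNIV f"
| "times_cont_diff (Suc n) f \<longleftrightarrow>
     (\<forall>x. f differentiable (at x)) \<and> (\<forall>b\<in>Basis. times_cont_diff n (pderiv b f))"

definition smooth :: "('a::euclidean_space \<Rightarrow> real) \<Rightarrow> bool" where
  "smooth f \<longleftrightarrow> (\<forall>n. times_cont_diff n f)"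

definition test_fun :: "'a::euclidean_space set \<Rightarrow> ('a \<Rightarrow> real) set" where
  "test_fun U = {\<psi>. smooth \<psi> \<and> compact (closure {x. \<psi> x \<noteq> 0}) \<and> closure {x. \<psi> x \<noteq> 0} \<subseteq> U}"

text \<open>\<open>weak_pderiv U b f g\<close>: both \<open>f\<close> and \<open>g\<close> are in \<open>L\<^sup>2(U)\<close> and \<open>\<partial>\<^sub>b f = g\<close> in the sense of
  distributions on \<open>U\<close>.\<close>

definition weak_pderiv ::
    "'a::euclidean_space set \<Rightarrow> 'a \<Rightarrow> ('a \<Rightarrow> real) \<Rightarrow> ('a \<Rightarrow> real) \<Rightarrow> bool" where
  "weak_pderiv U b f g \<longleftrightarrow> f \<in> L2 U \<and> g \<in> L2 U \<and>
     (\<forall>\<psi>\<in>test_fun U. L2_inner U f (pderiv b \<psi>) = - L2_inner U g \<psi>)"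

definition H1 :: "'a::euclidean_space set \<Rightarrow> ('a \<Rightarrow> real) set" where
  "H1 U = {f \<in> L2 U. \<forall>b\<in>Basis. \<exists>g. weak_pderiv U b f g}"

text \<open>\<open>H\<^sup>1\<^sub>0(U)\<close> is the closure of the test functions in \<open>H\<^sup>1(U)\<close>.\<close>

definition H10 :: "'a::euclidean_space set \<Rightarrow> ('a \<Rightarrow> real) set" where
  "H10 U = {f \<in> H1 U. \<exists>\<psi>. (\<forall>n. \<psi> n \<in> test_fun U) \<and>
     (\<lambda>n. L2_norm U (\<lambda>x. \<psi> n x - f x)) \<longlonglongrightarrow> 0 \<and>
     (\<forall>b\<in>Basis. \<forall>g. weak_pderiv U b f g \<longrightarrow>
        (\<lambda>n. L2_norm U (\<lambda>x. pderiv b (\<psi> n) x - g x)) \<longlonglongrightarrow> 0)}"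

text \<open>Unbounded operators on \<open>L\<^sup>2(U)\<close> are given by their graphs: \<open>T u f\<close> means that \<open>u\<close> is in the
  domain and \<open>T u = f\<close> almost everywhere in \<open>U\<close>.\<close>

definition eigenfunction ::
    "'a::euclidean_space set \<Rightarrow> (('a \<Rightarrow> real) \<Rightarrow> ('a \<Rightarrow> real) \<Rightarrow> bool) \<Rightarrow> real \<Rightarrow> ('a \<Rightarrow> real) \<Rightarrow> bool" where
  "eigenfunction U T lam u \<longleftrightarrow> T u (\<lambda>x. lam * u x) \<and> L2_norm U u \<noteq> 0"

definition eigenvalues ::
    "'a::euclidean_space set \<Rightarrow> (('a \<Rightarrow> real) \<Rightarrow> ('a \<Rightarrow> real) \<Rightarrow> bool) \<Rightarrow> real set" where
  "eigenvalues U T = {lam. \<exists>u. eigenfunction U T lam u}"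

text \<open>The \<open>l\<close>-th smallest element (\<open>l \<ge> 1\<close>) of the set of eigenvalues; since eigenvalues are
  counted here without multiplicity, this is for operators with simple spectrum.\<close>

definition is_nth_eigenvalue ::
    "'a::euclidean_space set \<Rightarrow> (('a \<Rightarrow> real) \<Rightarrow> ('a \<Rightarrow> real) \<Rightarrow> bool) \<Rightarrow> nat \<Rightarrow> real \<Rightarrow> bool" where
  "is_nth_eigenvalue U T l lam \<longleftrightarrow> lam \<in> eigenvalues U T \<and>
     finite {nu \<in> eigenvalues U T. nu \<le> lam} \<and> card {nu \<in> eigenvalues U T. nu \<le> lam} = l"

text \<open>The Dirichlet Laplacian \<open>-\<Delta>\<close> with domain \<open>{u \<in> H\<^sup>1\<^sub>0(U). \<Delta>u \<in> L\<^sup>2(U)}\<close>, where \<open>\<Delta>u\<close> is the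
  distributional divergence of the weak gradient \<open>G\<close>.\<close>

definition dirichlet_laplacian ::
    "'a::euclidean_space set \<Rightarrow> ('a \<Rightarrow> real) \<Rightarrow> ('a \<Rightarrow> real) \<Rightarrow> bool" where
  "dirichlet_laplacian U u f \<longleftrightarrow> u \<in> H10 U \<and> f \<in> L2 U \<and>
     (\<exists>G. (\<forall>b\<in>Basis. weak_pderiv U b u (G b)) \<and>
          (\<forall>\<psi>\<in>test_fun U. (\<Sum>b\<in>Basis. L2_inner U (G b) (pderiv b \<psi>)) = L2_inner U f \<psi>))"

text \<open>The index is shifted: \<open>\<mu> k\<close> and \<open>\<phi> k\<close> for \<open>k \<ge> 0\<close> are the \<open>(k+1)\<close>-st frequency and eigenfunction.\<close>

definition dirichlet_eigensystem ::
    "'a::euclidean_space set \<Rightarrow> (nat \<Rightarrow> real) \<Rightarrow> (nat \<Rightarrow> 'a \<Rightarrow> real) \<Rightarrow> bool" where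
  "dirichlet_eigensystem U \<mu> \<phi> \<longleftrightarrow>
     (\<forall>k. \<mu> k > 0) \<and> incseq \<mu> \<and>
     (\<forall>k. eigenfunction U (dirichlet_laplacian U) ((\<mu> k)\<^sup>2) (\<phi> k)) \<and>
     (\<forall>j k. L2_inner U (\<phi> j) (\<phi> k) = (if j = k then 1 else 0)) \<and>
     (\<forall>f\<in>L2 U. (\<lambda>N. L2_norm U (\<lambda>x. f x - (\<Sum>k<N. L2_inner U f (\<phi> k) * \<phi> k x))) \<longlonglongrightarrow> 0)"

text \<open>Near each boundary point the domain is, up to a rotation, the region above the graph of a
  smooth function; \<open>x - (x \<bullet> e) *\<^sub>R e\<close> is the projection to the hyperplane orthogonal to \<open>e\<close>.\<close>

definition smooth_bounded_domain :: "'a::euclidean_space set \<Rightarrow> bool" where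
  "smooth_bounded_domain U \<longleftrightarrow> open U \<and> connected U \<and> bounded U \<and> U \<noteq> {} \<and>
     (\<forall>p\<in>frontier U. \<exists>r>0. \<exists>e \<gamma>. norm e = 1 \<and> smooth \<gamma> \<and>
        U \<inter> ball p r = {x \<in> ball p r. x \<bullet> e > \<gamma> (x - (x \<bullet> e) *\<^sub>R e)})"

text \<open>The operator \<open>A\<^sub>k = c m\<^sup>2 - (d/dy) c (d/dy)\<close> in \<open>L\<^sup>2(0,H)\<close>, for \<open>m = \<mu>\<^sub>k\<close>, with domain
  \<open>{u \<in> H\<^sup>1\<^sub>0(0,H). c u' \<in> H\<^sup>1(0,H)}\<close>; here \<open>u' = du\<close> and \<open>(c u')' = w\<close>.\<close>

definition A_op :: "real \<Rightarrow> (real \<Rightarrow> real) \<Rightarrow> real \<Rightarrow> (real \<Rightarrow> real) \<Rightarrow> (real \<Rightarrow> real) \<Rightarrow> bool" where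
  "A_op H c m u f \<longleftrightarrow> u \<in> H10 {0<..<H} \<and>
     (\<exists>du w. weak_pderiv {0<..<H} 1 u du \<and> weak_pderiv {0<..<H} 1 (\<lambda>y. c y * du y) w \<and>
        (AE y in lebesgue_on {0<..<H}. f y = c y * m\<^sup>2 * u y - w y))"

definition A_eps ::
    "real \<Rightarrow> real \<Rightarrow> real \<Rightarrow> (nat \<Rightarrow> real) \<Rightarrow> (real \<Rightarrow> real) \<Rightarrow> (real \<times> real) set" where
  "A_eps H c\<^sub>M \<epsilon> \<mu> c = (\<Union>k. {(\<mu> k, lam) | lam.
     (\<exists>l\<ge>1. is_nth_eigenvalue {0<..<H} (A_op H c (\<mu> k)) l lam) \<and> lam \<ge> (c\<^sub>M + \<epsilon>) * (\<mu> k)\<^sup>2})"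

definition total_variation :: "(real \<Rightarrow> real) \<Rightarrow> real set \<Rightarrow> ennreal" where
  "total_variation f S = (SUP (n, t) \<in> {(n::nat, t). incseq t \<and> t ` {..n} \<subseteq> S}.
     \<Sum>i<n. ennreal \<bar>f (t (Suc i)) - f (t i)\<bar>)"

definition K_class :: "real \<Rightarrow> real \<Rightarrow> real \<Rightarrow> real \<Rightarrow> (real \<Rightarrow> real) set" where
  "K_class H c\<^sub>m c\<^sub>M V = {c. (\<forall>y\<in>{0<..<H}. c\<^sub>m \<le> c y \<and> c y \<le> c\<^sub>M) \<and>
     total_variation c {0<..<H} \<le> ennreal V}"

end

theory Submission
  imports Defs
begin

text \<open>
  Since \<open>v(x', y) = \<phi>\<^sub>k(x') u(y)\<close>, the quotient of the theorem is the norm of \<open>\<phi>\<^sub>k\<close> over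
  \<open>\<omega>'\<close> times the norm of \<open>u\<close> over \<open>(a, b)\<close> (\<open>L2_norm_product\<close>; both functions are
  normalized). The upper bound is then clear, and the two factors are bounded below separately.

  \<^bold>\<open>The factor \<open>\<phi>\<^sub>k\<close>.\<close> The hypothesis on the lower limit bounds the norms over \<open>\<omega>'\<close> from
  below for all but finitely many \<open>k\<close>. The remaining ones are positive by unique continuation
  (\<open>unique_continuation\<close>): a weak solution of \<open>\<Delta>\<phi> + \<lambda>\<phi> = 0\<close> that vanishes on a nonempty open
  subset of a connected domain vanishes. This is proved without regularity theory. Testing the equation
  with functions of \<open>|y - x|\<^sup>2\<close> shows that the integrals of \<open>\<phi>\<close> against
  \<open>(r - |y - x|\<^sup>2)\<^sub>+ ^ k\<close> solve a second-order ordinary differential equation in \<open>r\<close> which is regular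
  away from \<open>r = 0\<close>. If \<open>\<phi>\<close> vanishes near \<open>x\<close>, they vanish for small \<open>r\<close> and therefore for all
  \<open>r\<close> for which the ball stays in the domain (\<open>radial_moment_vanishes\<close>). This holds for all centres \<open>x\<close>
  in a small ball, and differentiation with respect to \<open>x\<close> yields the same for the integrals with an
  additional polynomial factor (\<open>polynomial_radial_moment_vanishes\<close>). By the Weierstrass theorem \<open>\<phi>\<close>
  vanishes on a larger ball, and a connectedness argument finishes the proof.

  \<^bold>\<open>The factor \<open>u\<close>.\<close> Let \<open>U\<close> and \<open>P\<close> be the absolutely continuous representatives of \<open>u\<close> and
  \<open>c u'\<close> (\<open>weak_derivative_primitive\<close>), so that \<open>U' = P / c\<close> and \<open>P' = - (\<lambda> - c m\<^sup>2) U\<close>. The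
  condition \<open>\<lambda> \<ge> (c\<^sub>M + \<epsilon>) m\<^sup>2\<close> makes \<open>\<lambda> - c m\<^sup>2\<close> comparable to \<open>\<lambda>\<close>: there is no region in which
  \<open>u\<close> could decay exponentially. The energy \<open>(\<lambda> - c m\<^sup>2) c U\<^sup>2 + P\<^sup>2\<close> changes only because \<open>c\<close>
  does, and its values at any two points differ at most by a factor that depends on the total variation
  \<open>V\<close> and on \<open>c\<^sub>m\<close>, \<open>c\<^sub>M\<close>, \<open>\<epsilon>\<close> alone (\<open>energy_comparison\<close>). Thus \<open>(a, b)\<close> carries a fixed share of
  the energy, and a cutoff argument shows that the part \<open>P\<^sup>2\<close> of it is controlled by \<open>\<lambda> U\<^sup>2\<close>
  (\<open>sturm_liouville_lower_bound\<close>). The constants involve a lower bound for \<open>\<lambda>\<close>, for which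
  \<open>(c\<^sub>M + \<epsilon>) \<mu>\<^sub>0\<^sup>2\<close> serves.
\<close>

section \<open>Smooth functions and test functions\<close>

lemma times_cont_diff_Suc_D: "times_cont_diff (Suc n) f \<Longrightarrow> times_cont_diff n f"
proof (induction n arbitrary: f)
  case 0
  then show ?case
    by (auto simp: continuous_on_eq_continuous_within intro: differentiable_imp_continuous_within)
next
  case (Suc n)
  then show ?case
    by (metis times_cont_diff.simps(2))
qed

lemma times_cont_diff_SucI:
  assumes "\<And>x. (f has_derivative f' x) (at x)"
    and "\<And>b. b \<in> Basis \<Longrightarrow> times_cont_diff n (\<lambda>x. f' x b)"
  shows "times_cont_diff (Suc n) f"
proof -
  have "pderiv b f = (\<lambda>x. f' x b)" for b
    unfolding pderiv_def using frechet_derivative_at[OF assms(1)] by metis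
  then show ?thesis
    using assms by (auto simp: differentiable_def)
qed

lemma pderiv_eqI: "(f has_derivative f') (at x) \<Longrightarrow> pderiv b f x = f' b"
  unfolding pderiv_def using frechet_derivative_at by metis

lemma times_cont_diff_has_derivative:
  "times_cont_diff (Suc n) f \<Longrightarrow> (f has_derivative (\<lambda>v. frechet_derivative f (at x) v)) (at x)"
  by (simp add: frechet_derivative_works[symmetric])

lemma times_cont_diff_const: "times_cont_diff n (\<lambda>x. c)"
proof (induction n arbitrary: c)
  case (Suc n)
  show ?case by (rule times_cont_diff_SucI[OF has_derivative_const]) (rule Suc)
qed auto

lemma times_cont_diff_linear:
  assumes "bounded_linear f" shows "times_cont_diff n f"
proof (cases n)
  case 0
  then show ?thesis using assms by (simp add: linear_continuous_on)
next
  case (Suc m)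
  show ?thesis unfolding Suc
    by (rule times_cont_diff_SucI[OF bounded_linear_imp_has_derivative[OF assms]])
      (rule times_cont_diff_const)
qed

lemma times_cont_diff_add:
  "times_cont_diff n f \<Longrightarrow> times_cont_diff n g \<Longrightarrow> times_cont_diff n (\<lambda>x. f x + g x)"
proof (induction n arbitrary: f g)
  case 0
  then show ?case by (auto intro: continuous_intros)
next
  case (Suc n)
  show ?case
    by (rule times_cont_diff_SucI[OF has_derivative_add[OF
          times_cont_diff_has_derivative[OF Suc.prems(1)] times_cont_diff_has_derivative[OF Suc.prems(2)]]])
      (use Suc in \<open>auto simp: pderiv_def[abs_def]\<close>)
qed

lemma times_cont_diff_mult:
  "times_cont_diff n f \<Longrightarrow> times_cont_diff n g \<Longrightarrow> times_cont_diff n (\<lambda>x. f x * g x)"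
proof (induction n arbitrary: f g)
  case 0
  then show ?case by (auto intro: continuous_intros)
next
  case (Suc n)
  show ?case
  proof (rule times_cont_diff_SucI[OF has_derivative_mult[OF
          times_cont_diff_has_derivative[OF Suc.prems(1)] times_cont_diff_has_derivative[OF Suc.prems(2)]]])
    fix b :: 'a assume b: "b \<in> Basis"
    have "times_cont_diff n (\<lambda>x. frechet_derivative f (at x) b)"
      "times_cont_diff n (\<lambda>x. frechet_derivative g (at x) b)"
      using Suc.prems b by (auto simp: pderiv_def[abs_def])
    then show "times_cont_diff n (\<lambda>x. f x * frechet_derivative g (at x) b
                                     + frechet_derivative f (at x) b * g x)"
      by (intro times_cont_diff_add Suc.IH times_cont_diff_Suc_D[OF Suc.prems(1)]
          times_cont_diff_Suc_D[OF Suc.prems(2)])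
  qed
qed

lemma times_cont_diff_compose:
  fixes h :: "real \<Rightarrow> real"
  shows "times_cont_diff n h \<Longrightarrow> times_cont_diff n g \<Longrightarrow> times_cont_diff n (\<lambda>x. h (g x))"
proof (induction n arbitrary: h)
  case 0
  then show ?case by (auto intro: continuous_on_compose2)
next
  case (Suc n)
  show ?case
  proof (rule times_cont_diff_SucI[OF diff_chain_at[unfolded o_def,
          OF times_cont_diff_has_derivative[OF Suc.prems(2)] times_cont_diff_has_derivative[OF Suc.prems(1)]]])
    fix b :: 'a assume b: "b \<in> Basis"
    have 1: "frechet_derivative h (at (g x)) (frechet_derivative g (at x) b)
      = pderiv 1 h (g x) * pderiv b g x" for x
    proof -
      have "linear (frechet_derivative h (at (g x)))"
        using times_cont_diff_has_derivative[OF Suc.prems(1)] has_derivative_linear by blast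
      from linear_scale[OF this, of "frechet_derivative g (at x) b" 1] show ?thesis
        by (simp add: pderiv_def mult.commute)
    qed
    have "times_cont_diff n (\<lambda>x. pderiv 1 h (g x))"
      by (rule Suc.IH) (use Suc.prems times_cont_diff_Suc_D in auto)
    moreover have "times_cont_diff n (pderiv b g)"
      using Suc.prems b by auto
    ultimately show "times_cont_diff n (\<lambda>x. frechet_derivative h (at (g x)) (frechet_derivative g (at x) b))"
      unfolding 1 by (rule times_cont_diff_mult)
  qed
qed

lemma smooth_const: "smooth (\<lambda>x. c)"
  and smooth_linear: "bounded_linear l \<Longrightarrow> smooth l"
  and smooth_add: "smooth f \<Longrightarrow> smooth g \<Longrightarrow> smooth (\<lambda>x. f x + g x)"
  and smooth_mult: "smooth f \<Longrightarrow> smooth g \<Longrightarrow> smooth (\<lambda>x. f x * g x)"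
  and smooth_compose: "smooth h \<Longrightarrow> smooth g \<Longrightarrow> smooth (\<lambda>x. h (g x))"
  for f g :: "'a::euclidean_space \<Rightarrow> real" and h :: "real \<Rightarrow> real"
  by (simp_all add: smooth_def times_cont_diff_const times_cont_diff_linear times_cont_diff_add
      times_cont_diff_mult times_cont_diff_compose)

lemma smooth_diff:
  fixes f g :: "'a::euclidean_space \<Rightarrow> real"
  shows "smooth f \<Longrightarrow> smooth g \<Longrightarrow> smooth (\<lambda>x. f x - g x)"
  using smooth_add[of f "\<lambda>x. (-1) * g x"] smooth_mult[OF smooth_const[of "-1"], of g] by simp

lemma smooth_power:
  fixes f :: "'a::euclidean_space \<Rightarrow> real"
  shows "smooth f \<Longrightarrow> smooth (\<lambda>x. f x ^ k)"
  by (induction k) (auto intro: smooth_const smooth_mult)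

lemma smooth_prod:
  fixes f :: "'i \<Rightarrow> 'a::euclidean_space \<Rightarrow> real"
  assumes "\<And>i. i \<in> I \<Longrightarrow> smooth (f i)"
  shows "smooth (\<lambda>x. \<Prod>i\<in>I. f i x)"
proof (cases "finite I")
  case True
  then show ?thesis using assms
    by (induction I) (auto intro: smooth_const smooth_mult)
qed (simp add: smooth_const)

lemma smooth_sum:
  fixes f :: "'i \<Rightarrow> 'a::euclidean_space \<Rightarrow> real"
  assumes "\<And>i. i \<in> I \<Longrightarrow> smooth (f i)"
  shows "smooth (\<lambda>x. \<Sum>i\<in>I. f i x)"
proof (cases "finite I")
  case True
  then show ?thesis using assms
    by (induction I) (auto intro: smooth_const smooth_add)
qed (simp add: smooth_const)

lemma smooth_continuous_on: "smooth f \<Longrightarrow> continuous_on S f"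
  unfolding smooth_def by (metis continuous_on_subset subset_UNIV times_cont_diff.simps(1))

lemma smooth_pderiv: "smooth f \<Longrightarrow> b \<in> Basis \<Longrightarrow> smooth (pderiv b f)"
  unfolding smooth_def by (meson times_cont_diff.simps(2))

lemma smooth_antideriv:
  assumes "\<And>x. (f has_real_derivative f' x) (at x)" and "smooth f'"
  shows "smooth f"
proof -
  have "times_cont_diff n f" for n
  proof -
    have "times_cont_diff (Suc n) f"
      by (rule times_cont_diff_SucI[OF assms(1)[unfolded has_field_derivative_def]])
        (use assms(2) in \<open>auto simp: smooth_def\<close>)
    then show ?thesis by (rule times_cont_diff_Suc_D)
  qed
  then show ?thesis by (simp add: smooth_def)
qed

text \<open>The powers of \<open>1/t\<close> are carried along because the family is then closed under differentiation,
  so that smoothness at \<open>0\<close> can be proved for all members at once.\<close>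

definition flat_exp :: "real \<Rightarrow> nat \<Rightarrow> real \<Rightarrow> real" where
  "flat_exp d k t = (if t > 0 then exp (- d / t) * inverse t ^ k else 0)"

lemma flat_exp_tendsto_0:
  assumes "d > 0" shows "(flat_exp d k \<longlongrightarrow> 0) (at_right 0)"
proof -
  have "((\<lambda>t::real. t ^ k / exp t) \<longlongrightarrow> 0) at_top"
    by (rule tendsto_power_div_exp_0)
  moreover have "filterlim (\<lambda>t. d * inverse t) at_top (at_right 0)"
    by (rule filterlim_tendsto_pos_mult_at_top[OF tendsto_const assms filterlim_inverse_at_top_right])
  ultimately have "((\<lambda>t. (d * inverse t) ^ k / exp (d * inverse t)) \<longlongrightarrow> 0) (at_right 0)"
    by (rule filterlim_compose)
  then have "((\<lambda>t. inverse d ^ k * ((d * inverse t) ^ k / exp (d * inverse t))) \<longlongrightarrow> inverse d ^ k * 0) (at_right 0)"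
    by (intro tendsto_intros)
  moreover have "\<forall>\<^sub>F t in at_right 0. inverse d ^ k * ((d * inverse t) ^ k / exp (d * inverse t)) = flat_exp d k t"
    unfolding eventually_at_right_field
    by (rule exI[of _ 1])
      (use assms in \<open>auto simp: flat_exp_def power_mult_distrib exp_minus field_simps\<close>)
  ultimately show ?thesis by (simp add: filterlim_cong)
qed

text \<open>At \<open>t = 0\<close> the difference quotient is the next member of the family, which tends to \<open>0\<close>.\<close>

lemma flat_exp_derivative:
  assumes d: "d > 0"
  shows "(flat_exp d k has_real_derivative d * flat_exp d (k+2) t - real k * flat_exp d (k+1) t) (at t)"
proof (cases t "0::real" rule: linorder_cases)
  case less
  have "((\<lambda>t. 0) has_real_derivative 0) (at t)" by simp
  then have "(flat_exp d k has_real_derivative 0) (at t)"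
    by (rule has_field_derivative_transform_within_open[where S="{..<0}"])
      (use less in \<open>auto simp: flat_exp_def\<close>)
  then show ?thesis using less by (simp add: flat_exp_def)
next
  case greater
  have "((\<lambda>t. exp (- d / t) * inverse t ^ k) has_real_derivative
      exp (- d / t) * (d / t^2) * inverse t ^ k
      + exp (- d / t) * (real k * inverse t ^ (k-1) * (- inverse (t^2)))) (at t)"
    by (rule derivative_eq_intros refl | use greater in \<open>simp add: power2_eq_square\<close>)+
  also have "exp (- d / t) * (d / t^2) * inverse t ^ k
      + exp (- d / t) * (real k * inverse t ^ (k-1) * (- inverse (t^2)))
     = d * flat_exp d (k+2) t - real k * flat_exp d (k+1) t"
    using greater by (cases k) (auto simp: flat_exp_def field_simps power2_eq_square)
  finally show ?thesis
    by (rule has_field_derivative_transform_within_open[where S="{0<..}"])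
      (use greater in \<open>auto simp: flat_exp_def\<close>)
next
  case equal
  have "((\<lambda>h. (flat_exp d k (0 + h) - flat_exp d k 0) / h) \<longlongrightarrow> 0) (at 0)"
    unfolding filterlim_at_split
  proof
    show "((\<lambda>h. (flat_exp d k (0 + h) - flat_exp d k 0) / h) \<longlongrightarrow> 0) (at_left 0)"
      by (rule tendsto_eventually) (auto simp: eventually_at_left_field flat_exp_def intro!: exI[of _ "-1"])
    have "\<forall>\<^sub>F h in at_right 0. flat_exp d (k+1) h = (flat_exp d k (0 + h) - flat_exp d k 0) / h"
      by (auto simp: eventually_at_right_field flat_exp_def field_simps intro!: exI[of _ "1"])
    from filterlim_cong[OF refl refl this] flat_exp_tendsto_0[OF d, of "k+1"]
    show "((\<lambda>h. (flat_exp d k (0 + h) - flat_exp d k 0) / h) \<longlongrightarrow> 0) (at_right 0)"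
      by simp
  qed
  then have "(flat_exp d k has_real_derivative 0) (at 0)"
    by (simp add: DERIV_def)
  then show ?thesis using equal by (simp add: flat_exp_def)
qed

lemma smooth_flat_exp:
  assumes "d > 0" shows "smooth (flat_exp d k)"
proof -
  have "times_cont_diff n (flat_exp d k)" for n
  proof (induction n arbitrary: k)
    case 0
    show ?case unfolding times_cont_diff.simps
      by (rule DERIV_continuous_on) (rule has_field_derivative_at_within[OF flat_exp_derivative[OF assms]])
  next
    case (Suc n)
    show ?case
    proof (rule times_cont_diff_SucI[OF flat_exp_derivative[OF assms, unfolded has_field_derivative_def]])
      fix b :: real assume "b \<in> Basis"
      have "times_cont_diff n (\<lambda>t. (d * b) * flat_exp d (k+2) t + (- b * real k) * flat_exp d (k+1) t)"
        by (intro times_cont_diff_add times_cont_diff_mult times_cont_diff_const Suc.IH)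
      then show "times_cont_diff n (\<lambda>t. (d * flat_exp d (k+2) t - real k * flat_exp d (k+1) t) * b)"
        by (simp add: algebra_simps)
    qed
  qed
  then show ?thesis by (simp add: smooth_def)
qed

lemma test_funI:
  assumes "smooth \<psi>" and "compact K" and "K \<subseteq> U" and "\<And>x. x \<notin> K \<Longrightarrow> \<psi> x = 0"
  shows "\<psi> \<in> test_fun U"
proof -
  have "closure {x. \<psi> x \<noteq> 0} \<subseteq> K"
    by (rule closure_minimal) (use assms compact_imp_closed in auto)
  then show ?thesis using assms(1,2,3) unfolding test_fun_def
    using compact_Int_closed[of K "closure {x. \<psi> x \<noteq> 0}"] by (auto simp: Int_absorb1)
qed

lemma test_fun_compact_support:
  assumes "\<psi> \<in> test_fun U"
  obtains K where "compact K" "K \<subseteq> U" "\<And>x. x \<notin> K \<Longrightarrow> \<psi> x = 0"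
  using assms closure_subset[of "{x. \<psi> x \<noteq> 0}"] unfolding test_fun_def by blast

lemma pderiv_test_fun:
  assumes "\<psi> \<in> test_fun U" and "b \<in> Basis"
  shows "pderiv b \<psi> \<in> test_fun U"
proof -
  obtain K where K: "compact K" "K \<subseteq> U" "\<And>x. x \<notin> K \<Longrightarrow> \<psi> x = 0"
    using test_fun_compact_support[OF assms(1)] by metis
  have sm: "smooth \<psi>" using assms(1) by (simp add: test_fun_def)
  show ?thesis
  proof (rule test_funI[OF smooth_pderiv[OF sm assms(2)] K(1,2)])
    fix x assume x: "x \<notin> K"
    have "((\<lambda>x. 0) has_derivative (\<lambda>v. 0)) (at x)" by simp
    then have "(\<psi> has_derivative (\<lambda>v. 0)) (at x)"
      by (rule has_derivative_transform_within_open[where s="- K"])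
        (use x K compact_imp_closed in auto)
    then show "pderiv b \<psi> x = 0" by (rule pderiv_eqI)
  qed
qed

section \<open>Integrals against test functions\<close>

lemma integrable_mult_bounded:
  fixes f g :: "'a \<Rightarrow> real"
  assumes "integrable M f" and "g \<in> borel_measurable M" and "\<And>x. x \<in> space M \<Longrightarrow> \<bar>g x\<bar> \<le> C"
  shows "integrable M (\<lambda>x. f x * g x)"
proof (rule Bochner_Integration.integrable_bound)
  show "integrable M (\<lambda>x. C * f x)" using assms(1) by simp
  show "(\<lambda>x. f x * g x) \<in> borel_measurable M" using assms by measurable
  show "AE x in M. norm (f x * g x) \<le> norm (C * f x)"
  proof (rule AE_I2)
    fix x assume "x \<in> space M"
    then have "\<bar>g x\<bar> \<le> \<bar>C\<bar>" using assms(3)[of x] by linarith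
    then have "\<bar>f x\<bar> * \<bar>g x\<bar> \<le> \<bar>f x\<bar> * \<bar>C\<bar>" by (rule mult_left_mono) simp
    then show "norm (f x * g x) \<le> norm (C * f x)"
      by (simp add: abs_mult mult.commute)
  qed
qed

text \<open>Differentiation under the integral sign. The difference quotients of \<open>K\<close> are dominated by \<open>C\<close>
  because of the mean value theorem.\<close>

lemma has_real_derivative_integral:
  fixes f :: "'a \<Rightarrow> real" and K K' :: "real \<Rightarrow> 'a \<Rightarrow> real"
  assumes f: "integrable M f" and e: "e > 0"
    and K: "\<And>t. \<bar>t - t0\<bar> < e \<Longrightarrow> integrable M (\<lambda>x. f x * K t x)"
    and K': "K' t0 \<in> borel_measurable M"
    and der: "\<And>t x. x \<in> space M \<Longrightarrow> \<bar>t - t0\<bar> < e \<Longrightarrow>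
        ((\<lambda>t. K t x) has_real_derivative K' t x) (at t)"
    and bd: "\<And>t x. x \<in> space M \<Longrightarrow> \<bar>t - t0\<bar> < e \<Longrightarrow> \<bar>K' t x\<bar> \<le> C"
  shows "((\<lambda>t. \<integral>x. f x * K t x \<partial>M) has_real_derivative (\<integral>x. f x * K' t0 x \<partial>M)) (at t0)"
  unfolding DERIV_def tendsto_at_iff_sequentially
proof (intro allI impI)
  fix X :: "nat \<Rightarrow> real"
  assume X: "\<forall>i. X i \<in> UNIV - {0}" "X \<longlonglongrightarrow> 0"
  \<comment> \<open>The mean value bound holds only for small increments; the value for the others is irrelevant
    to the limit and keeps the whole sequence dominated.\<close>
  define s where "s i x = (if \<bar>X i\<bar> < e then (f x * K (t0 + X i) x - f x * K t0 x) / X i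
    else f x * K' t0 x)" for i x
  have intK: "integrable M (\<lambda>x. f x * K (t0 + h) x)" if "\<bar>h\<bar> < e" for h
    using K[of "t0 + h"] that by simp
  have K0: "integrable M (\<lambda>x. f x * K t0 x)" using K[of t0] e by simp
  have fm: "f \<in> borel_measurable M" using f by simp
  have near: "\<forall>\<^sub>F i in sequentially. \<bar>X i\<bar> < e"
    using tendstoD[OF X(2) e] by (simp add: dist_real_def)
  have quot: "\<bar>f x * K (t0 + h) x - f x * K t0 x\<bar> \<le> C * \<bar>f x\<bar> * \<bar>h\<bar>"
    if x: "x \<in> space M" and h: "\<bar>h\<bar> < e" for x h
  proof -
    have "norm (K (t0 + h) x - K t0 x) \<le> C * norm (t0 + h - t0)"
    proof (rule field_differentiable_bound[where S="{t0-\<bar>h\<bar>..t0+\<bar>h\<bar>}" and f'="\<lambda>t. K' t x"])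
      fix z assume z: "z \<in> {t0-\<bar>h\<bar>..t0+\<bar>h\<bar>}"
      then have z: "\<bar>z - t0\<bar> < e" using h by auto
      show "((\<lambda>t. K t x) has_real_derivative K' z x) (at z within {t0-\<bar>h\<bar>..t0+\<bar>h\<bar>})"
        by (rule has_field_derivative_at_within[OF der[OF x z]])
      show "norm (K' z x) \<le> C" using bd[OF x z] by simp
    qed auto
    then have "\<bar>f x\<bar> * \<bar>K (t0 + h) x - K t0 x\<bar> \<le> \<bar>f x\<bar> * (C * \<bar>h\<bar>)"
      by (intro mult_left_mono) auto
    then show ?thesis
      by (simp add: abs_mult[symmetric] right_diff_distrib algebra_simps)
  qed
  have "(\<lambda>i. \<integral>x. s i x \<partial>M) \<longlonglongrightarrow> (\<integral>x. f x * K' t0 x \<partial>M)"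
  proof (rule integral_dominated_convergence[where w="\<lambda>x. C * \<bar>f x\<bar>"])
    show "(\<lambda>x. f x * K' t0 x) \<in> borel_measurable M" using fm K' by measurable
    show "integrable M (\<lambda>x. C * \<bar>f x\<bar>)" using f by simp
    fix i
    show "s i \<in> borel_measurable M"
    proof (cases "\<bar>X i\<bar> < e")
      case True
      then have "integrable M (s i)"
        unfolding s_def using intK[OF True] K0 by simp
      then show ?thesis by simp
    next
      case False
      then show ?thesis unfolding s_def using fm K' by simp
    qed
    show "AE x in M. norm (s i x) \<le> C * \<bar>f x\<bar>"
    proof (rule AE_I2)
      fix x assume x: "x \<in> space M"
      show "norm (s i x) \<le> C * \<bar>f x\<bar>"
      proof (cases "\<bar>X i\<bar> < e")
        case True
        have "X i \<noteq> 0" using X by auto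
        then show ?thesis using quot[OF x True] True
          by (simp add: s_def divide_simps)
      next
        case False
        have "\<bar>K' t0 x\<bar> \<le> C" using bd[OF x, of t0] e by simp
        then have "\<bar>f x\<bar> * \<bar>K' t0 x\<bar> \<le> \<bar>f x\<bar> * C" by (intro mult_left_mono) auto
        then show ?thesis using False by (simp add: s_def abs_mult mult.commute)
      qed
    qed
  next
    show "AE x in M. (\<lambda>i. s i x) \<longlonglongrightarrow> f x * K' t0 x"
    proof (rule AE_I2)
      fix x assume x: "x \<in> space M"
      have "((\<lambda>h. (K (t0 + h) x - K t0 x) / h) \<longlongrightarrow> K' t0 x) (at 0)"
        using der[OF x, of t0] e by (simp add: DERIV_def)
      then have "(\<lambda>i. (K (t0 + X i) x - K t0 x) / X i) \<longlonglongrightarrow> K' t0 x"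
        using X unfolding tendsto_at_iff_sequentially o_def by blast
      then have "(\<lambda>i. f x * ((K (t0 + X i) x - K t0 x) / X i)) \<longlonglongrightarrow> f x * K' t0 x"
        by (intro tendsto_intros)
      moreover have "\<forall>\<^sub>F i in sequentially. f x * ((K (t0 + X i) x - K t0 x) / X i) = s i x"
        using near by eventually_elim (simp add: s_def algebra_simps)
      ultimately show "(\<lambda>i. s i x) \<longlonglongrightarrow> f x * K' t0 x"
        by (rule Lim_transform_eventually)
    qed
  qed
  moreover have "\<forall>\<^sub>F i in sequentially. (\<integral>x. s i x \<partial>M) =
      ((\<lambda>h. ((\<integral>x. f x * K (t0 + h) x \<partial>M) - (\<integral>x. f x * K t0 x \<partial>M)) / h) \<circ> X) i"
    using near
  proof eventually_elim
    case (elim i)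
    show ?case unfolding s_def using elim intK[OF elim] K0 by simp
  qed
  ultimately show "((\<lambda>h. ((\<integral>x. f x * K (t0 + h) x \<partial>M) - (\<integral>x. f x * K t0 x \<partial>M)) / h) \<circ> X)
      \<longlonglongrightarrow> (\<integral>x. f x * K' t0 x \<partial>M)"
    by (rule Lim_transform_eventually)
qed

lemma smooth_measurable:
  assumes "open U" and "smooth f" shows "f \<in> borel_measurable (lebesgue_on U)"
  by (rule continuous_imp_measurable_on_sets_lebesgue)
    (use assms smooth_continuous_on in auto)

lemma test_fun_bounded:
  assumes "\<psi> \<in> test_fun U"
  obtains C where "\<And>x. \<bar>\<psi> x\<bar> \<le> C"
proof -
  obtain K where K: "compact K" "K \<subseteq> U" "\<And>x. x \<notin> K \<Longrightarrow> \<psi> x = 0"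
    using test_fun_compact_support[OF assms] by metis
  have "continuous_on K \<psi>" using assms smooth_continuous_on by (auto simp: test_fun_def)
  then have "bounded (\<psi> ` K)" using K compact_continuous_image compact_imp_bounded by blast
  then obtain B where B: "\<And>x. x \<in> K \<Longrightarrow> norm (\<psi> x) \<le> B" by (auto simp: bounded_iff)
  have "\<bar>\<psi> x\<bar> \<le> \<bar>B\<bar>" for x
    using B[of x] K(3)[of x] by (cases "x \<in> K") auto
  then show ?thesis using that by blast
qed

lemma smooth_flat_exp_affine:
  assumes "d > 0"
  shows "smooth (\<lambda>x::'a::euclidean_space. flat_exp d 0 (x \<bullet> v - c))"
    and "smooth (\<lambda>x::'a::euclidean_space. flat_exp d 0 (c - x \<bullet> v))"
  by (intro smooth_compose[OF smooth_flat_exp[OF assms]] smooth_diff smooth_const smooth_linear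
      bounded_linear_inner_left)+

lemma flat_exp_0_le_1: "0 < d \<Longrightarrow> 0 \<le> flat_exp d 0 t \<and> flat_exp d 0 t \<le> 1"
  by (simp add: flat_exp_def)

lemma flat_exp_0_limit:
  "(\<lambda>n. flat_exp (inverse (real (Suc n))) 0 t) \<longlonglongrightarrow> (if t > 0 then 1 else 0)"
proof (cases "t > 0")
  case True
  have "(\<lambda>n. exp (- inverse (real (Suc n)) / t)) \<longlonglongrightarrow> exp (- 0 / t)"
    by (intro tendsto_intros LIMSEQ_inverse_real_of_nat) (use True in auto)
  then show ?thesis using True by (simp add: flat_exp_def)
qed (simp add: flat_exp_def)

text \<open>The du Bois-Reymond lemma. The functions \<open>flat_exp d 0\<close> increase to the indicator of the positive
  half-line as \<open>d\<close> tends to \<open>0\<close>, so products of them are test functions that approximate the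
  indicator of any box whose closure lies in \<open>U\<close>. Hence \<open>f\<close> has integral \<open>0\<close> over all such boxes, and
  Lebesgue's differentiation theorem concludes.\<close>

lemma orthogonal_test_fun_imp_zero:
  fixes f :: "'a::euclidean_space \<Rightarrow> real"
  assumes U: "open U" and f: "integrable (lebesgue_on U) f"
    and orth: "\<And>\<psi>. \<psi> \<in> test_fun U \<Longrightarrow> (\<integral>x. f x * \<psi> x \<partial>lebesgue_on U) = 0"
  shows "AE x in lebesgue_on U. f x = 0"
proof -
  have Ul: "U \<in> sets lebesgue" using U by auto
  have box0: "(\<integral>x. f x * indicator (box p q) x \<partial>lebesgue_on U) = 0" if pq: "cbox p q \<subseteq> U" for p q
  proof -
    define B where "B n x = (\<Prod>i\<in>Basis. flat_exp (inverse (real (Suc n))) 0 (x \<bullet> i - p \<bullet> i)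
        * flat_exp (inverse (real (Suc n))) 0 (q \<bullet> i - x \<bullet> i))" for n and x :: 'a
    have smB: "smooth (B n)" for n
      unfolding B_def by (intro smooth_prod smooth_mult smooth_flat_exp_affine) auto
    have B01: "0 \<le> B n x \<and> B n x \<le> 1" for n x
      unfolding B_def
      by (intro conjI prod_nonneg prod_le_1) (auto simp: flat_exp_0_le_1 mult_le_one)
    have tB: "B n \<in> test_fun U" for n
    proof (rule test_funI[OF smB _ pq])
      fix x assume "x \<notin> cbox p q"
      then obtain i where "i \<in> Basis" "x \<bullet> i < p \<bullet> i \<or> q \<bullet> i < x \<bullet> i"
        by (auto simp: mem_box not_le)
      then show "B n x = 0"
        unfolding B_def by (intro prod_zero bexI[of _ i]) (auto simp: flat_exp_def)
    qed auto
    have lim: "(\<lambda>n. B n x) \<longlonglongrightarrow> indicator (box p q) x" for x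
    proof -
      have "(\<lambda>n. B n x) \<longlonglongrightarrow> (\<Prod>i\<in>Basis. (if x \<bullet> i - p \<bullet> i > 0 then 1 else 0)
        * (if q \<bullet> i - x \<bullet> i > 0 then 1 else 0))"
        unfolding B_def by (intro tendsto_intros flat_exp_0_limit)
      also have "(\<Prod>i\<in>Basis. (if x \<bullet> i - p \<bullet> i > 0 then 1 else 0)
        * (if q \<bullet> i - x \<bullet> i > 0 then 1 else 0)) = (indicator (box p q) x :: real)"
      proof (cases "x \<in> box p q")
        case True
        then show ?thesis by (auto simp: mem_box intro!: prod.neutral)
      next
        case False
        then obtain i where i: "i \<in> Basis" "\<not> (p \<bullet> i < x \<bullet> i \<and> x \<bullet> i < q \<bullet> i)"
          by (auto simp: mem_box)
        then show ?thesis using False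
          by (auto intro!: prod_zero bexI[of _ i])
      qed
      finally show ?thesis .
    qed
    have "(\<lambda>n. \<integral>x. f x * B n x \<partial>lebesgue_on U) \<longlonglongrightarrow> (\<integral>x. f x * indicator (box p q) x \<partial>lebesgue_on U)"
    proof (rule integral_dominated_convergence[where w="\<lambda>x. \<bar>f x\<bar>"])
      have fm[measurable]: "f \<in> borel_measurable (lebesgue_on U)" using f by simp
      have [measurable]: "B n \<in> borel_measurable (lebesgue_on U)" for n
        by (rule smooth_measurable[OF U smB])
      show "(\<lambda>x. f x * B i x) \<in> borel_measurable (lebesgue_on U)" for i
        by measurable
      have "(indicator (box p q) :: 'a \<Rightarrow> real) \<in> borel_measurable (lebesgue_on U)"
        by (rule borel_measurable_LIMSEQ_real[OF lim]) measurable
      then show "(\<lambda>x. f x * indicator (box p q) x) \<in> borel_measurable (lebesgue_on U)"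
        using fm by measurable
      show "integrable (lebesgue_on U) (\<lambda>x. \<bar>f x\<bar>)" using f by simp
      show "AE x in lebesgue_on U. (\<lambda>i. f x * B i x) \<longlonglongrightarrow> f x * indicator (box p q) x"
        by (intro AE_I2 tendsto_intros lim)
      show "AE x in lebesgue_on U. norm (f x * B i x) \<le> \<bar>f x\<bar>" for i
        using B01 by (intro AE_I2) (auto simp: abs_mult mult_left_le)
    qed
    then show ?thesis using orth[OF tB] by (simp add: LIMSEQ_const_iff)
  qed
  define F where "F x = (if x \<in> U then f x else 0)" for x
  have Fint: "integrable lebesgue F"
    unfolding F_def using f Lebesgue_Measure.integrable_restrict_UNIV[OF Ul, of f] by simp
  then have "F absolutely_integrable_on UNIV" by (simp add: set_integrable_def)
  then have "F integrable_on cbox p q" for p q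
    by (metis absolutely_integrable_on_def integrable_on_subcbox subset_UNIV)
  then obtain N where N: "negligible N" "\<And>x e. \<lbrakk>x \<notin> N; 0 < e\<rbrakk> \<Longrightarrow>
      \<exists>d>0. \<forall>h. 0 < h \<and> h < d \<longrightarrow>
        norm (integral (cbox x (x + h *\<^sub>R One)) F /\<^sub>R h ^ DIM('a) - F x) < e"
    using integrable_ccontinuous_explicit[of F] by metis
  have int0: "integral (cbox p q) F = 0" if pq: "cbox p q \<subseteq> U" for p q
  proof -
    have "integral (cbox p q) F = integral (box p q) F"
      by (simp add: integral_open_interval)
    also have "\<dots> = (\<integral>x. F x \<partial>lebesgue_on (box p q))"
    proof (rule lebesgue_integral_eq_integral[symmetric])
      show "integrable (lebesgue_on (box p q)) F"
        using integrable_mult_indicator[OF _ Fint, of "box p q"] by (simp add: integrable_restrict_space)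
    qed simp
    also have "\<dots> = (\<integral>x. indicator (box p q) x * F x \<partial>lebesgue)"
      by (simp add: integral_restrict_space)
    also have "(\<lambda>x. indicator (box p q) x * F x)
      = (\<lambda>x. if x \<in> U then f x * indicator (box p q) x else 0)"
      by (auto simp: F_def indicator_def)
    also have "(\<integral>x. (if x \<in> U then f x * indicator (box p q) x else 0) \<partial>lebesgue)
        = (\<integral>x. f x * indicator (box p q) x \<partial>lebesgue_on U)"
      by (rule Lebesgue_Measure.integral_restrict_UNIV[OF Ul])
    finally show ?thesis using box0[OF pq] by simp
  qed
  have "F x = 0" if x: "x \<in> U" "x \<notin> N" for x
  proof (rule ccontr)
    assume "F x \<noteq> 0"
    then obtain d where d: "d > 0" "\<And>h. 0 < h \<Longrightarrow> h < d \<Longrightarrow>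
        norm (integral (cbox x (x + h *\<^sub>R One)) F /\<^sub>R h ^ DIM('a) - F x) < \<bar>F x\<bar>"
      using N(2)[OF x(2), of "\<bar>F x\<bar>"] by auto
    obtain r where r: "r > 0" "ball x r \<subseteq> U" using U x openE by blast
    define h where "h = min (d/2) (r / (2 * norm (One::'a)))"
    have One: "norm (One::'a) > 0"
      by (metis One_non_0 zero_less_norm_iff)
    have h: "0 < h" "h < d" "h * norm (One::'a) < r"
      using d(1) r(1) One by (auto simp: h_def min_def field_simps)
    have "cbox x (x + h *\<^sub>R One) \<subseteq> ball x r"
    proof
      fix y assume y: "y \<in> cbox x (x + h *\<^sub>R One)"
      have "norm (y - x) \<le> norm (h *\<^sub>R One :: 'a)"
        by (rule norm_le_componentwise) (use y h(1) in \<open>auto simp: mem_box inner_diff_left inner_add_left\<close>)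
      then show "y \<in> ball x r" using h by (simp add: dist_norm norm_minus_commute)
    qed
    then have "integral (cbox x (x + h *\<^sub>R One)) F = 0" using int0 r by blast
    then show False using d(2)[OF h(1,2)] by simp
  qed
  then have "AE x in lebesgue. x \<in> U \<longrightarrow> f x = 0"
    using N(1) by (intro AE_I'[of N]) (auto simp: negligible_iff_null_sets F_def)
  then show ?thesis using Ul by (simp add: AE_restrict_space_iff)
qed

lemma L2_mult_integrable:
  assumes "f \<in> L2 U" "g \<in> L2 U"
  shows "integrable (lebesgue_on U) (\<lambda>x. f x * g x)"
proof (rule Bochner_Integration.integrable_bound)
  show "integrable (lebesgue_on U) (\<lambda>x. (f x)\<^sup>2 + (g x)\<^sup>2)" using assms by (auto simp: L2_def)
  show "(\<lambda>x. f x * g x) \<in> borel_measurable (lebesgue_on U)" using assms by (auto simp: L2_def)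
  show "AE x in lebesgue_on U. norm (f x * g x) \<le> norm ((f x)\<^sup>2 + (g x)\<^sup>2)"
  proof (rule AE_I2)
    fix x
    have "0 \<le> (\<bar>f x\<bar> - \<bar>g x\<bar>)\<^sup>2 + \<bar>f x\<bar> * \<bar>g x\<bar>" by simp
    then show "norm (f x * g x) \<le> norm ((f x)\<^sup>2 + (g x)\<^sup>2)"
      by (simp add: power2_diff abs_mult)
  qed
qed

lemma L2_integrable:
  assumes "open U" "bounded U" "f \<in> L2 U"
  shows "integrable (lebesgue_on U) f"
proof -
  have "U \<in> lmeasurable" using assms by (simp add: lmeasurable_open)
  then interpret finite_measure "lebesgue_on U" by (rule finite_measure_lebesgue_on)
  have "(\<lambda>x. 1) \<in> L2 U" by (auto simp: L2_def)
  from L2_mult_integrable[OF assms(3) this] show ?thesis by simp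
qed

section \<open>Radial moments of a Laplace eigenfunction\<close>

text \<open>Both derivatives are moved to the test function; this very weak form of \<open>\<Delta>\<phi> + lam \<phi> = 0\<close> is
  the form in which the equation enters unique continuation.\<close>

lemma dirichlet_eigenfunction_test_identity:
  fixes \<phi> :: "'a::euclidean_space \<Rightarrow> real"
  assumes U: "open U" "bounded U" and dl: "dirichlet_laplacian U \<phi> (\<lambda>x. lam * \<phi> x)"
    and psi: "\<psi> \<in> test_fun U"
  shows "(\<integral>x. \<phi> x * ((\<Sum>b\<in>Basis. pderiv b (pderiv b \<psi>) x) + lam * \<psi> x) \<partial>lebesgue_on U) = 0"
proof -
  obtain G where G: "\<And>b. b \<in> Basis \<Longrightarrow> weak_pderiv U b \<phi> (G b)"
    and eq: "\<And>\<psi>. \<psi> \<in> test_fun U \<Longrightarrow>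
      (\<Sum>b\<in>Basis. L2_inner U (G b) (pderiv b \<psi>)) = L2_inner U (\<lambda>x. lam * \<phi> x) \<psi>"
    using dl unfolding dirichlet_laplacian_def by blast
  have "\<phi> \<in> L2 U" using dl by (auto simp: dirichlet_laplacian_def H10_def H1_def)
  then have int: "integrable (lebesgue_on U) \<phi>" by (rule L2_integrable[OF U])
  have intt: "integrable (lebesgue_on U) (\<lambda>x. \<phi> x * \<eta> x)" if "\<eta> \<in> test_fun U" for \<eta>
  proof -
    obtain C where "\<And>x. \<bar>\<eta> x\<bar> \<le> C" using test_fun_bounded[OF \<open>\<eta> \<in> test_fun U\<close>] by metis
    then show ?thesis
      using that by (intro integrable_mult_bounded[OF int] smooth_measurable[OF U(1)]) (auto simp: test_fun_def)
  qed
  have t2: "pderiv b (pderiv b \<psi>) \<in> test_fun U" if "b \<in> Basis" for b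
    using pderiv_test_fun[OF pderiv_test_fun[OF psi that] that] .
  have "(\<integral>x. \<phi> x * ((\<Sum>b\<in>Basis. pderiv b (pderiv b \<psi>) x) + lam * \<psi> x) \<partial>lebesgue_on U)
    = (\<integral>x. (\<Sum>b\<in>Basis. \<phi> x * pderiv b (pderiv b \<psi>) x) + lam * (\<phi> x * \<psi> x) \<partial>lebesgue_on U)"
    by (simp add: distrib_left sum_distrib_left mult.left_commute)
  also have "\<dots> = (\<Sum>b\<in>Basis. \<integral>x. \<phi> x * pderiv b (pderiv b \<psi>) x \<partial>lebesgue_on U)
      + lam * (\<integral>x. \<phi> x * \<psi> x \<partial>lebesgue_on U)"
    using intt[OF psi] intt[OF t2] by (simp add: integral_add integral_sum)
  also have "(\<Sum>b\<in>Basis. \<integral>x. \<phi> x * pderiv b (pderiv b \<psi>) x \<partial>lebesgue_on U)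
     = (\<Sum>b\<in>Basis. - L2_inner U (G b) (pderiv b \<psi>))"
  proof (rule sum.cong[OF refl])
    fix b :: 'a assume b: "b \<in> Basis"
    show "(\<integral>x. \<phi> x * pderiv b (pderiv b \<psi>) x \<partial>lebesgue_on U) = - L2_inner U (G b) (pderiv b \<psi>)"
      using G[OF b] pderiv_test_fun[OF psi b] by (simp add: weak_pderiv_def L2_inner_def)
  qed
  also have "\<dots> = - (lam * (\<integral>x. \<phi> x * \<psi> x \<partial>lebesgue_on U))"
    using eq[OF psi] by (simp add: sum_negf L2_inner_def mult.assoc)
  finally show ?thesis by simp
qed

text \<open>The truncated power \<open>t\<^sub>+ ^ k\<close>. For \<open>k = 0\<close> it is the indicator of the positive half-line
  rather than the constant \<open>1\<close>.\<close>

definition pos_power :: "nat \<Rightarrow> real \<Rightarrow> real" where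
  "pos_power k t = (if t > 0 then t ^ k else 0)"

lemma pos_power_measurable[measurable]: "pos_power k \<in> borel_measurable borel"
  unfolding pos_power_def[abs_def] by measurable

lemma pos_power_bound: "t \<le> T \<Longrightarrow> 0 \<le> pos_power k t \<and> pos_power k t \<le> \<bar>T\<bar> ^ k"
  by (auto simp: pos_power_def intro!: power_mono)

lemma pos_power_derivative:
  assumes "k \<ge> 2"
  shows "(pos_power k has_real_derivative real k * pos_power (k - 1) t) (at t)"
proof (cases t "0::real" rule: linorder_cases)
  case less
  have "((\<lambda>t. 0) has_real_derivative 0) (at t)" by simp
  then have "(pos_power k has_real_derivative 0) (at t)"
    by (rule has_field_derivative_transform_within_open[where S="{..<0}"])
      (use less in \<open>auto simp: pos_power_def\<close>)
  then show ?thesis using less by (simp add: pos_power_def)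
next
  case greater
  have "((\<lambda>t. t ^ k) has_real_derivative real k * t ^ (k - 1)) (at t)"
    by (auto intro!: derivative_eq_intros)
  then have "(pos_power k has_real_derivative real k * t ^ (k - 1)) (at t)"
    by (rule has_field_derivative_transform_within_open[where S="{0<..}"])
      (use greater in \<open>auto simp: pos_power_def\<close>)
  then show ?thesis using greater by (simp add: pos_power_def)
next
  case equal
  have "((\<lambda>h. (pos_power k (0 + h) - pos_power k 0) / h) \<longlongrightarrow> 0) (at 0)"
  proof (rule Lim_null_comparison)
    have "\<bar>pos_power k h / h\<bar> \<le> \<bar>h\<bar> ^ (k - 1)" for h
    proof (cases "h > 0")
      case True
      then show ?thesis using assms by (cases k) (auto simp: pos_power_def)
    qed (simp add: pos_power_def)
    then show "\<forall>\<^sub>F h in at 0. norm ((pos_power k (0 + h) - pos_power k 0) / h) \<le> \<bar>h\<bar> ^ (k - 1)"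
      by (auto simp: pos_power_def)
    have "((\<lambda>h::real. \<bar>h\<bar> ^ (k - 1)) \<longlongrightarrow> \<bar>0\<bar> ^ (k - 1)) (at 0)"
      by (intro tendsto_intros)
    then show "((\<lambda>h::real. \<bar>h\<bar> ^ (k - 1)) \<longlongrightarrow> 0) (at 0)"
      using assms by (simp add: power_0_left split: if_splits)
  qed
  then have "(pos_power k has_real_derivative 0) (at 0)"
    by (simp add: DERIV_def)
  then show ?thesis using equal by (simp add: pos_power_def)
qed

lemma borel_imp_lebesgue_on:
  "f \<in> borel_measurable borel \<Longrightarrow> f \<in> borel_measurable (lebesgue_on U)"
  by (intro measurable_restrict_space1 measurable_completion) simp

text \<open>As a function of \<open>r\<close> this is, up to a factor, the \<open>k\<close>-fold primitive of the integral of \<open>\<phi>\<close> over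
  the ball of radius \<open>sqrt r\<close> about \<open>x\<close>. The variable is the squared radius, since
  \<open>|y - x|\<^sup>2\<close> is a polynomial in \<open>x\<close> and \<open>y\<close> and has no singularity at the centre.\<close>

definition radial_moment :: "'a::euclidean_space set \<Rightarrow> ('a \<Rightarrow> real) \<Rightarrow> nat \<Rightarrow> 'a \<Rightarrow> real \<Rightarrow> real" where
  "radial_moment U \<phi> k x r = (\<integral>y. \<phi> y * pos_power k (r - (norm (y - x))\<^sup>2) \<partial>lebesgue_on U)"

text \<open>A truncated power, damped at \<open>0\<close> so as to be smooth; \<open>d\<close> tends to \<open>0\<close> in the application.\<close>

definition damped_power :: "real \<Rightarrow> nat \<Rightarrow> real \<Rightarrow> real" where
  "damped_power d k t = t ^ k * flat_exp d 0 t"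

lemma smooth_damped_power: "d > 0 \<Longrightarrow> smooth (damped_power d k)"
  unfolding damped_power_def[abs_def]
  by (intro smooth_mult smooth_power smooth_linear smooth_flat_exp bounded_linear_ident)

lemma damped_power_Suc: "damped_power d (Suc k) t = t * damped_power d k t"
  by (simp add: damped_power_def)

lemma damped_power_derivative:
  assumes "d > 0" "k \<ge> 2"
  shows "(damped_power d k has_real_derivative real k * damped_power d (k - 1) t + d * damped_power d (k - 2) t) (at t)"
proof -
  have D: "(flat_exp d 0 has_real_derivative d * flat_exp d 2 t) (at t)"
    using flat_exp_derivative[OF assms(1), of 0 t] by (simp add: numeral_2_eq_2)
  have "(damped_power d k has_real_derivative
      real k * t ^ (k - 1) * flat_exp d 0 t + (d * flat_exp d 2 t) * t ^ k) (at t)"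
    unfolding damped_power_def[abs_def] by (auto intro!: derivative_eq_intros D)
  moreover have "flat_exp d 2 t * t ^ k = damped_power d (k - 2) t"
  proof -
    obtain m where "k = m + 2" using assms(2) by (metis add.commute le_Suc_ex)
    then show ?thesis by (auto simp: damped_power_def flat_exp_def power2_eq_square field_simps)
  qed
  ultimately show ?thesis by (simp add: damped_power_def mult.assoc)
qed

lemma damped_power_bound: "d > 0 \<Longrightarrow> \<bar>damped_power d k t\<bar> \<le> pos_power k t"
  by (auto simp: damped_power_def pos_power_def flat_exp_def abs_mult mult_left_le)

lemma damped_power_limit: "(\<lambda>n. damped_power (inverse (real (Suc n))) k t) \<longlonglongrightarrow> pos_power k t"
proof -
  have "(\<lambda>n. t ^ k * flat_exp (inverse (real (Suc n))) 0 t) \<longlonglongrightarrow> t ^ k * (if t > 0 then 1 else 0)"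
    by (intro tendsto_intros flat_exp_0_limit)
  then show ?thesis by (simp add: damped_power_def pos_power_def if_distrib cong: if_cong)
qed

lemma norm_sq_derivative:
  "((\<lambda>y. r - (norm (y - x))\<^sup>2) has_derivative (\<lambda>v. - (2 * ((y - x) \<bullet> v)))) (at y)"
  for x :: "'a::euclidean_space"
  unfolding power2_norm_eq_inner
  by (auto intro!: derivative_eq_intros simp: inner_commute)

lemma norm_sq_eq_sum: "(norm v)\<^sup>2 = (\<Sum>b\<in>Basis. (v \<bullet> b)\<^sup>2)" for v :: "'a::euclidean_space"
  unfolding power2_norm_eq_inner by (subst euclidean_inner) (simp add: power2_eq_square)

lemma smooth_norm_sq: "smooth (\<lambda>y. r - (norm (y - x))\<^sup>2)" for x :: "'a::euclidean_space"
proof -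
  have "(\<lambda>y. r - (norm (y - x))\<^sup>2) = (\<lambda>y. r - (\<Sum>b\<in>Basis. (y \<bullet> b - x \<bullet> b) ^ 2))"
    by (simp add: norm_sq_eq_sum inner_diff_left)
  then show ?thesis
    by (simp only:) (intro smooth_diff smooth_sum smooth_power smooth_const smooth_linear[OF bounded_linear_inner_left])
qed

text \<open>For \<open>\<psi>(y) = p(r - \<rho>)\<close> with \<open>\<rho> = |y - x|\<^sup>2\<close> the Laplacian is \<open>4 \<rho> p'' - 2 n p'\<close>. Writing
  \<open>\<rho> = r - (r - \<rho>)\<close> turns every term into a multiple of a damped power of \<open>r - \<rho>\<close>, because
  multiplication by \<open>r - \<rho>\<close> raises the exponent by one. The test function exists since \<open>p\<close> vanishes
  outside the ball of radius \<open>sqrt r\<close>.\<close>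

lemma damped_radial_recurrence:
  fixes \<phi> :: "'a::euclidean_space \<Rightarrow> real" and d :: real
  assumes U: "open U" "bounded U" and dl: "dirichlet_laplacian U \<phi> (\<lambda>x. lam * \<phi> x)"
    and sub: "cball x (sqrt r) \<subseteq> U" and r: "r \<ge> 0" and d: "d > 0" and j: "j \<ge> 4"
  defines "n \<equiv> real DIM('a)"
    and "M \<equiv> \<lambda>k. (\<integral>y. \<phi> y * damped_power d k (r - (norm (y - x))\<^sup>2) \<partial>lebesgue_on U)"
  shows "4 * r * (real j * real (j-1) * M (j-2) + d * (2 * real j - 2) * M (j-3) + d^2 * M (j-4))
    - 4 * (real j * real (j-1) * M (j-1) + d * (2 * real j - 2) * M (j-2) + d^2 * M (j-3))
    - 2 * n * (real j * M (j-1) + d * M (j-2)) + lam * M j = 0"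
proof -
  define u where "u y = r - (norm (y - x))\<^sup>2" for y
  define p1 where "p1 t = real j * damped_power d (j-1) t + d * damped_power d (j-2) t" for t
  define p2 where "p2 t = real j * (real (j-1) * damped_power d (j-2) t + d * damped_power d (j-3) t)
      + d * (real (j-2) * damped_power d (j-3) t + d * damped_power d (j-4) t)" for t
  define \<psi> where "\<psi> y = damped_power d j (u y)" for y
  have der0: "(damped_power d j has_real_derivative p1 t) (at t)" for t
    unfolding p1_def using damped_power_derivative[OF d, of j t] j by simp
  have j3: "j - 1 - 1 = j - 2" "j - 1 - 2 = j - 3" "j - 2 - 1 = j - 3" "j - 2 - 2 = j - 4"
    using j by auto
  have der1: "(p1 has_real_derivative p2 t) (at t)" for t
  proof -
    have a: "(damped_power d (j-1) has_real_derivative real (j-1) * damped_power d (j-2) t + d * damped_power d (j-3) t) (at t)"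
      using damped_power_derivative[OF d, of "j-1" t, unfolded j3] j by linarith
    have b: "(damped_power d (j-2) has_real_derivative real (j-2) * damped_power d (j-3) t + d * damped_power d (j-4) t) (at t)"
      using damped_power_derivative[OF d, of "j-2" t, unfolded j3] j by linarith
    show ?thesis unfolding p1_def[abs_def] p2_def
      by (intro DERIV_add DERIV_cmult a b)
  qed
  have sm: "smooth \<psi>"
    unfolding \<psi>_def[abs_def] u_def[abs_def] by (intro smooth_compose[OF smooth_damped_power[OF d]] smooth_norm_sq)
  have test: "\<psi> \<in> test_fun U"
  proof (rule test_funI[OF sm _ sub])
    fix y assume "y \<notin> cball x (sqrt r)"
    then have "sqrt r < norm (y - x)" by (simp add: dist_norm norm_minus_commute)
    then have "r < (norm (y - x))\<^sup>2"
      using power_strict_mono[of "sqrt r" "norm (y - x)" 2] r by simp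
    then show "\<psi> y = 0" by (simp add: \<psi>_def u_def damped_power_def flat_exp_def)
  qed auto
  have du: "(u has_derivative (\<lambda>v. - (2 * ((y - x) \<bullet> v)))) (at y)" for y
    unfolding u_def[abs_def] by (rule norm_sq_derivative)
  have pd1: "pderiv b \<psi> y = p1 (u y) * (- 2 * ((y - x) \<bullet> b))" for b y
    unfolding \<psi>_def[abs_def]
    using pderiv_eqI[OF diff_chain_at[unfolded o_def, OF du der0[unfolded has_field_derivative_def]]]
    by (simp add: algebra_simps)
  have pd2: "pderiv b (pderiv b \<psi>) y = p2 (u y) * (4 * ((y - x) \<bullet> b)^2) - 2 * p1 (u y)"
    if b: "b \<in> Basis" for b y
  proof -
    have e: "pderiv b \<psi> = (\<lambda>y. p1 (u y) * (- 2 * ((y - x) \<bullet> b)))" using pd1 by blast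
    have "((\<lambda>y. p1 (u y)) has_derivative (\<lambda>v. p2 (u y) * (- (2 * ((y - x) \<bullet> v))))) (at y)"
      by (rule diff_chain_at[unfolded o_def, OF du der1[unfolded has_field_derivative_def]])
    moreover have "((\<lambda>y. - 2 * ((y - x) \<bullet> b)) has_derivative (\<lambda>v. - 2 * (v \<bullet> b))) (at y)"
      by (auto intro!: derivative_eq_intros)
    ultimately have "((\<lambda>y. p1 (u y) * (- 2 * ((y - x) \<bullet> b))) has_derivative
      (\<lambda>v. p1 (u y) * (- 2 * (v \<bullet> b)) + p2 (u y) * (- (2 * ((y - x) \<bullet> v))) * (- 2 * ((y - x) \<bullet> b)))) (at y)"
      by (rule has_derivative_mult)
    from pderiv_eqI[OF this, of b] show ?thesis
      unfolding e using b by (simp add: power2_eq_square algebra_simps)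
  qed
  have lap: "(\<Sum>b\<in>Basis. pderiv b (pderiv b \<psi>) y) = 4 * (r - u y) * p2 (u y) - 2 * n * p1 (u y)" for y
  proof -
    have "(\<Sum>b\<in>Basis. ((y - x) \<bullet> b)^2) = r - u y"
      by (simp add: u_def norm_sq_eq_sum)
    moreover have "(\<Sum>b\<in>Basis. pderiv b (pderiv b \<psi>) y)
      = 4 * p2 (u y) * (\<Sum>b\<in>Basis. ((y - x) \<bullet> b)^2) - 2 * n * p1 (u y)"
      by (simp add: pd2 sum_subtractf sum_distrib_left n_def algebra_simps)
    ultimately show ?thesis by (simp only: mult.commute mult.left_commute)
  qed
  have Sj: "j - 1 = Suc (j - 2)" "j - 2 = Suc (j - 3)" "j - 3 = Suc (j - 4)" using j by auto
  \<comment> \<open>The factor \<open>t\<close> is absorbed by raising each exponent by one; exponents down to \<open>j - 4\<close> occur,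
    whence \<open>j \<ge> 4\<close>.\<close>
  have tp2: "t * p2 t = real j * real (j-1) * damped_power d (j-1) t + d * (2 * real j - 2) * damped_power d (j-2) t
      + d^2 * damped_power d (j-3) t" for t
  proof -
    have c: "t * damped_power d (j-2) t = damped_power d (j-1) t" "t * damped_power d (j-3) t = damped_power d (j-2) t"
      "t * damped_power d (j-4) t = damped_power d (j-3) t"
      using Sj damped_power_Suc by metis+
    have "t * p2 t = real j * (real (j-1) * (t * damped_power d (j-2) t) + d * (t * damped_power d (j-3) t))
      + d * (real (j-2) * (t * damped_power d (j-3) t) + d * (t * damped_power d (j-4) t))"
      unfolding p2_def by (simp add: algebra_simps)
    then show ?thesis unfolding c using j by (simp add: of_nat_diff power2_eq_square algebra_simps)
  qed
  have p2': "p2 t = real j * real (j-1) * damped_power d (j-2) t + d * (2 * real j - 2) * damped_power d (j-3) t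
      + d^2 * damped_power d (j-4) t" for t
    unfolding p2_def using j by (simp add: of_nat_diff power2_eq_square algebra_simps)
  have "\<phi> \<in> L2 U" using dl by (auto simp: dirichlet_laplacian_def H10_def H1_def)
  then have int: "integrable (lebesgue_on U) \<phi>" by (rule L2_integrable[OF U])
  have intM: "integrable (lebesgue_on U) (\<lambda>y. \<phi> y * damped_power d k (u y))" for k
  proof (rule integrable_mult_bounded[OF int])
    show "(\<lambda>y. damped_power d k (u y)) \<in> borel_measurable (lebesgue_on U)"
      unfolding u_def[abs_def] by (intro smooth_measurable[OF U(1)] smooth_compose[OF smooth_damped_power[OF d]] smooth_norm_sq)
    show "\<bar>damped_power d k (u y)\<bar> \<le> \<bar>r\<bar> ^ k" for y
      using damped_power_bound[OF d, of k "u y"] pos_power_bound[of "u y" r k] by (simp add: u_def)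
  qed
  have "0 = (\<integral>y. \<phi> y * ((\<Sum>b\<in>Basis. pderiv b (pderiv b \<psi>) y) + lam * \<psi> y) \<partial>lebesgue_on U)"
    using dirichlet_eigenfunction_test_identity[OF U dl test] by simp
  also have "(\<lambda>y. \<phi> y * ((\<Sum>b\<in>Basis. pderiv b (pderiv b \<psi>) y) + lam * \<psi> y))
    = (\<lambda>y. 4 * r * (real j * real (j-1) * (\<phi> y * damped_power d (j-2) (u y)) + d * (2 * real j - 2) * (\<phi> y * damped_power d (j-3) (u y))
           + d^2 * (\<phi> y * damped_power d (j-4) (u y)))
      - 4 * (real j * real (j-1) * (\<phi> y * damped_power d (j-1) (u y)) + d * (2 * real j - 2) * (\<phi> y * damped_power d (j-2) (u y))
           + d^2 * (\<phi> y * damped_power d (j-3) (u y)))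
      - 2 * n * (real j * (\<phi> y * damped_power d (j-1) (u y)) + d * (\<phi> y * damped_power d (j-2) (u y)))
      + lam * (\<phi> y * damped_power d j (u y)))"
  proof
    fix y
    have "\<phi> y * ((\<Sum>b\<in>Basis. pderiv b (pderiv b \<psi>) y) + lam * \<psi> y)
      = \<phi> y * (4 * r * p2 (u y) - 4 * (u y * p2 (u y)) - 2 * n * p1 (u y) + lam * damped_power d j (u y))"
      unfolding lap \<psi>_def by (simp add: algebra_simps)
    then show "\<phi> y * ((\<Sum>b\<in>Basis. pderiv b (pderiv b \<psi>) y) + lam * \<psi> y) =
      4 * r * (real j * real (j-1) * (\<phi> y * damped_power d (j-2) (u y)) + d * (2 * real j - 2) * (\<phi> y * damped_power d (j-3) (u y))
           + d^2 * (\<phi> y * damped_power d (j-4) (u y)))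
      - 4 * (real j * real (j-1) * (\<phi> y * damped_power d (j-1) (u y)) + d * (2 * real j - 2) * (\<phi> y * damped_power d (j-2) (u y))
           + d^2 * (\<phi> y * damped_power d (j-3) (u y)))
      - 2 * n * (real j * (\<phi> y * damped_power d (j-1) (u y)) + d * (\<phi> y * damped_power d (j-2) (u y)))
      + lam * (\<phi> y * damped_power d j (u y))"
      unfolding tp2 unfolding p2' p1_def by (simp add: algebra_simps)
  qed
  also have "(\<integral>y. \<dots> y \<partial>lebesgue_on U) =
    4 * r * (real j * real (j-1) * M (j-2) + d * (2 * real j - 2) * M (j-3) + d^2 * M (j-4))
    - 4 * (real j * real (j-1) * M (j-1) + d * (2 * real j - 2) * M (j-2) + d^2 * M (j-3))
    - 2 * n * (real j * M (j-1) + d * M (j-2)) + lam * M j"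
    unfolding M_def u_def[symmetric] using intM
    by simp
  finally show ?thesis by simp
qed

lemma pos_power_radial_measurable:
  "(\<lambda>y. pos_power k (r - (norm (y - x))\<^sup>2)) \<in> borel_measurable (lebesgue_on U)"
  for x :: "'a::euclidean_space"
  by (rule borel_imp_lebesgue_on) measurable

text \<open>The limit of the previous identity as the damping disappears: a second-order linear differential
  equation in \<open>r\<close> for the radial moment of order \<open>j\<close>, as lowering the order is differentiation.\<close>

lemma radial_moment_recurrence:
  fixes \<phi> :: "'a::euclidean_space \<Rightarrow> real"
  assumes U: "open U" "bounded U" and dl: "dirichlet_laplacian U \<phi> (\<lambda>x. lam * \<phi> x)"
    and sub: "cball x (sqrt r) \<subseteq> U" and r: "r \<ge> 0" and j: "j \<ge> 4"
  shows "4 * r * real j * real (j-1) * radial_moment U \<phi> (j-2) x r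
    - (4 * real j * real (j-1) + 2 * real DIM('a) * real j) * radial_moment U \<phi> (j-1) x r
    + lam * radial_moment U \<phi> j x r = 0"
proof -
  define d where "d m = inverse (real (Suc m))" for m
  define M where "M m k = (\<integral>y. \<phi> y * damped_power (d m) k (r - (norm (y - x))\<^sup>2) \<partial>lebesgue_on U)" for m k
  define N where "N k = radial_moment U \<phi> k x r" for k
  have d0: "d m > 0" for m by (simp add: d_def)
  have "\<phi> \<in> L2 U" using dl by (auto simp: dirichlet_laplacian_def H10_def H1_def)
  then have int: "integrable (lebesgue_on U) \<phi>" by (rule L2_integrable[OF U])
  have dlim: "d \<longlonglongrightarrow> 0" unfolding d_def by (rule LIMSEQ_inverse_real_of_nat)
  have Mlim: "(\<lambda>m. M m k) \<longlonglongrightarrow> N k" for k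
    unfolding M_def N_def radial_moment_def
  proof (rule integral_dominated_convergence[where w="\<lambda>y. \<bar>r\<bar> ^ k * \<bar>\<phi> y\<bar>"])
    have [measurable]: "\<phi> \<in> borel_measurable (lebesgue_on U)" using int by simp
    show "(\<lambda>y. \<phi> y * pos_power k (r - (norm (y - x))\<^sup>2)) \<in> borel_measurable (lebesgue_on U)"
      by (intro borel_measurable_times pos_power_radial_measurable) measurable
    show "(\<lambda>y. \<phi> y * damped_power (d m) k (r - (norm (y - x))\<^sup>2)) \<in> borel_measurable (lebesgue_on U)" for m
      using int by (intro borel_measurable_times[OF _ smooth_measurable[OF U(1)]]
          smooth_compose[OF smooth_damped_power[OF d0]] smooth_norm_sq) simp
    show "integrable (lebesgue_on U) (\<lambda>y. \<bar>r\<bar> ^ k * \<bar>\<phi> y\<bar>)" using int by simp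
    show "AE y in lebesgue_on U. (\<lambda>m. \<phi> y * damped_power (d m) k (r - (norm (y - x))\<^sup>2))
      \<longlonglongrightarrow> \<phi> y * pos_power k (r - (norm (y - x))\<^sup>2)"
      unfolding d_def by (intro AE_I2 tendsto_intros damped_power_limit)
    show "AE y in lebesgue_on U. norm (\<phi> y * damped_power (d m) k (r - (norm (y - x))\<^sup>2)) \<le> \<bar>r\<bar> ^ k * \<bar>\<phi> y\<bar>" for m
    proof (rule AE_I2)
      fix y
      have "\<bar>damped_power (d m) k (r - (norm (y - x))\<^sup>2)\<bar> \<le> \<bar>r\<bar> ^ k"
        using damped_power_bound[OF d0, of m k "r - (norm (y - x))\<^sup>2"] pos_power_bound[of "r - (norm (y - x))\<^sup>2" r k] by simp
      from mult_right_mono[OF this, of "\<bar>\<phi> y\<bar>"]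
      show "norm (\<phi> y * damped_power (d m) k (r - (norm (y - x))\<^sup>2)) \<le> \<bar>r\<bar> ^ k * \<bar>\<phi> y\<bar>"
        by (simp add: abs_mult mult.commute)
    qed
  qed
  have "(\<lambda>m. 4 * r * (real j * real (j-1) * M m (j-2) + d m * (2 * real j - 2) * M m (j-3) + (d m)^2 * M m (j-4))
    - 4 * (real j * real (j-1) * M m (j-1) + d m * (2 * real j - 2) * M m (j-2) + (d m)^2 * M m (j-3))
    - 2 * real DIM('a) * (real j * M m (j-1) + d m * M m (j-2)) + lam * M m j)
   \<longlonglongrightarrow> 4 * r * (real j * real (j-1) * N (j-2) + 0 * (2 * real j - 2) * N (j-3) + 0^2 * N (j-4))
    - 4 * (real j * real (j-1) * N (j-1) + 0 * (2 * real j - 2) * N (j-2) + 0^2 * N (j-3))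
    - 2 * real DIM('a) * (real j * N (j-1) + 0 * N (j-2)) + lam * N j"
    by (intro tendsto_intros Mlim dlim)
  moreover have "4 * r * (real j * real (j-1) * M m (j-2) + d m * (2 * real j - 2) * M m (j-3) + (d m)^2 * M m (j-4))
    - 4 * (real j * real (j-1) * M m (j-1) + d m * (2 * real j - 2) * M m (j-2) + (d m)^2 * M m (j-3))
    - 2 * real DIM('a) * (real j * M m (j-1) + d m * M m (j-2)) + lam * M m j = 0" for m
    unfolding M_def by (rule damped_radial_recurrence[OF U dl sub r d0 j])
  ultimately have "(\<lambda>m. 0) \<longlonglongrightarrow> 4 * r * (real j * real (j-1) * N (j-2) + 0 * (2 * real j - 2) * N (j-3) + 0^2 * N (j-4))
    - 4 * (real j * real (j-1) * N (j-1) + 0 * (2 * real j - 2) * N (j-2) + 0^2 * N (j-3))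
    - 2 * real DIM('a) * (real j * N (j-1) + 0 * N (j-2)) + lam * N j"
    by (simp only:)
  from LIMSEQ_unique[OF this tendsto_const]
  have "4 * r * (real j * real (j-1) * N (j-2)) - 4 * (real j * real (j-1) * N (j-1))
    - 2 * real DIM('a) * (real j * N (j-1)) + lam * N j = 0" by simp
  then show ?thesis unfolding N_def by (simp add: algebra_simps)
qed

section \<open>Unique continuation\<close>

lemma dirichlet_laplacian_integrable:
  assumes U: "open U" "bounded U" and dl: "dirichlet_laplacian U \<phi> f"
  shows "integrable (lebesgue_on U) \<phi>"
proof -
  have "\<phi> \<in> L2 U" using dl by (auto simp: dirichlet_laplacian_def H10_def H1_def)
  then show ?thesis by (rule L2_integrable[OF U])
qed

lemma radial_moment_derivative:
  assumes int: "integrable (lebesgue_on U) \<phi>" and k: "k \<ge> 2"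
  shows "(radial_moment U \<phi> k x has_real_derivative real k * radial_moment U \<phi> (k - 1) x r) (at r)"
proof -
  have "((\<lambda>r. \<integral>y. \<phi> y * pos_power k (r - (norm (y - x))\<^sup>2) \<partial>lebesgue_on U) has_real_derivative
      (\<integral>y. \<phi> y * (real k * pos_power (k-1) (r - (norm (y - x))\<^sup>2)) \<partial>lebesgue_on U)) (at r)"
  proof (rule has_real_derivative_integral[OF int zero_less_one, where C="real k * (\<bar>r\<bar> + 1) ^ (k-1)"
        and K="\<lambda>t y. pos_power k (t - (norm (y - x))\<^sup>2)" and K'="\<lambda>t y. real k * pos_power (k-1) (t - (norm (y - x))\<^sup>2)"])
    show "integrable (lebesgue_on U) (\<lambda>y. \<phi> y * pos_power k (t - (norm (y - x))\<^sup>2))" for t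
      by (rule integrable_mult_bounded[OF int pos_power_radial_measurable, where C="\<bar>t\<bar> ^ k"])
        (use pos_power_bound[of _ t k] in auto)
    show "(\<lambda>y. real k * pos_power (k-1) (r - (norm (y - x))\<^sup>2)) \<in> borel_measurable (lebesgue_on U)"
      by (intro borel_measurable_times pos_power_radial_measurable) simp
    show "((\<lambda>t. pos_power k (t - (norm (y - x))\<^sup>2)) has_real_derivative
        real k * pos_power (k-1) (t - (norm (y - x))\<^sup>2)) (at t)" for t y
    proof -
      have "((\<lambda>t. t - (norm (y - x))\<^sup>2) has_real_derivative 1) (at t)"
        by (auto intro!: derivative_eq_intros)
      from DERIV_chain2[OF pos_power_derivative[OF k] this] show ?thesis by simp
    qed
    show "\<bar>real k * pos_power (k-1) (t - (norm (y - x))\<^sup>2)\<bar> \<le> real k * (\<bar>r\<bar> + 1) ^ (k-1)" if "\<bar>t - r\<bar> < 1" for t y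
    proof -
      have "t - (norm (y - x))\<^sup>2 \<le> \<bar>r\<bar> + 1"
        using that zero_le_power2[of "norm (y - x)"] by linarith
      from pos_power_bound[OF this, of "k-1"] show ?thesis by (auto simp: abs_mult intro!: mult_left_mono)
    qed
  qed
  then show ?thesis
    unfolding radial_moment_def[abs_def] by (simp add: mult.left_commute)
qed

text \<open>If \<open>\<phi>\<close> vanishes near \<open>x\<close>, the solution \<open>radial_moment U \<phi> j x\<close> of the differential equation of
  \<open>radial_moment_recurrence\<close> vanishes for small \<open>r\<close>, hence for all \<open>r\<close> up to \<open>R\<^sup>2\<close>: the coefficient \<open>r\<close> of
  the leading term is bounded below by \<open>s\<^sup>2\<close> beyond the initial interval, so a Gronwall argument for
  the sum of squares of two consecutive moments applies. This replaces the mean value property.\<close>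

lemma radial_moment_vanishes:
  fixes \<phi> :: "'a::euclidean_space \<Rightarrow> real"
  assumes U: "open U" "bounded U" and dl: "dirichlet_laplacian U \<phi> (\<lambda>x. lam * \<phi> x)"
    and R: "ball x R \<subseteq> U" "R > 0" and s: "s > 0" and zero: "AE y in lebesgue_on U. y \<in> ball x s \<longrightarrow> \<phi> y = 0"
    and j: "j \<ge> 3" and r: "r < R\<^sup>2"
  shows "radial_moment U \<phi> j x r = 0"
proof -
  have int: "integrable (lebesgue_on U) \<phi>" by (rule dirichlet_laplacian_integrable[OF U dl])
  define N where "N k = radial_moment U \<phi> k x" for k
  have N0: "N k t = 0" if t: "t \<le> s\<^sup>2" for k t
  proof -
    have "AE y in lebesgue_on U. \<phi> y * pos_power k (t - (norm (y - x))\<^sup>2) = 0"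
      using zero
    proof eventually_elim
      case (elim y)
      show ?case
      proof (cases "y \<in> ball x s")
        case False
        then have "s \<le> norm (y - x)" by (simp add: dist_norm norm_minus_commute)
        then have "s\<^sup>2 \<le> (norm (y - x))\<^sup>2" using s by (intro power_mono) auto
        then show ?thesis using t by (simp add: pos_power_def)
      qed (use elim in simp)
    qed
    then show ?thesis unfolding N_def radial_moment_def by (rule integral_eq_zero_AE)
  qed
  show ?thesis
  proof (cases "r \<le> s\<^sup>2")
    case True
    then show ?thesis using N0 by (simp add: N_def)
  next
    case False
    \<comment> \<open>The differential equation is used at order \<open>j + 1\<close>, so the moment of order \<open>j\<close> is \<open>A\<close> and that
      of order \<open>j - 1\<close>, which is controlled by the equation, gives the derivative of \<open>A\<close>.\<close>
    define i where "i = j + 1"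
    define A B where "A = N (i - 1)" and "B = N i"
    have i: "i \<ge> 4" "i - 1 = j" "i - 1 - 1 = i - 2" using j by (auto simp: i_def)
    define C1 where "C1 = (4 * real i * real (i-1) + 2 * real DIM('a) * real i + \<bar>lam\<bar>) / (4 * s\<^sup>2 * real i * real (i-1))"
    have C1: "C1 \<ge> 0" unfolding C1_def by (intro divide_nonneg_nonneg) auto
    define C where "C = 4 * real (i-1) * C1 + real i"
    have bd: "\<bar>N (i-2) t\<bar> \<le> C1 * (\<bar>A t\<bar> + \<bar>B t\<bar>)" if t: "s\<^sup>2 \<le> t" "t \<le> r" for t
    proof -
      have t0: "t \<ge> 0" using t zero_le_power2[of s] by linarith
      have "sqrt t < R" using t r R(2) t0
        by (metis le_less_trans less_eq_real_def real_sqrt_abs real_sqrt_less_iff abs_of_pos)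
      then have "cball x (sqrt t) \<subseteq> U" using R(1) by (auto simp: subset_iff)
      from radial_moment_recurrence[OF U dl this t0 i(1)]
      have e: "4 * t * real i * real (i-1) * N (i-2) t
        = (4 * real i * real (i-1) + 2 * real DIM('a) * real i) * A t - lam * B t"
        unfolding N_def A_def B_def by simp
      have "4 * s\<^sup>2 * real i * real (i-1) * \<bar>N (i-2) t\<bar> \<le> 4 * t * real i * real (i-1) * \<bar>N (i-2) t\<bar>"
        using t by (intro mult_right_mono) auto
      also have "\<dots> = \<bar>4 * t * real i * real (i-1) * N (i-2) t\<bar>"
        using t0 by (simp add: abs_mult)
      also have "\<dots> \<le> (4 * real i * real (i-1) + 2 * real DIM('a) * real i) * \<bar>A t\<bar> + \<bar>lam\<bar> * \<bar>B t\<bar>"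
        unfolding e by (rule order_trans[OF abs_triangle_ineq4]) (simp add: abs_mult)
      also have "\<dots> \<le> (4 * real i * real (i-1) + 2 * real DIM('a) * real i + \<bar>lam\<bar>) * (\<bar>A t\<bar> + \<bar>B t\<bar>)"
        by (simp add: algebra_simps)
      finally have h: "4 * s\<^sup>2 * real i * real (i-1) * \<bar>N (i-2) t\<bar>
        \<le> (4 * real i * real (i-1) + 2 * real DIM('a) * real i + \<bar>lam\<bar>) * (\<bar>A t\<bar> + \<bar>B t\<bar>)" .
      have D: "4 * s\<^sup>2 * real i * real (i-1) > 0" using s i(1) by simp
      show ?thesis
        unfolding C1_def times_divide_eq_left pos_le_divide_eq[OF D] using h by (subst mult.commute)
    qed
    have dA: "(A has_real_derivative real (i-1) * N (i-2) t) (at t)" for t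
      unfolding A_def N_def
      by (rule radial_moment_derivative[OF int, of "i-1" x t, unfolded i(3)]) (use i(1) in simp)
    have dB: "(B has_real_derivative real i * A t) (at t)" for t
      unfolding A_def B_def N_def using radial_moment_derivative[OF int, of "i" x t] i by simp
    define Q where "Q t = ((A t)\<^sup>2 + (B t)\<^sup>2) * exp (- C * t)" for t
    have "Q r \<le> Q (s\<^sup>2)"
    proof (rule DERIV_nonpos_imp_nonincreasing[where f=Q and a="s\<^sup>2" and b=r])
      show "s\<^sup>2 \<le> r" using False by simp
      fix t assume t: "s\<^sup>2 \<le> t" "t \<le> r"
      define D where "D = (2 * A t * (real (i-1) * N (i-2) t) + 2 * B t * (real i * A t))"
      have "((\<lambda>t. (A t)\<^sup>2 + (B t)\<^sup>2) has_real_derivative D) (at t)"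
        unfolding D_def using DERIV_add[OF DERIV_power[OF dA, of 2] DERIV_power[OF dB, of 2]]
        by (simp add: mult_ac)
      moreover have "((\<lambda>t. exp (- C * t)) has_real_derivative - C * exp (- C * t)) (at t)"
        by (auto intro!: derivative_eq_intros)
      ultimately have "((\<lambda>t. ((A t)\<^sup>2 + (B t)\<^sup>2) * exp (- C * t)) has_real_derivative
        D * exp (- C * t) + (- C * exp (- C * t)) * ((A t)\<^sup>2 + (B t)\<^sup>2)) (at t)"
        by (rule DERIV_mult)
      then have "(Q has_real_derivative (D - C * ((A t)\<^sup>2 + (B t)\<^sup>2)) * exp (- C * t)) (at t)"
        unfolding Q_def[abs_def] left_diff_distrib by (simp add: mult_ac)
      moreover have "D \<le> C * ((A t)\<^sup>2 + (B t)\<^sup>2)"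
      proof -
        have sq: "2 * (\<bar>A t\<bar> * \<bar>B t\<bar>) \<le> (A t)\<^sup>2 + (B t)\<^sup>2"
          using sum_squares_bound[of "\<bar>A t\<bar>" "\<bar>B t\<bar>"] by simp
        have "A t * N (i-2) t \<le> \<bar>A t\<bar> * (C1 * (\<bar>A t\<bar> + \<bar>B t\<bar>))"
          using mult_left_mono[OF bd[OF t], of "\<bar>A t\<bar>"] abs_le_D1[of "A t * N (i-2) t"]
          by (simp add: abs_mult)
        also have "\<dots> = C1 * ((A t)\<^sup>2 + \<bar>A t\<bar> * \<bar>B t\<bar>)"
          by (simp add: algebra_simps power2_eq_square)
        also have "\<dots> \<le> C1 * (2 * ((A t)\<^sup>2 + (B t)\<^sup>2))"
        proof (rule mult_left_mono[OF _ C1])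
          have "a + p \<le> 2 * (a + b)" if "0 \<le> a" "0 \<le> b" "2 * p \<le> a + b" for a b p :: real
            using that by simp
          from this[OF _ _ sq] show "(A t)\<^sup>2 + \<bar>A t\<bar> * \<bar>B t\<bar> \<le> 2 * ((A t)\<^sup>2 + (B t)\<^sup>2)"
            by simp
        qed
        finally have 1: "2 * real (i-1) * (A t * N (i-2) t) \<le> 2 * real (i-1) * (C1 * (2 * ((A t)\<^sup>2 + (B t)\<^sup>2)))"
          by (intro mult_left_mono) auto
        have "2 * (A t * B t) \<le> (A t)\<^sup>2 + (B t)\<^sup>2"
          using sum_squares_bound[of "A t" "B t"] by simp
        then have 2: "real i * (2 * (A t * B t)) \<le> real i * ((A t)\<^sup>2 + (B t)\<^sup>2)"
          by (intro mult_left_mono) auto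
        have "D = 2 * real (i-1) * (A t * N (i-2) t) + real i * (2 * (A t * B t))"
          unfolding D_def by (simp only: mult_ac)
        also have "\<dots> \<le> 2 * real (i-1) * (C1 * (2 * ((A t)\<^sup>2 + (B t)\<^sup>2))) + real i * ((A t)\<^sup>2 + (B t)\<^sup>2)"
          using 1 2 by linarith
        also have "\<dots> = C * ((A t)\<^sup>2 + (B t)\<^sup>2)"
          unfolding C_def by (simp add: distrib_right distrib_left mult_ac)
        finally show ?thesis .
      qed
      then have "(D - C * ((A t)\<^sup>2 + (B t)\<^sup>2)) * exp (- C * t) \<le> 0"
        by (intro mult_nonpos_nonneg) auto
      ultimately show "\<exists>y. (Q has_real_derivative y) (at t) \<and> y \<le> 0" by blast
    qed
    also have "Q (s\<^sup>2) = 0" unfolding Q_def A_def B_def using N0 by simp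
    finally have "(A r)\<^sup>2 + (B r)\<^sup>2 \<le> 0"
      unfolding Q_def by (simp add: mult_le_0_iff)
    then have "A r = 0"
      by (simp add: sum_power2_le_zero_iff)
    then show ?thesis unfolding A_def N_def i(2) by simp
  qed
qed

lemma bounded_linear_inner_rep:
  fixes f :: "'a::euclidean_space \<Rightarrow> real"
  assumes "bounded_linear f" obtains v where "f = (\<lambda>y. y \<bullet> v)"
proof -
  have "linear f" using assms by (rule bounded_linear.linear)
  then have "f y = y \<bullet> adjoint f 1" for y using adjoint_works[of f y 1] by simp
  then show ?thesis using that by blast
qed

text \<open>Differentiating the vanishing radial moments with respect to their centre brings down a factor
  \<open>2 (y - x) \<bullet> v\<close> and lowers the exponent by one. Since all exponents are available, induction gives
  vanishing moments against every polynomial.\<close>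

lemma polynomial_radial_moment_vanishes:
  fixes \<phi> :: "'a::euclidean_space \<Rightarrow> real" and z :: 'a
  assumes bU: "bounded U" and int: "integrable (lebesgue_on U) \<phi>" and s: "s > 0"
    and zero: "\<And>k x r. k \<ge> 3 \<Longrightarrow> x \<in> ball z s \<Longrightarrow> r < T \<Longrightarrow> radial_moment U \<phi> k x r = 0"
    and p: "real_polynomial_function p"
  shows "\<And>k x r. k \<ge> 3 \<Longrightarrow> x \<in> ball z s \<Longrightarrow> r < T \<Longrightarrow>
    (\<integral>y. \<phi> y * (pos_power k (r - (norm (y - x))\<^sup>2) * p y) \<partial>lebesgue_on U) = 0"
proof -
  define G where "G q \<longleftrightarrow> continuous_on UNIV q \<and> (\<forall>k x r. k \<ge> 3 \<longrightarrow> x \<in> ball z s \<longrightarrow> r < T \<longrightarrow>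
    (\<integral>y. \<phi> y * (pos_power k (r - (norm (y - x))\<^sup>2) * q y) \<partial>lebesgue_on U) = 0)" for q :: "'a \<Rightarrow> real"
  obtain Y where Y: "\<And>y. y \<in> U \<Longrightarrow> norm y \<le> Y" using bU by (auto simp: bounded_iff)
  have bq: "\<exists>C. \<forall>y\<in>U. \<bar>q y\<bar> \<le> C" if "continuous_on UNIV q" for q :: "'a \<Rightarrow> real"
  proof -
    have "compact (closure U)" using bU by simp
    then have "bounded (q ` closure U)"
      using that by (metis compact_continuous_image compact_imp_bounded continuous_on_subset subset_UNIV)
    then show ?thesis using closure_subset[of U] unfolding bounded_iff by auto
  qed
  have qm: "q \<in> borel_measurable (lebesgue_on U)" if "continuous_on UNIV q" for q :: "'a \<Rightarrow> real"
    by (rule borel_imp_lebesgue_on) (use that borel_measurable_continuous_onI in auto)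
  have intq: "integrable (lebesgue_on U) (\<lambda>y. \<phi> y * (pos_power k (r - (norm (y - x))\<^sup>2) * q y))"
    if q: "continuous_on UNIV q" for q k x r
  proof -
    obtain C where C: "\<And>y. y \<in> U \<Longrightarrow> \<bar>q y\<bar> \<le> C" using bq[OF q] by blast
    show ?thesis
    proof (rule integrable_mult_bounded[OF int])
      show "(\<lambda>y. pos_power k (r - (norm (y - x))\<^sup>2) * q y) \<in> borel_measurable (lebesgue_on U)"
        by (intro borel_measurable_times pos_power_radial_measurable qm q)
      fix y assume "y \<in> space (lebesgue_on U)"
      then show "\<bar>pos_power k (r - (norm (y - x))\<^sup>2) * q y\<bar> \<le> \<bar>r\<bar> ^ k * C"
        using pos_power_bound[of "r - (norm (y - x))\<^sup>2" r k] C[of y]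
        by (auto simp: abs_mult intro!: mult_mono)
    qed
  qed
  have G1: "G (\<lambda>y. 1)" using zero by (auto simp: G_def radial_moment_def)
  have Gc: "G (\<lambda>y. c * q y)" if "G q" for c q
  proof -
    have "(\<lambda>y. \<phi> y * (pos_power k (r - (norm (y - x))\<^sup>2) * (c * q y)))
      = (\<lambda>y. c * (\<phi> y * (pos_power k (r - (norm (y - x))\<^sup>2) * q y)))" for k r x
      by (simp add: mult_ac)
    then show ?thesis using that by (auto simp: G_def intro!: continuous_intros)
  qed
  have Gadd: "G (\<lambda>y. q1 y + q2 y)" if "G q1" "G q2" for q1 q2
    unfolding G_def
  proof (intro conjI allI impI)
    have c: "continuous_on UNIV q1" "continuous_on UNIV q2" using that by (auto simp: G_def)
    then show "continuous_on UNIV (\<lambda>y. q1 y + q2 y)" by (intro continuous_intros)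
    fix k :: nat and x r assume "k \<ge> 3" "x \<in> ball z s" "r < T"
    then have "(\<integral>y. \<phi> y * (pos_power k (r - (norm (y - x))\<^sup>2) * q1 y) \<partial>lebesgue_on U) = 0"
      "(\<integral>y. \<phi> y * (pos_power k (r - (norm (y - x))\<^sup>2) * q2 y) \<partial>lebesgue_on U) = 0"
      using that unfolding G_def by blast+
    then show "(\<integral>y. \<phi> y * (pos_power k (r - (norm (y - x))\<^sup>2) * (q1 y + q2 y)) \<partial>lebesgue_on U) = 0"
      unfolding distrib_left
      using intq[OF c(1)] intq[OF c(2)] by (subst Bochner_Integration.integral_add) simp_all
  qed
  have Glin: "G (\<lambda>y. q y * (y \<bullet> v))" if G: "G q" for q v
    unfolding G_def
  proof (intro conjI allI impI)
    have q: "continuous_on UNIV q" using G by (simp add: G_def)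
    then show "continuous_on UNIV (\<lambda>y. q y * (y \<bullet> v))" by (intro continuous_intros)
    fix k :: nat and x r assume k: "k \<ge> 3" and x: "x \<in> ball z s" and r: "r < T"
    obtain e0 where e0: "e0 > 0" "ball x e0 \<subseteq> ball z s" using openE[OF open_ball x] by blast
    define e where "e = e0 / (norm v + 1)"
    have e: "e > 0" using e0 by (simp add: e_def add_nonneg_pos)
    have xin: "x + t *\<^sub>R v \<in> ball z s" if "\<bar>t\<bar> < e" for t
    proof -
      have "\<bar>t\<bar> * norm v \<le> \<bar>t\<bar> * (norm v + 1)" by (intro mult_left_mono) auto
      also have "\<dots> < e0" using that by (simp add: e_def pos_less_divide_eq add_nonneg_pos)
      finally have "x + t *\<^sub>R v \<in> ball x e0" by (simp add: dist_norm)
      then show ?thesis using e0 by blast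
    qed
    obtain C where C: "\<And>y. y \<in> U \<Longrightarrow> \<bar>q y\<bar> \<le> C" using bq[OF q] by blast
    define K where "K t y = pos_power (k+1) (r - (norm (y - (x + t *\<^sub>R v)))\<^sup>2) * q y" for t y
    define K' where "K' t y = real (k+1) * pos_power k (r - (norm (y - (x + t *\<^sub>R v)))\<^sup>2)
        * (2 * ((y - (x + t *\<^sub>R v)) \<bullet> v)) * q y" for t y
    have "((\<lambda>t. \<integral>y. \<phi> y * K t y \<partial>lebesgue_on U) has_real_derivative
        (\<integral>y. \<phi> y * K' 0 y \<partial>lebesgue_on U)) (at 0)"
    proof (rule has_real_derivative_integral[OF int e,
          where C="real (k+1) * \<bar>r\<bar> ^ k * (2 * ((Y + (norm x + e * norm v)) * norm v)) * C"])
      show "integrable (lebesgue_on U) (\<lambda>y. \<phi> y * K t y)" for t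
        unfolding K_def by (rule intq[OF q])
      show "K' 0 \<in> borel_measurable (lebesgue_on U)"
        unfolding K'_def[abs_def]
        by (rule borel_measurable_times[OF borel_measurable_times[OF borel_measurable_times[OF
                borel_measurable_const pos_power_radial_measurable] qm] qm[OF q]])
          (intro continuous_intros)
      fix t y assume y: "y \<in> space (lebesgue_on U)" and t: "\<bar>t - 0\<bar> < e"
      have "((\<lambda>t. r - (norm (y - (x + t *\<^sub>R v)))\<^sup>2) has_real_derivative 2 * ((y - (x + t *\<^sub>R v)) \<bullet> v)) (at t)"
      proof -
        define w where "w = y - x"
        have "(norm (y - (x + t *\<^sub>R v)))\<^sup>2 = w \<bullet> w - 2 * t * (w \<bullet> v) + t\<^sup>2 * (v \<bullet> v)" for t
        proof -
          have "y - (x + t *\<^sub>R v) = w - t *\<^sub>R v" by (simp add: w_def)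
          then show ?thesis
            by (simp only: power2_norm_eq_inner) (simp add: inner_diff_left inner_diff_right inner_commute power2_eq_square)
        qed
        moreover have "(y - (x + t *\<^sub>R v)) \<bullet> v = w \<bullet> v - t * (v \<bullet> v)"
          by (simp add: w_def inner_diff_left inner_add_left)
        ultimately show ?thesis by (auto intro!: derivative_eq_intros)
      qed
      from DERIV_chain2[OF pos_power_derivative this, of "k+1"] k
      have "((\<lambda>t. pos_power (k+1) (r - (norm (y - (x + t *\<^sub>R v)))\<^sup>2)) has_real_derivative
        real (k+1) * pos_power k (r - (norm (y - (x + t *\<^sub>R v)))\<^sup>2) * (2 * ((y - (x + t *\<^sub>R v)) \<bullet> v))) (at t)"
        by simp
      then show "((\<lambda>t. K t y) has_real_derivative K' t y) (at t)"
        unfolding K_def K'_def by (rule DERIV_cmult_right)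
      have yU: "y \<in> U" using y by simp
      have 1: "\<bar>(y - (x + t *\<^sub>R v)) \<bullet> v\<bar> \<le> (Y + (norm x + e * norm v)) * norm v"
      proof -
        have "\<bar>(y - (x + t *\<^sub>R v)) \<bullet> v\<bar> \<le> norm (y - (x + t *\<^sub>R v)) * norm v"
          by (rule Cauchy_Schwarz_ineq2)
        also have "norm (y - (x + t *\<^sub>R v)) \<le> norm y + norm (x + t *\<^sub>R v)" by (rule norm_triangle_ineq4)
        also have "norm (x + t *\<^sub>R v) \<le> norm x + norm (t *\<^sub>R v)" by (rule norm_triangle_ineq)
        also have "norm (t *\<^sub>R v) \<le> e * norm v" using t by (simp add: mult_right_mono)
        finally have "\<bar>(y - (x + t *\<^sub>R v)) \<bullet> v\<bar> \<le> (norm y + (norm x + e * norm v)) * norm v"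
          by (simp add: mult_right_mono)
        also have "\<dots> \<le> (Y + (norm x + e * norm v)) * norm v"
          using Y[OF yU] by (intro mult_right_mono) auto
        finally show ?thesis .
      qed
      have 2: "\<bar>pos_power k (r - (norm (y - (x + t *\<^sub>R v)))\<^sup>2)\<bar> \<le> \<bar>r\<bar> ^ k"
        using pos_power_bound[of "r - (norm (y - (x + t *\<^sub>R v)))\<^sup>2" r k] by simp
      have "0 \<le> C" using C[OF yU] by linarith
      have "0 \<le> Y" using Y[OF yU] norm_ge_zero[of y] by linarith
      then have "0 \<le> Y + (norm x + e * norm v)" using e by simp
      show "\<bar>K' t y\<bar> \<le> real (k+1) * \<bar>r\<bar> ^ k * (2 * ((Y + (norm x + e * norm v)) * norm v)) * C"
        unfolding K'_def abs_mult
        using 1 2 C[OF yU] \<open>0 \<le> C\<close> \<open>0 \<le> Y + (norm x + e * norm v)\<close>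
        by (intro mult_mono mult_nonneg_nonneg) auto
    qed
    moreover have "((\<lambda>t. \<integral>y. \<phi> y * K t y \<partial>lebesgue_on U) has_real_derivative 0) (at 0)"
    proof (rule has_field_derivative_transform_within_open[where S="{-e<..<e}"])
      show "((\<lambda>t. 0::real) has_real_derivative 0) (at 0)" by simp
      show "0 = (\<integral>y. \<phi> y * K t y \<partial>lebesgue_on U)" if "t \<in> {-e<..<e}" for t
        using G k xin[of t] that r unfolding G_def K_def by auto
    qed (use e in auto)
    ultimately have "(\<integral>y. \<phi> y * K' 0 y \<partial>lebesgue_on U) = 0" by (rule DERIV_unique)
    moreover have "(\<lambda>y. \<phi> y * K' 0 y) = (\<lambda>y. 2 * real (k+1) *
        (\<phi> y * (pos_power k (r - (norm (y - x))\<^sup>2) * (q y * (y \<bullet> v)))) -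
        2 * real (k+1) * (x \<bullet> v) * (\<phi> y * (pos_power k (r - (norm (y - x))\<^sup>2) * q y)))"
      unfolding K'_def by (rule ext) (simp add: inner_diff_left right_diff_distrib left_diff_distrib distrib_left distrib_right mult_ac)
    moreover have "(\<integral>y. \<phi> y * (pos_power k (r - (norm (y - x))\<^sup>2) * q y) \<partial>lebesgue_on U) = 0"
      using G k x r unfolding G_def by auto
    moreover have "continuous_on UNIV (\<lambda>y. q y * (y \<bullet> v))" using q by (intro continuous_intros)
    ultimately show "(\<integral>y. \<phi> y * (pos_power k (r - (norm (y - x))\<^sup>2) * (q y * (y \<bullet> v))) \<partial>lebesgue_on U) = 0"
      using intq[OF q] intq[of "\<lambda>y. q y * (y \<bullet> v)"] by simp
  qed
  have "\<forall>q. G q \<longrightarrow> G (\<lambda>y. q y * p y)"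
    using p
  proof induction
    case (linear f)
    then obtain v where "f = (\<lambda>y. y \<bullet> v)" by (rule bounded_linear_inner_rep)
    then show ?case by (simp add: Glin)
  next
    case (const c)
    show ?case by (subst mult.commute) (simp add: Gc)
  next
    case (add f g)
    then show ?case by (simp add: distrib_left Gadd)
  next
    case (mult f g)
    have "G (\<lambda>y. (q y * f y) * g y)" if "G q" for q
      by (rule mult.IH(2)[rule_format]) (rule mult.IH(1)[rule_format, OF that])
    then show ?case by (simp add: mult.assoc)
  qed
  then have "G p" using G1 by force
  then show "\<And>k x r. k \<ge> 3 \<Longrightarrow> x \<in> ball z s \<Longrightarrow> r < T \<Longrightarrow>
    (\<integral>y. \<phi> y * (pos_power k (r - (norm (y - x))\<^sup>2) * p y) \<partial>lebesgue_on U) = 0"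
    unfolding G_def by blast
qed

text \<open>Polynomials are uniformly dense in the continuous functions on the closure of \<open>U\<close>.\<close>

lemma orthogonal_polynomials_imp_zero:
  fixes f :: "'a::euclidean_space \<Rightarrow> real"
  assumes U: "open U" "bounded U" and f: "integrable (lebesgue_on U) f"
    and orth: "\<And>p. real_polynomial_function p \<Longrightarrow> (\<integral>x. f x * p x \<partial>lebesgue_on U) = 0"
  shows "AE x in lebesgue_on U. f x = 0"
proof (rule orthogonal_test_fun_imp_zero[OF U(1) f])
  fix \<psi> assume psi: "\<psi> \<in> test_fun U"
  have c: "continuous_on (closure U) \<psi>"
    using psi smooth_continuous_on by (auto simp: test_fun_def)
  have bd: "\<bar>\<integral>x. f x * \<psi> x \<partial>lebesgue_on U\<bar> \<le> e * (\<integral>x. \<bar>f x\<bar> \<partial>lebesgue_on U)" if e: "e > 0" for e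
  proof -
    have cl: "compact (closure U)" using U by simp
    obtain p where p: "real_polynomial_function p" "\<And>x. x \<in> closure U \<Longrightarrow> \<bar>\<psi> x - p x\<bar> < e"
      using Stone_Weierstrass_real_polynomial_function[OF cl c e] by blast
    have pU: "\<bar>\<psi> x - p x\<bar> \<le> e" if "x \<in> U" for x
      using p(2)[of x] closure_subset[of U] that by auto
    have pc: "continuous_on UNIV p"
      using p(1) by (simp add: continuous_on_polymonial_function real_polynomial_function_eq)
    have pm: "p \<in> borel_measurable (lebesgue_on U)"
      by (rule borel_imp_lebesgue_on) (use pc borel_measurable_continuous_onI in auto)
    obtain C where C: "\<And>x. \<bar>\<psi> x\<bar> \<le> C" using test_fun_bounded[OF psi] by metis
    have i1: "integrable (lebesgue_on U) (\<lambda>x. f x * \<psi> x)"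
      using psi by (intro integrable_mult_bounded[OF f, where C=C] smooth_measurable[OF U(1)] C) (auto simp: test_fun_def)
    have i2: "integrable (lebesgue_on U) (\<lambda>x. f x * p x)"
    proof (rule integrable_mult_bounded[OF f pm])
      show "\<bar>p x\<bar> \<le> C + e" if "x \<in> space (lebesgue_on U)" for x
        using pU[of x] C[of x] that by simp
    qed
    have "(\<integral>x. f x * \<psi> x \<partial>lebesgue_on U) = (\<integral>x. f x * \<psi> x \<partial>lebesgue_on U) - (\<integral>x. f x * p x \<partial>lebesgue_on U)"
      using orth[OF p(1)] by simp
    also have "\<dots> = (\<integral>x. f x * \<psi> x - f x * p x \<partial>lebesgue_on U)"
      using i1 i2 by simp
    finally have "\<bar>\<integral>x. f x * \<psi> x \<partial>lebesgue_on U\<bar> \<le> (\<integral>x. \<bar>f x * \<psi> x - f x * p x\<bar> \<partial>lebesgue_on U)"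
      using integral_abs_bound by simp
    also have "\<dots> \<le> (\<integral>x. e * \<bar>f x\<bar> \<partial>lebesgue_on U)"
    proof (rule integral_mono)
      show "integrable (lebesgue_on U) (\<lambda>x. \<bar>f x * \<psi> x - f x * p x\<bar>)" using i1 i2 by simp
      show "integrable (lebesgue_on U) (\<lambda>x. e * \<bar>f x\<bar>)" using f by simp
      fix x assume "x \<in> space (lebesgue_on U)"
      then have "\<bar>f x\<bar> * \<bar>\<psi> x - p x\<bar> \<le> \<bar>f x\<bar> * e" using pU by (intro mult_left_mono) auto
      then show "\<bar>f x * \<psi> x - f x * p x\<bar> \<le> e * \<bar>f x\<bar>"
        by (simp add: abs_mult[symmetric] right_diff_distrib mult.commute)
    qed
    finally show ?thesis by simp
  qed
  show "(\<integral>x. f x * \<psi> x \<partial>lebesgue_on U) = 0"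
  proof (rule ccontr)
    define I where "I = \<bar>\<integral>x. f x * \<psi> x \<partial>lebesgue_on U\<bar>"
    define J where "J = (\<integral>x. \<bar>f x\<bar> \<partial>lebesgue_on U)"
    assume "(\<integral>x. f x * \<psi> x \<partial>lebesgue_on U) \<noteq> 0"
    then have I: "I > 0" by (simp add: I_def)
    have J: "J \<ge> 0" by (simp add: J_def)
    have "I / (2 * (J + 1)) > 0" using I J by simp
    from bd[OF this] have "I \<le> I / (2 * (J + 1)) * J"
      unfolding I_def[symmetric] J_def[symmetric] .
    also have "\<dots> \<le> I / 2"
      using I J by (simp add: field_simps)
    finally show False using I by simp
  qed
qed

text \<open>The product of \<open>\<phi>\<close> with a function that is positive exactly on \<open>ball z (R/2)\<close> is orthogonal to
  all polynomials. The centres range over \<open>ball z (s/2)\<close>, which leaves a ball of zeros of radius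
  \<open>s/2\<close> and a ball in \<open>U\<close> of radius \<open>R - s/2 > R/2\<close> about each of them.\<close>

lemma local_unique_continuation:
  fixes \<phi> :: "'a::euclidean_space \<Rightarrow> real"
  assumes U: "open U" "bounded U" and dl: "dirichlet_laplacian U \<phi> (\<lambda>x. lam * \<phi> x)"
    and R: "ball z R \<subseteq> U" and s: "0 < s" "s < R"
    and zero: "AE y in lebesgue_on U. y \<in> ball z s \<longrightarrow> \<phi> y = 0"
  shows "AE y in lebesgue_on U. y \<in> ball z (R/2) \<longrightarrow> \<phi> y = 0"
proof -
  have int: "integrable (lebesgue_on U) \<phi>" by (rule dirichlet_laplacian_integrable[OF U dl])
  have rm: "radial_moment U \<phi> k x r = 0" if k: "k \<ge> 3" and x: "x \<in> ball z (s/2)" and r: "r < (R - s/2)\<^sup>2" for k x r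
  proof (rule radial_moment_vanishes[OF U dl _ _ _ _ k r])
    show "ball x (R - s/2) \<subseteq> U"
    proof
      fix y assume "y \<in> ball x (R - s/2)"
      then have "y \<in> ball z R" using x dist_triangle[of z y x] by auto
      then show "y \<in> U" using R by blast
    qed
    show "R - s/2 > 0" "s / 2 > 0" using s by auto
    show "AE y in lebesgue_on U. y \<in> ball x (s/2) \<longrightarrow> \<phi> y = 0"
      using zero
    proof eventually_elim
      case (elim y)
      show ?case
      proof
        assume "y \<in> ball x (s/2)"
        then have "y \<in> ball z s" using x dist_triangle[of z y x] by auto
        then show "\<phi> y = 0" using elim by blast
      qed
    qed
  qed
  define r where "r = (R/2)\<^sup>2"
  have r: "r < (R - s/2)\<^sup>2" unfolding r_def using s by (intro power_strict_mono) auto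
  have "AE y in lebesgue_on U. \<phi> y * pos_power 3 (r - (norm (y - z))\<^sup>2) = 0"
  proof (rule orthogonal_polynomials_imp_zero[OF U])
    show "integrable (lebesgue_on U) (\<lambda>y. \<phi> y * pos_power 3 (r - (norm (y - z))\<^sup>2))"
      by (rule integrable_mult_bounded[OF int pos_power_radial_measurable, where C="\<bar>r\<bar> ^ 3"])
        (use pos_power_bound[of _ r 3] in auto)
    fix p :: "'a \<Rightarrow> real" assume p: "real_polynomial_function p"
    have "(\<integral>y. \<phi> y * (pos_power 3 (r - (norm (y - z))\<^sup>2) * p y) \<partial>lebesgue_on U) = 0"
      by (rule polynomial_radial_moment_vanishes[OF U(2) int _ rm p _ _ r, where s="s/2"]) (use s in auto)
    then show "(\<integral>y. \<phi> y * pos_power 3 (r - (norm (y - z))\<^sup>2) * p y \<partial>lebesgue_on U) = 0"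
      by (simp add: mult.assoc)
  qed
  then show ?thesis
  proof eventually_elim
    case (elim y)
    show ?case
    proof
      assume "y \<in> ball z (R/2)"
      then have "norm (y - z) < R/2" by (simp add: dist_norm norm_minus_commute)
      then have "(norm (y - z))\<^sup>2 < r" unfolding r_def by (intro power_strict_mono) auto
      then show "\<phi> y = 0" using elim by (simp add: pos_power_def)
    qed
  qed
qed

text \<open>The points near which \<open>\<phi>\<close> vanishes form an open set; by \<open>local_unique_continuation\<close> its complement
  in \<open>U\<close> is open too, as the radius gained there depends only on the distance to the boundary.\<close>

theorem unique_continuation:
  fixes \<phi> :: "'a::euclidean_space \<Rightarrow> real"
  assumes U: "open U" "bounded U" "connected U" and dl: "dirichlet_laplacian U \<phi> (\<lambda>x. lam * \<phi> x)"
    and W: "open W" "W \<noteq> {}" "W \<subseteq> U" and zero: "AE y in lebesgue_on W. \<phi> y = 0"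
  shows "AE y in lebesgue_on U. \<phi> y = 0"
proof -
  define P where "P x s \<longleftrightarrow> (AE y in lebesgue_on U. y \<in> ball x s \<longrightarrow> \<phi> y = 0)" for x s
  have Psub: "P x s" if "P z t" "ball x s \<subseteq> ball z t" for x s z t
    using that(1) unfolding P_def by eventually_elim (use that(2) in blast)
  define Z where "Z = {x \<in> U. \<exists>s>0. P x s}"
  have "open Z"
    unfolding open_contains_ball
  proof
    fix x assume "x \<in> Z"
    then obtain s where s: "s > 0" "P x s" and x: "x \<in> U" by (auto simp: Z_def)
    obtain t where t: "t > 0" "ball x t \<subseteq> U" using U(1) x openE by blast
    have "ball x (min s t) \<subseteq> Z"
    proof
      fix y assume y: "y \<in> ball x (min s t)"
      then obtain d where "d > 0" "ball y d \<subseteq> ball x (min s t)" by (meson open_ball openE)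
      then have "P y d" by (intro Psub[OF s(2)]) auto
      moreover have "y \<in> U" using y t by auto
      ultimately show "y \<in> Z" using \<open>d > 0\<close> by (auto simp: Z_def)
    qed
    then show "\<exists>e>0. ball x e \<subseteq> Z" using s t by (metis min_less_iff_conj)
  qed
  moreover have "open (U - Z)"
    unfolding open_contains_ball
  proof
    fix x assume x: "x \<in> U - Z"
    obtain R where R: "R > 0" "ball x R \<subseteq> U" using U(1) x openE by blast
    \<comment> \<open>If \<open>z\<close> in \<open>Z\<close> were closer than \<open>R/4\<close> to \<open>x\<close>, then \<open>\<phi>\<close> would vanish on the ball of radius
      \<open>3R/8\<close> about \<open>z\<close>, which is a neighbourhood of \<open>x\<close>.\<close>
    have "ball x (R/4) \<subseteq> U - Z"
    proof (rule ccontr)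
      assume "\<not> ball x (R/4) \<subseteq> U - Z"
      then obtain z where z: "z \<in> ball x (R/4)" "z \<in> Z" using R by fastforce
      then obtain s where s: "s > 0" "P z s" by (auto simp: Z_def)
      have sub: "ball z (3*R/4) \<subseteq> U"
      proof
        fix y assume "y \<in> ball z (3*R/4)"
        then have "y \<in> ball x R" using z dist_triangle[of x y z] by auto
        then show "y \<in> U" using R by blast
      qed
      have m: "0 < min s (R/2)" "min s (R/2) < 3*R/4" using s(1) R(1) by auto
      have "P z (min s (R/2))" by (rule Psub[OF s(2)]) auto
      then have "P z (3*R/4/2)"
        unfolding P_def by (rule local_unique_continuation[OF U(1,2) dl sub m])
      moreover have "ball x (R/8) \<subseteq> ball z (3*R/4/2)"
      proof
        fix y assume "y \<in> ball x (R/8)"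
        then show "y \<in> ball z (3*R/4/2)" using z dist_triangle[of z y x] by (auto simp: dist_commute)
      qed
      ultimately have "P x (R/8)" by (rule Psub)
      then show False using x R by (auto simp: Z_def intro: exI[of _ "R/8"])
    qed
    then show "\<exists>e>0. ball x e \<subseteq> U - Z" using R by (intro exI[of _ "R/4"]) auto
  qed
  moreover have "Z \<inter> U \<noteq> {}"
  proof -
    obtain w where w: "w \<in> W" using W by blast
    obtain s where s: "s > 0" "ball w s \<subseteq> W" using W(1) w openE by blast
    have "AE y in lebesgue. y \<in> W \<longrightarrow> \<phi> y = 0"
      using zero W(1) by (simp add: AE_restrict_space_iff)
    then have "P w s" unfolding P_def using U(1) s(2)
      by (auto simp: AE_restrict_space_iff elim!: eventually_mono)
    then show ?thesis using w W(3) s(1) by (auto simp: Z_def)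
  qed
  ultimately have ZU: "U \<subseteq> Z"
    using connectedD[OF U(3), of Z "U - Z"] by blast
  then have "\<forall>x\<in>U. \<exists>s>0. P x s" by (auto simp: Z_def)
  then obtain \<sigma> where sig: "\<And>x. x \<in> U \<Longrightarrow> \<sigma> x > 0 \<and> P x (\<sigma> x)" by metis
  define F where "F = (\<lambda>x. ball x (\<sigma> x)) ` U"
  obtain F' where F': "F' \<subseteq> F" "countable F'" "\<Union>F' = \<Union>F"
    using Lindelof[of F] by (auto simp: F_def)
  have "AE y in lebesgue_on U. \<forall>B\<in>F'. y \<in> B \<longrightarrow> \<phi> y = 0"
    unfolding AE_ball_countable[OF F'(2)]
    using F'(1) sig by (auto simp: F_def P_def)
  moreover have "AE y in lebesgue_on U. y \<in> U" by (rule AE_I2) simp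
  ultimately show ?thesis
  proof eventually_elim
    case (elim y)
    have "y \<in> \<Union>F" using elim(2) sig[of y] by (auto simp: F_def intro!: bexI[of _ y])
    then show ?case using F'(3) elim(1) by blast
  qed
qed

section \<open>Primitives of integrable functions and weak derivatives on an interval\<close>

lemma integral_mono_negligible:
  fixes f g :: "real \<Rightarrow> real"
  assumes N: "negligible N" and f: "f integrable_on S" and g: "g integrable_on S"
    and le: "\<And>x. x \<in> S - N \<Longrightarrow> f x \<le> g x"
  shows "integral S f \<le> integral S g"
proof -
  define f' g' where "f' x = (if x \<in> N then 0 else f x)" and "g' x = (if x \<in> N then 0 else g x)" for x
  have "integral S f = integral S f'" "integral S g = integral S g'"
    by (rule integral_spike[OF N]; simp add: f'_def g'_def)+
  moreover have "f' integrable_on S" "g' integrable_on S"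
    by (rule integrable_spike[OF f N] integrable_spike[OF g N]; simp add: f'_def g'_def)+
  then have "integral S f' \<le> integral S g'"
    by (rule integral_le) (use le in \<open>auto simp: f'_def g'_def\<close>)
  ultimately show ?thesis by simp
qed

text \<open>The end points are put into the exceptional set, so that outside it a point of the closed interval
  lies in the open one, where the coefficient is controlled.\<close>

lemma AE_interval_negligible:
  assumes "AE y in lebesgue_on {0<..<H::real}. P y"
  obtains N where "negligible N" "\<And>y. y \<in> {0..H} - N \<Longrightarrow> P y" "0 \<in> N" "H \<in> N"
proof -
  have "AE y in lebesgue. y \<in> {0<..<H} \<longrightarrow> P y"
    using assms by (simp add: AE_restrict_space_iff)
  then obtain N where N: "N \<in> null_sets lebesgue" "{y. \<not> (y \<in> {0<..<H} \<longrightarrow> P y)} \<subseteq> N"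
    unfolding eventually_ae_filter by auto
  have "negligible (insert 0 (insert H N))"
    using N(1) by (simp add: negligible_iff_null_sets[symmetric])
  then show ?thesis by (rule that) (use N(2) in \<open>auto simp: subset_iff order_le_less\<close>)
qed

text \<open>Summing the increments over fine partitions bounds the total increment of \<open>G\<close> by arbitrarily small
  multiples of that of \<open>M\<close>. It takes the part of the theorem that an absolutely continuous
  function with derivative zero almost everywhere is constant.\<close>

lemma eq_of_small_increments:
  fixes G M :: "real \<Rightarrow> real"
  assumes AB: "A \<le> B"
    and small: "\<And>e. e > 0 \<Longrightarrow> \<exists>d>0. \<forall>s t. A \<le> s \<longrightarrow> s \<le> t \<longrightarrow> t \<le> B \<longrightarrow> t - s < d \<longrightarrow>
        \<bar>G t - G s\<bar> \<le> e * (M t - M s)"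
  shows "G B = G A"
proof -
  have le: "\<bar>G B - G A\<bar> \<le> e * (M B - M A)" if e: "e > 0" for e
  proof -
    obtain d where d: "d > 0" "\<And>s t. A \<le> s \<Longrightarrow> s \<le> t \<Longrightarrow> t \<le> B \<Longrightarrow> t - s < d \<Longrightarrow>
        \<bar>G t - G s\<bar> \<le> e * (M t - M s)"
      using small[OF e] by blast
    obtain n :: nat where n: "(B - A) / d < real n" using reals_Archimedean2 by blast
    have n0: "0 < real n" using n AB d(1) by (metis divide_nonneg_pos diff_ge_0_iff_ge le_less_trans)
    define x where "x i = A + real i * ((B - A) / real n)" for i :: nat
    have x0: "x 0 = A" "x n = B" using n0 by (auto simp: x_def)
    have step: "x (Suc i) - x i = (B - A) / real n" for i by (simp add: x_def distrib_right add_divide_distrib)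
    have h: "0 \<le> (B - A) / real n" "(B - A) / real n < d"
      using AB n n0 d(1) by (auto simp: field_simps)
    have xm: "A \<le> x i" "i \<le> n \<Longrightarrow> x i \<le> B" for i
    proof -
      show "A \<le> x i"
        using mult_nonneg_nonneg[OF of_nat_0_le_iff h(1), of i] by (simp add: x_def)
      assume "i \<le> n"
      then have "real i * ((B - A) / real n) \<le> real n * ((B - A) / real n)"
        using h(1) by (intro mult_right_mono) auto
      then show "x i \<le> B" using n0 by (simp add: x_def)
    qed
    have "\<bar>G (x i) - G A\<bar> \<le> e * (M (x i) - M A)" if "i \<le> n" for i
      using that
    proof (induction i)
      case (Suc i)
      have "\<bar>G (x (Suc i)) - G (x i)\<bar> \<le> e * (M (x (Suc i)) - M (x i))"
        using xm(1)[of i] step[of i] h xm(2)[of "Suc i"] Suc.prems by (intro d(2)) auto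
      then show ?case using Suc by (simp add: right_diff_distrib)
    qed (simp add: x0)
    from this[of n] show ?thesis by (simp add: x0)
  qed
  show ?thesis
  proof (rule ccontr)
    assume ne: "G B \<noteq> G A"
    define I where "I = \<bar>G B - G A\<bar>"
    define J where "J = \<bar>M B - M A\<bar>"
    have I: "I > 0" and J: "J \<ge> 0" using ne by (auto simp: I_def J_def)
    define e where "e = I / (2 * (J + 1))"
    have e: "e > 0" using I J by (simp add: e_def)
    have "I \<le> e * (M B - M A)" using le[OF e] by (simp add: I_def)
    also have "\<dots> \<le> e * J" using e by (intro mult_left_mono) (auto simp: J_def)
    also have "\<dots> \<le> I / 2" using I J by (simp add: e_def field_simps)
    finally show False using I by simp
  qed
qed

text \<open>That is, \<open>F\<close> is absolutely continuous on \<open>{A..B}\<close> with derivative \<open>f\<close> almost everywhere.\<close>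

definition primitive_on :: "real \<Rightarrow> real \<Rightarrow> (real \<Rightarrow> real) \<Rightarrow> (real \<Rightarrow> real) \<Rightarrow> bool" where
  "primitive_on A B F f \<longleftrightarrow> f absolutely_integrable_on {A..B} \<and>
     (\<forall>s t. A \<le> s \<longrightarrow> s \<le> t \<longrightarrow> t \<le> B \<longrightarrow> integral {s..t} f = F t - F s)"

lemma primitive_onD:
  assumes "primitive_on A B F f" "A \<le> s" "s \<le> t" "t \<le> B"
  shows "integral {s..t} f = F t - F s" "f integrable_on {s..t}" "f absolutely_integrable_on {s..t}"
proof -
  show "integral {s..t} f = F t - F s" using assms by (auto simp: primitive_on_def)
  have "f absolutely_integrable_on {A..B}" using assms by (auto simp: primitive_on_def)
  then show a: "f absolutely_integrable_on {s..t}"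
    by (rule absolutely_integrable_on_subinterval) (use assms in auto)
  show "f integrable_on {s..t}" using a by (simp add: absolutely_integrable_on_def)
qed

lemma primitive_on_subinterval:
  assumes "primitive_on A B F f" "A \<le> A'" "A' \<le> B'" "B' \<le> B"
  shows "primitive_on A' B' F f"
  unfolding primitive_on_def using primitive_onD[OF assms(1)] assms by auto

lemma primitive_on_integral:
  assumes "f absolutely_integrable_on {A..B}"
  shows "primitive_on A B (\<lambda>t. k + integral {A..t} f) f"
  unfolding primitive_on_def
proof (intro conjI allI impI assms)
  fix s t assume st: "A \<le> s" "s \<le> t" "t \<le> B"
  have "f integrable_on {A..B}" using assms by (simp add: absolutely_integrable_on_def)
  then have "f integrable_on {A..t}" by (rule integrable_on_subinterval) (use st in auto)
  from Henstock_Kurzweil_Integration.integral_combine[OF st(1,2) this]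
  show "integral {s..t} f = k + integral {A..t} f - (k + integral {A..s} f)" by simp
qed

lemma primitive_on_continuous:
  assumes "primitive_on A B F f" shows "continuous_on {A..B} F"
proof (cases "A \<le> B")
  case True
  have "continuous_on {A..B} (\<lambda>t. F A + integral {A..t} f)"
    using primitive_onD(2)[OF assms, of A B] True
    by (intro continuous_intros indefinite_integral_continuous_1) auto
  then show ?thesis
    by (rule continuous_on_eq) (use primitive_onD(1)[OF assms, of A] in auto)
qed simp

lemma absolutely_integrable_mult_continuous:
  fixes f g :: "real \<Rightarrow> real"
  assumes "f absolutely_integrable_on {A..B}" "continuous_on {A..B} g"
  shows "(\<lambda>x. g x * f x) absolutely_integrable_on {A..B}"
proof (rule absolutely_integrable_bounded_measurable_product_real[OF _ _ _ assms(1)])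
  show "g \<in> borel_measurable (lebesgue_on {A..B})"
    by (rule continuous_imp_measurable_on_sets_lebesgue[OF assms(2)]) simp
  show "bounded (g ` {A..B})"
    by (meson assms(2) compact_Icc compact_continuous_image compact_imp_bounded)
qed simp

text \<open>On a short interval from \<open>x\<close> to \<open>y\<close> the increment of \<open>F G\<close> is the integral of \<open>G(y) f + F(x) g\<close>
  exactly. By uniform continuity this differs from the integral of the product rule by at most \<open>e\<close>
  times the integral of \<open>|f| + |g|\<close>, and these errors are summable.\<close>

lemma primitive_on_mult:
  assumes F: "primitive_on A B F f" and G: "primitive_on A B G g"
  shows "primitive_on A B (\<lambda>x. F x * G x) (\<lambda>x. G x * f x + F x * g x)"
  unfolding primitive_on_def
proof (intro conjI allI impI)
  define h where "h x = G x * f x + F x * g x" for x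
  have Fc: "continuous_on {A..B} F" and Gc: "continuous_on {A..B} G"
    using F G by (auto intro: primitive_on_continuous)
  have fa: "f absolutely_integrable_on {A..B}" and ga: "g absolutely_integrable_on {A..B}"
    using F G by (auto simp: primitive_on_def)
  have ha: "h absolutely_integrable_on {A..B}"
    unfolding h_def by (intro set_integral_add(1) absolutely_integrable_mult_continuous fa ga Fc Gc)
  then show "(\<lambda>x. G x * f x + F x * g x) absolutely_integrable_on {A..B}"
    by (simp add: h_def[abs_def])
  fix s t assume st: "A \<le> s" "s \<le> t" "t \<le> B"
  define M where "M = (\<lambda>x. integral {A..x} (\<lambda>x. \<bar>f x\<bar> + \<bar>g x\<bar>))"
  have "(\<lambda>x. \<bar>f x\<bar> + \<bar>g x\<bar>) absolutely_integrable_on {A..B}"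
    using fa ga by (auto intro!: set_integral_add(1) set_integrable_abs)
  then have Mp: "primitive_on A B M (\<lambda>x. \<bar>f x\<bar> + \<bar>g x\<bar>)"
    using primitive_on_integral[where k=0] by (simp add: M_def)
  have hp: "primitive_on A B (\<lambda>x. integral {A..x} h) h"
    using primitive_on_integral[OF ha, where k=0] by simp
  have "F t * G t - integral {A..t} h = F s * G s - integral {A..s} h"
  proof (rule eq_of_small_increments[where M=M, OF st(2)])
    fix e :: real assume e: "e > 0"
    have ucF: "uniformly_continuous_on {A..B} F" and ucG: "uniformly_continuous_on {A..B} G"
      using Fc Gc compact_Icc by (auto intro: compact_uniformly_continuous)
    obtain d1 where d1: "d1 > 0" "\<And>x y. x \<in> {A..B} \<Longrightarrow> y \<in> {A..B} \<Longrightarrow> \<bar>y - x\<bar> < d1 \<Longrightarrow> \<bar>F y - F x\<bar> < e"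
      using ucF e unfolding uniformly_continuous_on_def dist_real_def by blast
    obtain d2 where d2: "d2 > 0" "\<And>x y. x \<in> {A..B} \<Longrightarrow> y \<in> {A..B} \<Longrightarrow> \<bar>y - x\<bar> < d2 \<Longrightarrow> \<bar>G y - G x\<bar> < e"
      using ucG e unfolding uniformly_continuous_on_def dist_real_def by blast
    show "\<exists>d>0. \<forall>x y. s \<le> x \<longrightarrow> x \<le> y \<longrightarrow> y \<le> t \<longrightarrow> y - x < d \<longrightarrow>
        \<bar>F y * G y - integral {A..y} h - (F x * G x - integral {A..x} h)\<bar> \<le> e * (M y - M x)"
    proof (intro exI[of _ "min d1 d2"] conjI allI impI)
      fix x y assume xy: "s \<le> x" "x \<le> y" "y \<le> t" "y - x < min d1 d2"
      then have AB: "A \<le> x" "x \<le> y" "y \<le> B" using st by auto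
      have fi: "f integrable_on {x..y}" and gi: "g integrable_on {x..y}" and hi: "h integrable_on {x..y}"
        using primitive_onD(2)[OF F AB] primitive_onD(2)[OF G AB] primitive_onD(2)[OF hp AB] by auto
      have 1: "F y * G y - F x * G x = integral {x..y} (\<lambda>r. G y * f r + F x * g r)"
      proof -
        have "integral {x..y} (\<lambda>r. G y * f r + F x * g r) = G y * (F y - F x) + F x * (G y - G x)"
          using fi gi primitive_onD(1)[OF F AB] primitive_onD(1)[OF G AB]
          by (subst Henstock_Kurzweil_Integration.integral_add) (auto intro: integrable_on_mult_right)
        then show ?thesis by (simp add: algebra_simps)
      qed
      have "F y * G y - integral {A..y} h - (F x * G x - integral {A..x} h)
         = integral {x..y} (\<lambda>r. G y * f r + F x * g r) - integral {x..y} h"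
        using 1 primitive_onD(1)[OF hp AB] by simp
      also have "\<dots> = integral {x..y} (\<lambda>r. (G y * f r + F x * g r) - h r)"
        using fi gi hi by (intro Henstock_Kurzweil_Integration.integral_diff[symmetric] Henstock_Kurzweil_Integration.integrable_add integrable_on_mult_right)
      finally have 2: "F y * G y - integral {A..y} h - (F x * G x - integral {A..x} h)
         = integral {x..y} (\<lambda>r. (G y * f r + F x * g r) - h r)" .
      have "norm (integral {x..y} (\<lambda>r. (G y * f r + F x * g r) - h r))
        \<le> integral {x..y} (\<lambda>r. e * (\<bar>f r\<bar> + \<bar>g r\<bar>))"
      proof (rule Henstock_Kurzweil_Integration.integral_norm_bound_integral)
        show "(\<lambda>r. (G y * f r + F x * g r) - h r) integrable_on {x..y}"
          using fi gi hi by (intro Henstock_Kurzweil_Integration.integrable_diff Henstock_Kurzweil_Integration.integrable_add integrable_on_mult_right)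
        show "(\<lambda>r. e * (\<bar>f r\<bar> + \<bar>g r\<bar>)) integrable_on {x..y}"
          by (intro integrable_on_mult_right primitive_onD(2)[OF Mp AB])
        fix r assume r: "r \<in> {x..y}"
        have "\<bar>G y - G r\<bar> \<le> e" "\<bar>F x - F r\<bar> \<le> e"
          using d2(2)[of r y] d1(2)[of r x] r AB xy(4) by auto
        then have "\<bar>G y - G r\<bar> * \<bar>f r\<bar> \<le> e * \<bar>f r\<bar>" "\<bar>F x - F r\<bar> * \<bar>g r\<bar> \<le> e * \<bar>g r\<bar>"
          by (auto intro: mult_right_mono)
        moreover have "(G y * f r + F x * g r) - h r = (G y - G r) * f r + (F x - F r) * g r"
          by (simp add: h_def algebra_simps)
        moreover have "\<bar>(G y - G r) * f r + (F x - F r) * g r\<bar> \<le> \<bar>G y - G r\<bar> * \<bar>f r\<bar> + \<bar>F x - F r\<bar> * \<bar>g r\<bar>"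
          by (rule order_trans[OF abs_triangle_ineq]) (simp add: abs_mult)
        ultimately show "norm ((G y * f r + F x * g r) - h r) \<le> e * (\<bar>f r\<bar> + \<bar>g r\<bar>)"
          by (simp add: distrib_left)
      qed
      also have "\<dots> = e * (M y - M x)"
        using primitive_onD(1)[OF Mp AB] by simp
      finally show "\<bar>F y * G y - integral {A..y} h - (F x * G x - integral {A..x} h)\<bar> \<le> e * (M y - M x)"
        unfolding 2 by simp
    qed (use d1 d2 in auto)
  qed
  then have "integral {s..t} h = F t * G t - F s * G s"
    using primitive_onD(1)[OF hp st] by simp
  then show "integral {s..t} (\<lambda>x. G x * f x + F x * g x) = F t * G t - F s * G s"
    by (simp add: h_def[abs_def])
qed

lemma primitive_on_C1:
  assumes "\<And>x. (F has_real_derivative f x) (at x)" "continuous_on UNIV f"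
  shows "primitive_on A B F f"
  unfolding primitive_on_def
proof (intro conjI allI impI)
  show "f absolutely_integrable_on {A..B}"
    by (rule absolutely_integrable_continuous_real) (use assms(2) continuous_on_subset in blast)
  fix s t :: real assume "s \<le> t"
  then have "(f has_integral F t - F s) {s..t}"
    by (intro fundamental_theorem_of_calculus)
      (auto simp: has_real_derivative_iff_has_vector_derivative[symmetric] intro: has_field_derivative_at_within assms(1))
  then show "integral {s..t} f = F t - F s" by (rule integral_unique)
qed

lemma lebesgue_on_interval_integral:
  fixes f :: "real \<Rightarrow> real"
  assumes "integrable (lebesgue_on {0<..<H}) f"
  shows "(\<integral>x. f x \<partial>lebesgue_on {0<..<H}) = integral {0..H} f"
  using lebesgue_integral_eq_integral[OF assms] by (simp add: integral_open_interval_real)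

lemma absolutely_integrable_interval_iff:
  fixes f :: "real \<Rightarrow> real"
  shows "f absolutely_integrable_on {a..b} \<longleftrightarrow> integrable (lebesgue_on {a<..<b}) f"
  using absolutely_integrable_on_Icc_iff_Ioo[where f=f and a=a and b=b]
  by (simp add: set_integrable_def integrable_restrict_space)

lemma continuous_L2_interval:
  fixes f :: "real \<Rightarrow> real"
  assumes "continuous_on {a..b} f" shows "f \<in> L2 {a<..<b}"
proof -
  have "f absolutely_integrable_on {a..b}" "(\<lambda>x. (f x)\<^sup>2) absolutely_integrable_on {a..b}"
    using assms by (auto intro!: absolutely_integrable_continuous_real continuous_intros)
  then show ?thesis unfolding absolutely_integrable_interval_iff L2_def by auto
qed

lemma exists_unit_test_fun:
  assumes "H > (0::real)"
  obtains \<theta> where "\<theta> \<in> test_fun {0<..<H}" "integral {0..H} \<theta> = 1"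
proof -
  define \<theta>0 where "\<theta>0 x = flat_exp 1 0 (x \<bullet> 1 - H/4) * flat_exp 1 0 (3*H/4 - x \<bullet> 1)" for x :: real
  have sm: "smooth \<theta>0" unfolding \<theta>0_def[abs_def] by (intro smooth_mult smooth_flat_exp_affine) auto
  define I where "I = integral {0..H} \<theta>0"
  have "I \<noteq> 0"
  proof
    assume "I = 0"
    then have "\<forall>x\<in>{0..H}. \<theta>0 x = 0"
      unfolding I_def using assms smooth_continuous_on[OF sm]
      by (subst (asm) integral_eq_0_iff) (auto simp: \<theta>0_def flat_exp_0_le_1)
    then have "\<theta>0 (H/2) = 0" using assms by auto
    then show False using assms by (simp add: \<theta>0_def flat_exp_def split: if_splits)
  qed
  have "(\<lambda>x. inverse I * \<theta>0 x) \<in> test_fun {0<..<H}"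
  proof (rule test_funI[where K="{H/4..3*H/4}"])
    show "smooth (\<lambda>x. inverse I * \<theta>0 x)" by (intro smooth_mult smooth_const sm)
    fix x assume "x \<notin> {H/4..3*H/4}"
    then show "inverse I * \<theta>0 x = 0" by (auto simp: \<theta>0_def flat_exp_def)
  qed (use assms in auto)
  moreover have "integral {0..H} (\<lambda>x. inverse I * \<theta>0 x) = 1"
    using \<open>I \<noteq> 0\<close> by (simp add: I_def)
  ultimately show ?thesis using that by blast
qed

text \<open>The condition on the integral makes the primitive vanish to the right of the support as well.\<close>

lemma test_fun_antiderivative:
  assumes chi: "\<eta> \<in> test_fun {0<..<H::real}" and zero: "integral {0..H} \<eta> = 0" and H: "H > 0"
  obtains \<psi> where "\<psi> \<in> test_fun {0<..<H}" "\<And>x. (\<psi> has_real_derivative \<eta> x) (at x)"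
proof -
  obtain K where K: "compact K" "K \<subseteq> {0<..<H}" "\<And>x. x \<notin> K \<Longrightarrow> \<eta> x = 0"
    using test_fun_compact_support[OF chi] by metis
  have sm: "smooth \<eta>" using chi by (simp add: test_fun_def)
  have cont: "continuous_on S \<eta>" for S by (rule smooth_continuous_on[OF sm])
  obtain \<alpha> \<beta> where ab: "0 < \<alpha>" "\<beta> < H" "K \<subseteq> {\<alpha>..\<beta>}"
  proof (cases "K = {}")
    case True
    then show ?thesis using that[of "H/2" "H/2"] H by auto
  next
    case False
    obtain x where x: "x \<in> K" "\<forall>y\<in>K. x \<le> y" using compact_attains_inf[OF K(1) False] by blast
    obtain z where z: "z \<in> K" "\<forall>y\<in>K. y \<le> z" using compact_attains_sup[OF K(1) False] by blast
    show ?thesis by (rule that[of x z]) (use x z K(2) in auto)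
  qed
  define \<psi> where "\<psi> x = (if x \<ge> 0 then integral {0..x} \<eta> else - integral {x..0} \<eta>)" for x
  have prim: "\<psi> t - \<psi> s = integral {s..t} \<eta>" if "s \<le> t" for s t
  proof -
    have i: "\<eta> integrable_on {p..q}" for p q by (rule integrable_continuous_real[OF cont])
    consider "0 \<le> s" | "s < 0" "0 \<le> t" | "t < 0" by linarith
    then show ?thesis
    proof cases
      case 1
      then show ?thesis using Henstock_Kurzweil_Integration.integral_combine[OF 1 that i] that by (simp add: \<psi>_def)
    next
      case 2
      then show ?thesis using Henstock_Kurzweil_Integration.integral_combine[of s 0 t, OF _ _ i] by (simp add: \<psi>_def)
    next
      case 3
      then show ?thesis using Henstock_Kurzweil_Integration.integral_combine[of s t 0, OF that _ i] that by (simp add: \<psi>_def)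
    qed
  qed
  have der: "(\<psi> has_real_derivative \<eta> x) (at x)" for x
  proof -
    have "((\<lambda>t. integral {x - 1..t} \<eta>) has_real_derivative \<eta> x) (at x within {x-1..x+1})"
      by (rule integral_has_real_derivative[OF cont]) auto
    then have "((\<lambda>t. integral {x - 1..t} \<eta>) has_real_derivative \<eta> x) (at x)"
      by (subst (asm) at_within_Icc_at) auto
    then have "((\<lambda>t. integral {x - 1..t} \<eta> + \<psi> (x - 1)) has_real_derivative \<eta> x) (at x)"
      using DERIV_add[OF _ DERIV_const[of "\<psi> (x - 1)"]] by fastforce
    then show ?thesis
    proof (rule has_field_derivative_transform_within_open[where S="{x-1<..}"])
      show "integral {x - 1..t} \<eta> + \<psi> (x - 1) = \<psi> t" if "t \<in> {x-1<..}" for t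
        using prim[of "x-1" t] that by simp
    qed auto
  qed
  have z: "integral {s..t} \<eta> = 0" if "{s..t} \<inter> K \<subseteq> {}" for s t
  proof -
    have "integral {s..t} \<eta> = integral {s..t} (\<lambda>x. 0)"
    proof (rule integral_cong)
      fix x assume "x \<in> {s..t}"
      then have "x \<notin> K" using that by blast
      then show "\<eta> x = 0" by (rule K(3))
    qed
    then show ?thesis by simp
  qed
  have supp: "\<psi> x = 0" if x: "x \<notin> {\<alpha>..\<beta>}" for x
  proof (cases "x < \<alpha>")
    case True
    have "{0..x} \<inter> K \<subseteq> {}" "{x..0} \<inter> K \<subseteq> {}" using ab True by auto
    then show ?thesis using z by (simp add: \<psi>_def)
  next
    case False
    then have xb: "\<beta> < x" using x by auto
    have "\<psi> H = 0" using zero H by (simp add: \<psi>_def)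
    moreover have "integral {x..H} \<eta> = 0" "integral {H..x} \<eta> = 0"
      using ab xb by (auto intro!: z)
    ultimately show ?thesis using prim[of x H] prim[of H x] by (cases "x \<le> H") auto
  qed
  have "\<psi> \<in> test_fun {0<..<H}"
  proof (rule test_funI[where K="{\<alpha>..\<beta>}"])
    show "smooth \<psi>" by (rule smooth_antideriv[OF der sm])
  qed (use ab supp in auto)
  then show ?thesis using der that by blast
qed

text \<open>Subtract a primitive of \<open>du\<close>: the difference \<open>v\<close> is orthogonal to all derivatives of test
  functions, that is, to all test functions with integral zero. Correcting an arbitrary test function
  by a multiple of a fixed one of integral \<open>1\<close> shows that \<open>v\<close> is a constant.\<close>

lemma weak_derivative_primitive:
  assumes H: "H > 0" and wd: "weak_pderiv {0<..<H::real} 1 u du"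
  obtains F where "primitive_on 0 H F du" "AE y in lebesgue_on {0<..<H}. u y = F y"
proof -
  let ?L = "lebesgue_on {0<..<H}"
  have U: "open {0<..<H}" "bounded {0<..<H}" by auto
  have uL: "u \<in> L2 {0<..<H}" and duL: "du \<in> L2 {0<..<H}"
    and by_parts: "\<And>\<psi>. \<psi> \<in> test_fun {0<..<H} \<Longrightarrow> (\<integral>x. u x * pderiv 1 \<psi> x \<partial>?L) = - (\<integral>x. du x * \<psi> x \<partial>?L)"
    using wd by (auto simp: weak_pderiv_def L2_inner_def)
  have dua: "du absolutely_integrable_on {0..H}"
    unfolding absolutely_integrable_interval_iff by (rule L2_integrable[OF U duL])
  define F0 where "F0 = (\<lambda>t. integral {0..t} du)"
  have F0: "primitive_on 0 H F0 du"
    using primitive_on_integral[OF dua, where k=0] by (simp add: F0_def)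
  have F0c: "continuous_on {0..H} F0" by (rule primitive_on_continuous[OF F0])
  have tL: "\<eta> \<in> L2 {0<..<H}" if "\<eta> \<in> test_fun {0<..<H}" for \<eta>
    using that by (intro continuous_L2_interval smooth_continuous_on) (simp add: test_fun_def)
  have F0L: "F0 \<in> L2 {0<..<H}" by (rule continuous_L2_interval[OF F0c])
  define v where "v x = u x - F0 x" for x
  have vt: "integrable ?L (\<lambda>x. v x * \<eta> x)" if "\<eta> \<in> test_fun {0<..<H}" for \<eta>
    unfolding v_def left_diff_distrib
    by (intro Bochner_Integration.integrable_diff L2_mult_integrable uL F0L tL that)
  have key: "(\<integral>x. v x * \<eta> x \<partial>?L) = 0" if eta: "\<eta> \<in> test_fun {0<..<H}" and z: "integral {0..H} \<eta> = 0" for \<eta>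
  proof -
    obtain \<psi> where psi: "\<psi> \<in> test_fun {0<..<H}" and d: "\<And>x. (\<psi> has_real_derivative \<eta> x) (at x)"
      using test_fun_antiderivative[OF eta z H] by metis
    have pd: "pderiv 1 \<psi> x = \<eta> x" for x
      using pderiv_eqI[OF d[unfolded has_field_derivative_def], of 1] by simp
    have "primitive_on 0 H \<psi> \<eta>"
      using eta smooth_continuous_on by (intro primitive_on_C1 d) (auto simp: test_fun_def)
    from primitive_on_mult[OF F0 this]
    have "integral {0..H} (\<lambda>x. \<psi> x * du x + F0 x * \<eta> x) = F0 H * \<psi> H - F0 0 * \<psi> 0"
      by (rule primitive_onD(1)) (use H in auto)
    moreover obtain K where K: "compact K" "K \<subseteq> {0<..<H}" "\<And>x. x \<notin> K \<Longrightarrow> \<psi> x = 0"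
      using test_fun_compact_support[OF psi] by metis
    moreover have "\<psi> 0 = 0" "\<psi> H = 0"
      using K(2) by (auto intro!: K(3))
    ultimately have "integral {0..H} (\<lambda>x. \<psi> x * du x + F0 x * \<eta> x) = 0" by simp
    moreover have i1: "integrable ?L (\<lambda>x. du x * \<psi> x)" and i2: "integrable ?L (\<lambda>x. F0 x * \<eta> x)"
      and i3: "integrable ?L (\<lambda>x. u x * \<eta> x)"
      by (intro L2_mult_integrable uL duL F0L tL psi eta)+
    ultimately have "(\<integral>x. du x * \<psi> x + F0 x * \<eta> x \<partial>?L) = 0"
      by (subst lebesgue_on_interval_integral) (auto simp: mult.commute)
    then have "(\<integral>x. du x * \<psi> x \<partial>?L) + (\<integral>x. F0 x * \<eta> x \<partial>?L) = 0"
      using i1 i2 by simp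
    then show ?thesis
      using by_parts[OF psi] i2 i3 unfolding pd v_def left_diff_distrib by simp
  qed
  obtain \<theta> where th: "\<theta> \<in> test_fun {0<..<H}" "integral {0..H} \<theta> = 1"
    using exists_unit_test_fun[OF H] by metis
  define k where "k = (\<integral>x. v x * \<theta> x \<partial>?L)"
  have "AE x in ?L. v x - k = 0"
  proof (rule orthogonal_test_fun_imp_zero[OF U(1)])
    have "(\<lambda>x. k) \<in> L2 {0<..<H}" by (rule continuous_L2_interval) auto
    then have "integrable ?L (\<lambda>x. k)" by (rule L2_integrable[OF U])
    moreover have "integrable ?L v"
      unfolding v_def by (intro Bochner_Integration.integrable_diff L2_integrable[OF U] uL F0L)
    ultimately show "integrable ?L (\<lambda>x. v x - k)" by (rule Bochner_Integration.integrable_diff[rotated])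
    fix \<eta> assume eta: "\<eta> \<in> test_fun {0<..<H}"
    define c where "c = integral {0..H} \<eta>"
    have sm: "smooth \<eta>" "smooth \<theta>" using eta th by (auto simp: test_fun_def)
    have ei: "\<eta> integrable_on {0..H}" "\<theta> integrable_on {0..H}"
      using sm by (auto intro: integrable_continuous_real smooth_continuous_on)
    have t: "(\<lambda>x. \<eta> x - c * \<theta> x) \<in> test_fun {0<..<H}"
    proof -
      obtain K1 where K1: "compact K1" "K1 \<subseteq> {0<..<H}" "\<And>x. x \<notin> K1 \<Longrightarrow> \<eta> x = 0"
        using test_fun_compact_support[OF eta] by metis
      obtain K2 where K2: "compact K2" "K2 \<subseteq> {0<..<H}" "\<And>x. x \<notin> K2 \<Longrightarrow> \<theta> x = 0"
        using test_fun_compact_support[OF th(1)] by metis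
      show ?thesis
        by (rule test_funI[where K="K1 \<union> K2"])
          (use K1 K2 sm in \<open>auto intro!: smooth_diff smooth_mult[OF smooth_const]\<close>)
    qed
    have "integral {0..H} (\<lambda>x. \<eta> x - c * \<theta> x) = 0"
      using ei th(2)
      by (subst Henstock_Kurzweil_Integration.integral_diff) (auto intro: integrable_on_mult_right simp: c_def)
    from key[OF t this] have "(\<integral>x. v x * \<eta> x - c * (v x * \<theta> x) \<partial>?L) = 0"
      by (simp add: right_diff_distrib mult_ac)
    then have 1: "(\<integral>x. v x * \<eta> x \<partial>?L) = c * k"
      using vt[OF eta] vt[OF th(1)] by (simp add: k_def)
    have ii: "integrable ?L \<eta>" by (rule L2_integrable[OF U tL[OF eta]])
    have "(\<integral>x. \<eta> x \<partial>?L) = c"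
      unfolding c_def by (rule lebesgue_on_interval_integral[OF ii])
    then show "(\<integral>x. (v x - k) * \<eta> x \<partial>?L) = 0"
      using 1 vt[OF eta] ii by (simp add: left_diff_distrib)
  qed
  moreover have "primitive_on 0 H (\<lambda>t. k + F0 t) du"
    using primitive_on_integral[OF dua, where k=k] by (simp add: F0_def)
  moreover have "AE y in ?L. u y = k + F0 y"
    using calculation(1) by eventually_elim (simp add: v_def)
  ultimately show ?thesis using that by blast
qed

section \<open>The energy under a coefficient of bounded variation\<close>

text \<open>The variation function of \<open>c\<close>. Its increments dominate those of \<open>c\<close> and it is monotone, so it
  takes the part of the integral of \<open>|c'|\<close> when \<open>c\<close> has jumps.\<close>

definition variation_to :: "(real \<Rightarrow> real) \<Rightarrow> real \<Rightarrow> real" where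
  "variation_to c t = enn2real (total_variation c {0<..t})"

lemma total_variation_mono: "S \<subseteq> T \<Longrightarrow> total_variation f S \<le> total_variation f T"
  unfolding total_variation_def by (intro SUP_subset_mono) auto

text \<open>A partition of \<open>{0<..s}\<close> can be prolonged by the points \<open>s\<close> and \<open>t\<close>.\<close>

lemma variation_to_increment:
  assumes fin: "total_variation c {0<..<H} \<le> ennreal V" and st: "0 < s" "s \<le> t" "t < H"
  shows "\<bar>c t - c s\<bar> \<le> variation_to c t - variation_to c s"
proof -
  define T where "T = total_variation c {0<..t}"
  have "T \<le> total_variation c {0<..<H}"
    unfolding T_def by (rule total_variation_mono) (use st in auto)
  then have Tfin: "T < top" using fin by (metis ennreal_less_top le_less_trans)
  have *: "(\<Sum>i<n. \<bar>c (p (Suc i)) - c (p i)\<bar>) + \<bar>c t - c s\<bar> \<le> enn2real T"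
    if p: "incseq p" "p ` {..n} \<subseteq> {0<..s}" for n :: nat and p
  proof -
    \<comment> \<open>An increasing sequence must be given on all of \<open>nat\<close>; it stays at \<open>t\<close> after the two new points.\<close>
    define q where "q i = (if i \<le> n then p i else if i = Suc n then s else t)" for i
    have pn: "p i \<le> s" "0 < p i" if "i \<le> n" for i using p(2) that by auto
    have q: "incseq q"
    proof (rule incseq_SucI)
      fix i show "q i \<le> q (Suc i)"
        using incseqD[OF p(1), of i "Suc i"] pn[of i] st by (auto simp: q_def)
    qed
    have qs: "q ` {..n+2} \<subseteq> {0<..t}"
      using pn st by (fastforce simp: q_def)
    have "(\<Sum>i<n+2. ennreal \<bar>c (q (Suc i)) - c (q i)\<bar>) \<le> T"
      unfolding T_def total_variation_def
      by (rule SUP_upper2[of "(n+2, q)"]) (use q qs in auto)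
    then have "ennreal (\<Sum>i<n+2. \<bar>c (q (Suc i)) - c (q i)\<bar>) \<le> ennreal (enn2real T)"
      using Tfin by (simp add: sum_ennreal)
    then have "(\<Sum>i<n+2. \<bar>c (q (Suc i)) - c (q i)\<bar>) \<le> enn2real T"
      by (simp only: ennreal_le_iff[OF enn2real_nonneg])
    moreover have "(\<Sum>i<n+2. \<bar>c (q (Suc i)) - c (q i)\<bar>)
      = (\<Sum>i<n. \<bar>c (q (Suc i)) - c (q i)\<bar>) + \<bar>c s - c (p n)\<bar> + \<bar>c t - c s\<bar>"
      by (simp add: q_def)
    moreover have "(\<Sum>i<n. \<bar>c (q (Suc i)) - c (q i)\<bar>) = (\<Sum>i<n. \<bar>c (p (Suc i)) - c (p i)\<bar>)"
      by (rule sum.cong) (auto simp: q_def)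
    ultimately show ?thesis by simp
  qed
  have nn: "0 \<le> enn2real T - \<bar>c t - c s\<bar>"
    using *[of "\<lambda>_. s" 0] st by (simp add: incseq_def)
  have "total_variation c {0<..s} \<le> ennreal (enn2real T - \<bar>c t - c s\<bar>)"
    unfolding total_variation_def
  proof (rule SUP_least, clarify)
    fix n :: nat and p assume p: "incseq p" "p ` {..n} \<subseteq> {0<..s}"
    show "(\<Sum>i<n. ennreal \<bar>c (p (Suc i)) - c (p i)\<bar>) \<le> ennreal (enn2real T - \<bar>c t - c s\<bar>)"
      using *[OF p] by (simp add: sum_ennreal ennreal_leI)
  qed
  then have "variation_to c s \<le> enn2real T - \<bar>c t - c s\<bar>"
    unfolding variation_to_def using nn by (simp add: enn2real_leI)
  then show ?thesis by (simp add: variation_to_def T_def)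
qed

lemma variation_to_bounds:
  assumes fin: "total_variation c {0<..<H} \<le> ennreal V" and V: "V \<ge> 0" and t: "t < H"
  shows "0 \<le> variation_to c t" "variation_to c t \<le> V"
proof -
  show "0 \<le> variation_to c t" by (simp add: variation_to_def)
  have "total_variation c {0<..t} \<le> total_variation c {0<..<H}"
    by (rule total_variation_mono) (use t in auto)
  then show "variation_to c t \<le> V"
    unfolding variation_to_def using fin V by (intro enn2real_leI) auto
qed

text \<open>The error term is of second order, so it disappears when a uniform partition is refined, while
  the factors multiply to the exponential since the increments of the monotone function \<open>W\<close> add up.
  The order of \<open>x0\<close> and \<open>y0\<close> is arbitrary, so that bounds propagate in both directions.\<close>

lemma discrete_gronwall:
  fixes E W :: "real \<Rightarrow> real"
  assumes I: "convex I" "x0 \<in> I" "y0 \<in> I"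
    and step: "\<And>x y. x \<in> I \<Longrightarrow> y \<in> I \<Longrightarrow>
      E y \<le> E x * (1 + \<kappa> * \<bar>W y - W x\<bar>) + C * \<bar>y - x\<bar> * \<bar>W y - W x\<bar>"
    and W: "\<And>x y. x \<in> I \<Longrightarrow> y \<in> I \<Longrightarrow> x \<le> y \<Longrightarrow> W x \<le> W y"
    and nn: "\<kappa> \<ge> 0" "C \<ge> 0" "\<And>x. x \<in> I \<Longrightarrow> E x \<ge> 0"
  shows "E y0 \<le> exp (\<kappa> * \<bar>W y0 - W x0\<bar>) * E x0"
proof -
  define D where "D = \<bar>W y0 - W x0\<bar>"
  have bound: "E y0 \<le> exp (\<kappa> * D) * (E x0 + C * (\<bar>y0 - x0\<bar> / real (Suc N)) * D)" for N
  proof -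
    define h where "h = (y0 - x0) / real (Suc N)"
    define x where "x i = x0 + real i * h" for i :: nat
    have x0: "x 0 = x0" by (simp add: x_def)
    have xN: "x (Suc N) = y0" by (simp add: x_def h_def del: of_nat_Suc)
    have xI: "x i \<in> I" if "i \<le> Suc N" for i
    proof -
      have "(1 - real i / real (Suc N)) *\<^sub>R x0 + (real i / real (Suc N)) *\<^sub>R y0 \<in> I"
        using that by (intro convexD[OF I(1,2,3)]) (auto simp: divide_simps)
      also have "(1 - real i / real (Suc N)) *\<^sub>R x0 + (real i / real (Suc N)) *\<^sub>R y0 = x i"
        by (simp add: x_def h_def algebra_simps diff_divide_distrib del: of_nat_Suc)
      finally show ?thesis .
    qed
    have xstep: "x (Suc i) - x i = h" for i by (simp add: x_def algebra_simps)
    define w where "w i = \<bar>W (x (Suc i)) - W (x i)\<bar>" for i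
    define S where "S i = \<bar>W (x i) - W x0\<bar>" for i
    have S: "S (Suc i) = S i + w i" if i: "Suc i \<le> Suc N" for i
    proof (cases "h \<ge> 0")
      case True
      have "x i \<le> x (Suc i)" "x0 \<le> x i" using True xstep[of i] by (auto simp: x_def)
      then have "W (x i) \<le> W (x (Suc i))" "W x0 \<le> W (x i)" using W xI i I by auto
      then show ?thesis by (simp add: S_def w_def)
    next
      case False
      have "real i * h \<le> 0" using False by (intro mult_nonneg_nonpos) auto
      then have "x (Suc i) \<le> x i" "x i \<le> x0" using False xstep[of i] by (auto simp: x_def)
      then have "W (x (Suc i)) \<le> W (x i)" "W (x i) \<le> W x0" using W xI i I by auto
      then show ?thesis by (simp add: S_def w_def)
    qed
    have "E (x i) \<le> exp (\<kappa> * S i) * (E x0 + C * \<bar>h\<bar> * S i)" if "i \<le> Suc N" for i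
      using that
    proof (induction i)
      case 0
      then show ?case by (simp add: x0 S_def)
    next
      case (Suc i)
      have w0: "w i \<ge> 0" and S0: "S i \<ge> 0" by (auto simp: w_def S_def)
      have E0: "E x0 \<ge> 0" by (rule nn(3)[OF I(2)])
      have Ch: "C * \<bar>h\<bar> \<ge> 0" using nn by simp
      define Z where "Z = E x0 + C * \<bar>h\<bar> * S i"
      have Z: "Z \<ge> 0" unfolding Z_def by (rule add_nonneg_nonneg[OF E0 mult_nonneg_nonneg[OF Ch S0]])
      have ge1: "1 \<le> exp (\<kappa> * S (Suc i))" using nn(1) by (simp add: S_def)
      have "E (x (Suc i)) \<le> E (x i) * (1 + \<kappa> * w i) + C * \<bar>h\<bar> * w i"
        using step[OF xI[of i] xI[of "Suc i"]] Suc.prems by (simp add: w_def xstep)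
      also have "E (x i) * (1 + \<kappa> * w i) \<le> E (x i) * exp (\<kappa> * w i)"
        using nn(3)[OF xI[of i]] Suc.prems exp_ge_add_one_self[of "\<kappa> * w i"] by (intro mult_left_mono) auto
      also have "E (x i) * exp (\<kappa> * w i) \<le> (exp (\<kappa> * S i) * Z) * exp (\<kappa> * w i)"
        using Suc unfolding Z_def by (intro mult_right_mono) auto
      also have "(exp (\<kappa> * S i) * Z) * exp (\<kappa> * w i) = exp (\<kappa> * S (Suc i)) * Z"
        using S[OF Suc.prems] by (simp add: exp_add distrib_left mult_ac)
      also have "C * \<bar>h\<bar> * w i \<le> exp (\<kappa> * S (Suc i)) * (C * \<bar>h\<bar> * w i)"
        using mult_right_mono[OF ge1, of "C * \<bar>h\<bar> * w i"] Ch w0 by simp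
      finally have "E (x (Suc i)) \<le> exp (\<kappa> * S (Suc i)) * Z + exp (\<kappa> * S (Suc i)) * (C * \<bar>h\<bar> * w i)"
        by simp
      also have "\<dots> = exp (\<kappa> * S (Suc i)) * (Z + C * \<bar>h\<bar> * w i)"
        by (simp add: distrib_left)
      also have "Z + C * \<bar>h\<bar> * w i = E x0 + C * \<bar>h\<bar> * S (Suc i)"
        using S[OF Suc.prems] by (simp add: Z_def distrib_left)
      finally show ?case .
    qed
    from this[of "Suc N"] show ?thesis
      unfolding S_def xN D_def by (simp add: h_def abs_divide del: of_nat_Suc)
  qed
  have "(\<lambda>N. exp (\<kappa> * D) * (E x0 + C * (\<bar>y0 - x0\<bar> * inverse (real (Suc N))) * D))
      \<longlonglongrightarrow> exp (\<kappa> * D) * (E x0 + C * (\<bar>y0 - x0\<bar> * 0) * D)"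
    by (intro tendsto_intros LIMSEQ_inverse_real_of_nat)
  then have "E y0 \<le> exp (\<kappa> * D) * (E x0 + C * (\<bar>y0 - x0\<bar> * 0) * D)"
    by (rule LIMSEQ_le_const) (use bound[unfolded divide_inverse] in blast)
  then show ?thesis by (simp add: D_def)
qed

text \<open>For smooth \<open>c\<close> the energy \<open>E = g U\<^sup>2 + P\<^sup>2\<close> of the system \<open>U' = P/c\<close>, \<open>P' = -(lam - c m\<^sup>2) U\<close>
  has derivative \<open>g' U\<^sup>2\<close>: the weight \<open>g\<close> is chosen to cancel the terms with \<open>U P\<close>. Moreover
  \<open>|g'| \<le> lam |c'|\<close> and \<open>g \<ge> lam \<gamma>\<close>, so the logarithmic derivative of \<open>E\<close> is at most
  \<open>|c'| / \<gamma>\<close>, with a \<open>\<gamma>\<close> that depends neither on \<open>lam\<close> nor on \<open>m\<close>. For \<open>c\<close> of bounded variation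
  the same computation is done with finite differences: freezing \<open>g\<close> at an end point of a short
  interval, the terms with \<open>U P\<close> cancel up to the oscillation of \<open>c\<close> there times the length.\<close>

lemma energy_comparison:
  fixes H c\<^sub>m c\<^sub>M \<epsilon> V m lam :: real
  assumes H: "H > 0" and cm: "0 < c\<^sub>m" "c\<^sub>m < c\<^sub>M" and eps: "\<epsilon> > 0" and V: "V > 0"
    and c: "c \<in> K_class H c\<^sub>m c\<^sub>M V" and lam: "lam \<ge> (c\<^sub>M + \<epsilon>) * m\<^sup>2" "lam > 0"
    and U: "primitive_on 0 H U du" and P: "primitive_on 0 H P w" and N: "negligible N"
    and Pdu: "\<And>y. y \<in> {0..H} - N \<Longrightarrow> P y = c y * du y"
    and wU: "\<And>y. y \<in> {0..H} - N \<Longrightarrow> w y = - ((lam - c y * m\<^sup>2) * U y)"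
    and xy: "x \<in> {0<..<H}" "y \<in> {0<..<H}"
  defines "g \<equiv> \<lambda>r. (lam - c r * m\<^sup>2) * c r" and "\<gamma> \<equiv> c\<^sub>m * \<epsilon> / (c\<^sub>M + \<epsilon>)"
  shows "g x * (U x)\<^sup>2 + (P x)\<^sup>2 \<le> exp (V / \<gamma>) * (g y * (U y)\<^sup>2 + (P y)\<^sup>2)"
    and "lam * \<gamma> \<le> g x" and "g x \<le> lam * c\<^sub>M"
proof -
  define W where "W = variation_to c"
  define E where "E r = g r * (U r)\<^sup>2 + (P r)\<^sup>2" for r
  have cb: "c\<^sub>m \<le> c r" "c r \<le> c\<^sub>M" if "r \<in> {0<..<H}" for r
    using c that by (auto simp: K_class_def)
  have tv: "total_variation c {0<..<H} \<le> ennreal V" using c by (auto simp: K_class_def)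
  have Wle: "\<bar>c t - c s\<bar> \<le> W t - W s" if "0 < s" "s \<le> t" "t < H" for s t
    unfolding W_def using variation_to_increment[OF tv that] .
  have Wb: "0 \<le> W t" "W t \<le> V" if "t < H" for t
    unfolding W_def using variation_to_bounds[OF tv _ that] V by auto
  have cMe: "c\<^sub>M + \<epsilon> > 0" using cm eps by auto
  have gam: "\<gamma> > 0" unfolding \<gamma>_def using cm eps cMe by auto
  have m2: "m\<^sup>2 \<le> lam / (c\<^sub>M + \<epsilon>)" using lam(1) cMe by (simp add: field_simps)
  have q: "lam * (\<epsilon> / (c\<^sub>M + \<epsilon>)) \<le> lam - c r * m\<^sup>2" "lam - c r * m\<^sup>2 \<le> lam" if r: "r \<in> {0<..<H}" for r
  proof -
    have "c r * m\<^sup>2 \<le> c\<^sub>M * (lam / (c\<^sub>M + \<epsilon>))"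
      using cb[OF r] m2 cm by (intro mult_mono) auto
    also have "\<dots> = lam - lam * (\<epsilon> / (c\<^sub>M + \<epsilon>))" using cMe by (simp add: field_simps)
    finally show "lam * (\<epsilon> / (c\<^sub>M + \<epsilon>)) \<le> lam - c r * m\<^sup>2" by simp
    have "0 \<le> c r * m\<^sup>2" using cb[OF r] cm by auto
    then show "lam - c r * m\<^sup>2 \<le> lam" by simp
  qed
  have q0: "0 \<le> lam - c r * m\<^sup>2" if "r \<in> {0<..<H}" for r
  proof -
    have "0 \<le> lam * (\<epsilon> / (c\<^sub>M + \<epsilon>))" using lam(2) eps cMe by simp
    then show ?thesis using q(1)[OF that] by linarith
  qed
  have glb: "lam * \<gamma> \<le> g r" and gub: "g r \<le> lam * c\<^sub>M" if r: "r \<in> {0<..<H}" for r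
  proof -
    have "lam * (\<epsilon> / (c\<^sub>M + \<epsilon>)) * c\<^sub>m \<le> g r"
      unfolding g_def using q[OF r] cb[OF r] cm q0[OF r] by (intro mult_mono) auto
    then show "lam * \<gamma> \<le> g r" by (simp add: \<gamma>_def mult_ac)
    show "g r \<le> lam * c\<^sub>M"
      unfolding g_def using q[OF r] cb[OF r] cm q0[OF r] lam by (intro mult_mono) auto
  qed
  show "lam * \<gamma> \<le> g x" "g x \<le> lam * c\<^sub>M" using glb gub xy by auto
  \<comment> \<open>The factor \<open>lam - m\<^sup>2 (c t + c s)\<close> of the difference lies between \<open>- lam\<close> and \<open>lam\<close>, since
    \<open>0 \<le> c m\<^sup>2 \<le> lam\<close>.\<close>
  have gdiff: "\<bar>g t - g s\<bar> \<le> lam * \<bar>c t - c s\<bar>" if "s \<in> {0<..<H}" "t \<in> {0<..<H}" for s t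
  proof -
    have "g t - g s = (lam - m\<^sup>2 * (c t + c s)) * (c t - c s)"
      by (simp add: g_def algebra_simps)
    moreover have "\<bar>lam - m\<^sup>2 * (c t + c s)\<bar> \<le> lam"
      using q0[OF that(1)] q0[OF that(2)] q(2)[OF that(1)] q(2)[OF that(2)]
      by (simp add: abs_le_iff algebra_simps)
    ultimately show ?thesis by (simp add: abs_mult mult_right_mono)
  qed
  have Uc: "continuous_on {0..H} U" and Pc: "continuous_on {0..H} P"
    using U P by (auto intro: primitive_on_continuous)
  obtain B where B: "\<And>r. r \<in> {0..H} \<Longrightarrow> \<bar>U r\<bar> * \<bar>P r\<bar> \<le> B" "B \<ge> 0"
  proof -
    have "continuous_on {0..H} (\<lambda>r. \<bar>U r\<bar> * \<bar>P r\<bar>)" using Uc Pc by (intro continuous_intros)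
    then have "bounded ((\<lambda>r. \<bar>U r\<bar> * \<bar>P r\<bar>) ` {0..H})"
      using compact_Icc compact_continuous_image compact_imp_bounded by blast
    then obtain B where "\<forall>y\<in>(\<lambda>r. \<bar>U r\<bar> * \<bar>P r\<bar>) ` {0..H}. norm y \<le> B"
      unfolding bounded_iff by blast
    then have B: "\<bar>U r\<bar> * \<bar>P r\<bar> \<le> B" if "r \<in> {0..H}" for r
      using that by (auto simp: abs_mult)
    have "B \<ge> 0" by (rule order_trans[OF _ B[of 0]]) (use H in auto)
    then show ?thesis using that[of B] B by blast
  qed
  have UU: "primitive_on 0 H (\<lambda>r. U r * U r) (\<lambda>r. U r * du r + U r * du r)"
    by (rule primitive_on_mult[OF U U])
  have PP: "primitive_on 0 H (\<lambda>r. P r * P r) (\<lambda>r. P r * w r + P r * w r)"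
    by (rule primitive_on_mult[OF P P])
  define C where "C = 2 * B * lam / c\<^sub>m"
  have C0: "C \<ge> 0" unfolding C_def using B(2) lam(2) cm by simp
  \<comment> \<open>The increment of the energy when \<open>g\<close> is frozen at \<open>\<sigma>\<close>. The point \<open>\<sigma>\<close> is the
    target of the step below, hence the right or the left end point according to its direction.\<close>
  define X where "X \<sigma> s t = g \<sigma> * ((U t)\<^sup>2 - (U s)\<^sup>2) + ((P t)\<^sup>2 - (P s)\<^sup>2)" for \<sigma> s t
  have Xb: "\<bar>X \<sigma> s t\<bar> \<le> C * (t - s) * (W t - W s)"
    if st: "0 < s" "s \<le> t" "t < H" and sg: "\<sigma> = s \<or> \<sigma> = t" for \<sigma> s t
  proof -
    define k where "k r = g \<sigma> * (U r * du r + U r * du r) + (P r * w r + P r * w r)" for r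
    have st': "0 \<le> s" "s \<le> t" "t \<le> H" using st by auto
    have i: "(\<lambda>r. U r * du r + U r * du r) integrable_on {s..t}" "(\<lambda>r. P r * w r + P r * w r) integrable_on {s..t}"
      using primitive_onD(2)[OF UU st'] primitive_onD(2)[OF PP st'] .
    have ki: "k integrable_on {s..t}"
      unfolding k_def by (intro Henstock_Kurzweil_Integration.integrable_add integrable_on_mult_right i)
    have "integral {s..t} k = g \<sigma> * integral {s..t} (\<lambda>r. U r * du r + U r * du r)
        + integral {s..t} (\<lambda>r. P r * w r + P r * w r)"
      unfolding k_def
      by (subst Henstock_Kurzweil_Integration.integral_add[OF integrable_on_mult_right[OF i(1)] i(2)])
        (subst Henstock_Kurzweil_Integration.integral_mult_right, rule refl)
    also have "\<dots> = X \<sigma> s t"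
      unfolding X_def primitive_onD(1)[OF UU st'] primitive_onD(1)[OF PP st'] by (simp add: power2_eq_square)
    finally have kX: "integral {s..t} k = X \<sigma> s t" .
    have bd: "\<bar>k r\<bar> \<le> C * (W t - W s)" if r: "r \<in> {s..t} - N" for r
    proof -
      have r1: "r \<in> {0..H} - N" "r \<in> {0<..<H}" "\<sigma> \<in> {0<..<H}" using r st sg by auto
      have cr: "c r > 0" using cb[OF r1(2)] cm by auto
      have du: "du r = P r / c r" using Pdu[OF r1(1)] cr by simp
      have "k r = 2 * (U r * P r) * ((g \<sigma> - g r) / c r)"
        unfolding k_def wU[OF r1(1)] du using cr by (simp add: g_def field_simps)
      then have "\<bar>k r\<bar> = 2 * (\<bar>U r\<bar> * \<bar>P r\<bar>) * (\<bar>g \<sigma> - g r\<bar> / c r)"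
        using cr by (simp add: abs_mult)
      also have "\<dots> \<le> 2 * B * (lam * (W t - W s) / c\<^sub>m)"
      proof (intro mult_mono frac_le)
        have "\<bar>c \<sigma> - c r\<bar> \<le> W t - W s"
        proof (cases "\<sigma> = s")
          case True
          then show ?thesis using Wle[of s r] Wle[of r t] r st by (auto simp: abs_minus_commute)
        next
          case False
          then show ?thesis using Wle[of s r] Wle[of r t] r st sg by auto
        qed
        then have "lam * \<bar>c \<sigma> - c r\<bar> \<le> lam * (W t - W s)" using lam(2) by (intro mult_left_mono) auto
        then show "\<bar>g \<sigma> - g r\<bar> \<le> lam * (W t - W s)" using gdiff[OF r1(2,3)] by linarith
        then show "0 \<le> lam * (W t - W s)" by linarith
      qed (use B r1 cb[OF r1(2)] cm cr in auto)
      finally show ?thesis by (simp add: C_def)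
    qed
    have "integral {s..t} k \<le> integral {s..t} (\<lambda>r. C * (W t - W s))"
      by (rule integral_mono_negligible[OF N ki]) (use bd in \<open>auto simp: abs_le_iff\<close>)
    moreover have "integral {s..t} (\<lambda>r. - k r) \<le> integral {s..t} (\<lambda>r. C * (W t - W s))"
      by (rule integral_mono_negligible[OF N]) (use bd integrable_neg[OF ki] in \<open>auto simp: abs_le_iff\<close>)
    ultimately show ?thesis
      using st ki kX by (simp add: abs_le_iff mult_ac)
  qed
  have E0: "E r \<ge> 0" if "r \<in> {0<..<H}" for r
  proof -
    have "g r \<ge> 0" using glb[OF that] lam(2) gam by (meson less_imp_le mult_pos_pos order_trans)
    then show ?thesis by (simp add: E_def)
  qed
  have UE: "lam * (U r)\<^sup>2 \<le> E r / \<gamma>" if "r \<in> {0<..<H}" for r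
  proof -
    have "lam * \<gamma> * (U r)\<^sup>2 \<le> g r * (U r)\<^sup>2" using glb[OF that] by (intro mult_right_mono) auto
    then have "lam * \<gamma> * (U r)\<^sup>2 \<le> E r" unfolding E_def by (simp add: add_increasing2)
    then show ?thesis using gam by (simp add: pos_le_divide_eq mult_ac)
  qed
  have step: "E t \<le> E s * (1 + (1 / \<gamma>) * \<bar>W t - W s\<bar>) + C * \<bar>t - s\<bar> * \<bar>W t - W s\<bar>"
    if s: "s \<in> {0<..<H}" and t: "t \<in> {0<..<H}" for s t
  proof -
    have "\<bar>c t - c s\<bar> \<le> \<bar>W t - W s\<bar>"
      using Wle[of s t] Wle[of t s] s t by (cases "s \<le> t") (auto simp: abs_minus_commute)
    then have gW: "\<bar>g t - g s\<bar> \<le> lam * \<bar>W t - W s\<bar>"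
      using gdiff[OF s t] lam(2) by (meson less_imp_le mult_left_mono order_trans)
    have "(g t - g s) * (U s)\<^sup>2 \<le> (lam * \<bar>W t - W s\<bar>) * (U s)\<^sup>2"
      using gW by (intro mult_right_mono) auto
    also have "\<dots> = (lam * (U s)\<^sup>2) * \<bar>W t - W s\<bar>" by simp
    also have "\<dots> \<le> E s / \<gamma> * \<bar>W t - W s\<bar>"
      by (rule mult_right_mono[OF UE[OF s]]) simp
    finally have 1: "(g t - g s) * (U s)\<^sup>2 \<le> E s * (1 / \<gamma> * \<bar>W t - W s\<bar>)" by simp
    have 2: "E t - E s = (g t - g s) * (U s)\<^sup>2 + (g t * ((U t)\<^sup>2 - (U s)\<^sup>2) + ((P t)\<^sup>2 - (P s)\<^sup>2))"
      by (simp add: E_def algebra_simps)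
    have 3: "g t * ((U t)\<^sup>2 - (U s)\<^sup>2) + ((P t)\<^sup>2 - (P s)\<^sup>2) \<le> C * \<bar>t - s\<bar> * \<bar>W t - W s\<bar>"
    proof (cases "s \<le> t")
      case True
      have "W s \<le> W t" using Wle[of s t] True s t by auto
      then show ?thesis using Xb[of s t t] True s t unfolding X_def by (auto simp: abs_le_iff)
    next
      case False
      have "W t \<le> W s" using Wle[of t s] False s t by auto
      moreover have "g t * ((U t)\<^sup>2 - (U s)\<^sup>2) + ((P t)\<^sup>2 - (P s)\<^sup>2) = - X t t s"
        by (simp add: X_def algebra_simps)
      ultimately show ?thesis using Xb[of t s t] False s t
        by (auto simp: abs_le_iff abs_minus_commute[of t] abs_minus_commute[of "W t"])
    qed
    show ?thesis using 1 2 3 by (simp add: distrib_left)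
  qed
  have "E x \<le> exp (1 / \<gamma> * \<bar>W x - W y\<bar>) * E y"
  proof (rule discrete_gronwall[OF _ _ _ step])
    show "W s \<le> W t" if "s \<in> {0<..<H}" "t \<in> {0<..<H}" "s \<le> t" for s t
      using Wle[of s t] that by auto
  qed (use xy gam C0 E0 in auto)
  also have "\<dots> \<le> exp (V / \<gamma>) * E y"
  proof (rule mult_right_mono)
    have "\<bar>W x - W y\<bar> \<le> V" using Wb[of x] Wb[of y] xy by auto
    then show "exp (1 / \<gamma> * \<bar>W x - W y\<bar>) \<le> exp (V / \<gamma>)" using gam by (simp add: divide_right_mono)
  qed (rule E0[OF xy(2)])
  finally show "g x * (U x)\<^sup>2 + (P x)\<^sup>2 \<le> exp (V / \<gamma>) * (g y * (U y)\<^sup>2 + (P y)\<^sup>2)"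
    by (simp add: E_def)
qed

section \<open>Eigenfunctions on a subinterval\<close>

lemma L2_norm_subinterval:
  fixes u U :: "real \<Rightarrow> real"
  assumes u: "u \<in> L2 {0<..<H}" and ae: "AE y in lebesgue_on {0<..<H}. u y = U y"
    and U: "continuous_on {0..H} U" and ab: "0 \<le> a" "b \<le> H"
  shows "L2_norm {a<..<b} u = sqrt (integral {a..b} (\<lambda>y. (U y)\<^sup>2))"
proof -
  have sub: "{a<..<b} \<subseteq> {0<..<H}" using ab by auto
  have Uab: "continuous_on {a..b} U" by (rule continuous_on_subset[OF U]) (use ab in auto)
  have um: "u \<in> borel_measurable (lebesgue_on {a<..<b})"
    using measurable_restrict_mono[OF _ sub] u by (auto simp: L2_def)
  have Ui: "integrable (lebesgue_on {a<..<b}) (\<lambda>y. (U y)\<^sup>2)" and Um: "U \<in> borel_measurable (lebesgue_on {a<..<b})"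
    using continuous_L2_interval[OF Uab] by (auto simp: L2_def)
  have "AE y in lebesgue. y \<in> {0<..<H} \<longrightarrow> u y = U y" using ae by (simp add: AE_restrict_space_iff)
  then have "AE y in lebesgue. y \<in> {a<..<b} \<longrightarrow> u y = U y"
    by eventually_elim (use sub in blast)
  then have "AE y in lebesgue_on {a<..<b}. (u y)\<^sup>2 = (U y)\<^sup>2"
    by (auto simp: AE_restrict_space_iff elim!: eventually_mono)
  then have "(\<integral>y. (u y)\<^sup>2 \<partial>lebesgue_on {a<..<b}) = (\<integral>y. (U y)\<^sup>2 \<partial>lebesgue_on {a<..<b})"
    using um Um by (intro integral_cong_AE) auto
  also have "\<dots> = integral {a..b} (\<lambda>y. (U y)\<^sup>2)"
    using lebesgue_integral_eq_integral[OF Ui] by (simp add: integral_open_interval_real)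
  finally show ?thesis by (simp add: L2_norm_def)
qed

text \<open>By \<open>energy_comparison\<close> the energy is spread evenly over \<open>{0<..<H}\<close>, hence it has size at least
  a multiple of \<open>lam\<close> on \<open>{a<..<b}\<close>. It remains to exclude that all of it sits in \<open>P\<close>, which is
  done with the cutoff \<open>\<eta>(y) = (y - a)(b - y)\<close>: the primitive \<open>\<eta>\<^sup>2 U P\<close> vanishes at \<open>a\<close> and \<open>b\<close>,
  so the integral of its derivative \<open>h\<close> is \<open>0\<close>, and this controls the integral of \<open>\<eta>\<^sup>2 P\<^sup>2\<close> by \<open>lam\<close>
  times that of \<open>U\<^sup>2\<close> over \<open>{a<..<b}\<close>. A lower bound for \<open>lam\<close> makes the term with \<open>\<eta>'\<close>, which
  carries no factor \<open>lam\<close>, harmless.\<close>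

lemma sturm_liouville_lower_bound:
  fixes H c\<^sub>m c\<^sub>M \<epsilon> V a b lam0 :: real
  assumes H: "H > 0" and cm: "0 < c\<^sub>m" "c\<^sub>m < c\<^sub>M" and eps: "\<epsilon> > 0" and V: "V > 0"
    and ab: "a < b" "{a<..<b} \<subseteq> {0<..<H}" and lam0: "lam0 > 0"
  shows "\<exists>f>0. \<forall>c\<in>K_class H c\<^sub>m c\<^sub>M V. \<forall>m lam u. lam \<ge> (c\<^sub>M + \<epsilon>) * m\<^sup>2 \<longrightarrow> lam \<ge> lam0 \<longrightarrow>
    A_op H c m u (\<lambda>y. lam * u y) \<longrightarrow> L2_norm {0<..<H} u = 1 \<longrightarrow> f \<le> L2_norm {a<..<b} u"
proof -
  have cM: "c\<^sub>M > 0" using cm by simp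
  have ab': "0 \<le> a" "b \<le> H" using ab by (simp_all add: greaterThanLessThan_subseteq_greaterThanLessThan)
  define L where "L = b - a"
  define \<eta> where "\<eta> y = (y - a) * (b - y)" for y
  define \<eta>' where "\<eta>' y = a + b - 2 * y" for y
  define J where "J = integral {a..b} (\<lambda>y. (\<eta> y)\<^sup>2)"
  define \<gamma> where "\<gamma> = c\<^sub>m * \<epsilon> / (c\<^sub>M + \<epsilon>)"
  define K1 where "K1 = exp (V / \<gamma>) * max c\<^sub>M 1 / min \<gamma> 1"
  define Kc where "Kc = L ^ 4 + 2 * c\<^sub>M * (2 * c\<^sub>M * L\<^sup>2 / lam0 + L ^ 4)"
  have L: "L > 0" using ab by (simp add: L_def)
  have gam: "\<gamma> > 0" using cm eps cM by (simp add: \<gamma>_def)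
  have K1: "K1 > 0" using gam by (simp add: K1_def)
  have Kc: "Kc > 0" unfolding Kc_def using L cM lam0 by (intro add_pos_pos mult_pos_pos divide_pos_pos zero_less_power) auto
  have etac: "continuous_on S \<eta>" "continuous_on S \<eta>'" for S
    unfolding \<eta>_def[abs_def] \<eta>'_def[abs_def] by (intro continuous_intros)+
  have J: "J > 0"
  proof -
    have "J \<ge> 0" unfolding J_def by (rule Henstock_Kurzweil_Integration.integral_nonneg)
        (auto intro!: integrable_continuous_real continuous_intros etac)
    moreover have "J \<noteq> 0"
    proof
      assume "J = 0"
      then have "\<forall>y\<in>{a..b}. (\<eta> y)\<^sup>2 = 0"
        unfolding J_def using ab
        by (subst (asm) integral_eq_0_iff) (auto intro!: continuous_intros etac)
      then have "\<eta> ((a + b) / 2) = 0" using ab by auto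
      then show False using ab by (simp add: \<eta>_def)
    qed
    ultimately show ?thesis by simp
  qed
  have eta_bd: "(\<eta> y)\<^sup>2 \<le> L ^ 4" "(\<eta>' y)\<^sup>2 \<le> L\<^sup>2" if y: "y \<in> {a..b}" for y
  proof -
    have "0 \<le> \<eta> y" "\<eta> y \<le> L * L" unfolding \<eta>_def L_def using y by (auto intro!: mult_mono)
    then have "(\<eta> y)\<^sup>2 \<le> (L * L)\<^sup>2" by (intro power_mono)
    then show "(\<eta> y)\<^sup>2 \<le> L ^ 4" by (simp add: power2_eq_square power4_eq_xxxx mult.assoc)
    have "\<bar>\<eta>' y\<bar> \<le> \<bar>L\<bar>" unfolding \<eta>'_def L_def using y by auto
    then show "(\<eta>' y)\<^sup>2 \<le> L\<^sup>2" by (simp only: abs_le_square_iff)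
  qed
  define f where "f = sqrt (J / (H * K1 * Kc))"
  have "f > 0" unfolding f_def using J H K1 Kc by simp
  moreover have "f \<le> L2_norm {a<..<b} u"
    if c: "c \<in> K_class H c\<^sub>m c\<^sub>M V" and lam: "lam \<ge> (c\<^sub>M + \<epsilon>) * m\<^sup>2" "lam \<ge> lam0"
      and A: "A_op H c m u (\<lambda>y. lam * u y)" and nrm: "L2_norm {0<..<H} u = 1" for c m lam u
  proof -
    have lam_pos: "lam > 0" using lam lam0 by simp
    obtain du w where du: "weak_pderiv {0<..<H} 1 u du" and w: "weak_pderiv {0<..<H} 1 (\<lambda>y. c y * du y) w"
      and eq: "AE y in lebesgue_on {0<..<H}. lam * u y = c y * m\<^sup>2 * u y - w y"
      using A unfolding A_op_def by blast
    obtain U where U: "primitive_on 0 H U du" and uU: "AE y in lebesgue_on {0<..<H}. u y = U y"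
      using weak_derivative_primitive[OF H du] .
    obtain P where P: "primitive_on 0 H P w" and cP: "AE y in lebesgue_on {0<..<H}. c y * du y = P y"
      using weak_derivative_primitive[OF H w] .
    have Uc: "continuous_on {0..H} U" and Pc: "continuous_on {0..H} P"
      using U P by (auto intro: primitive_on_continuous)
    have "AE y in lebesgue_on {0<..<H}. P y = c y * du y \<and> w y = - ((lam - c y * m\<^sup>2) * U y)"
      using eq uU cP by eventually_elim (auto simp: algebra_simps)
    then obtain N where N: "negligible N" "0 \<in> N" "H \<in> N"
      and PN: "\<And>y. y \<in> {0..H} - N \<Longrightarrow> P y = c y * du y \<and> w y = - ((lam - c y * m\<^sup>2) * U y)"
      by (rule AE_interval_negligible) blast
    have uL: "u \<in> L2 {0<..<H}" using du by (simp add: weak_pderiv_def)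
    have sub: "{a..b} \<subseteq> {0..H}" using ab' by auto
    have Uab: "continuous_on {a..b} U" and Pab: "continuous_on {a..b} P"
      using continuous_on_subset[OF Uc sub] continuous_on_subset[OF Pc sub] .
    define I where "I = integral {a..b} (\<lambda>y. (U y)\<^sup>2)"
    have normab: "L2_norm {a<..<b} u = sqrt I"
      unfolding I_def by (rule L2_norm_subinterval[OF uL uU Uc ab'])
    have normH: "integral {0..H} (\<lambda>y. (U y)\<^sup>2) = 1"
      using L2_norm_subinterval[OF uL uU Uc, of 0 H] nrm by simp
    define E where "E r = lam * (U r)\<^sup>2 + (P r)\<^sup>2" for r
    note en = energy_comparison[OF H cm eps V c lam(1) lam_pos U P N(1), folded \<gamma>_def]
    have Ecomp: "E r \<le> K1 * E s" if r: "r \<in> {0<..<H}" and s: "s \<in> {0<..<H}" for r s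
    proof -
      define g where "g r = (lam - c r * m\<^sup>2) * c r" for r
      have e: "g r * (U r)\<^sup>2 + (P r)\<^sup>2 \<le> exp (V / \<gamma>) * (g s * (U s)\<^sup>2 + (P s)\<^sup>2)"
        and g: "lam * \<gamma> \<le> g r" "g s \<le> lam * c\<^sub>M"
        unfolding g_def using en[OF _ _ r s] en[OF _ _ s r] PN by blast+
      have "min \<gamma> 1 * E r = min \<gamma> 1 * lam * (U r)\<^sup>2 + min \<gamma> 1 * (P r)\<^sup>2"
        by (simp add: E_def algebra_simps)
      also have "\<dots> \<le> g r * (U r)\<^sup>2 + 1 * (P r)\<^sup>2"
      proof (intro add_mono mult_right_mono)
        have "min \<gamma> 1 * lam \<le> \<gamma> * lam" using lam_pos by (intro mult_right_mono) auto
        then show "min \<gamma> 1 * lam \<le> g r" using g(1) by (simp add: mult.commute)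
      qed auto
      also have "\<dots> \<le> exp (V / \<gamma>) * (g s * (U s)\<^sup>2 + (P s)\<^sup>2)" using e by simp
      also have "\<dots> \<le> exp (V / \<gamma>) * (max c\<^sub>M 1 * lam * (U s)\<^sup>2 + max c\<^sub>M 1 * (P s)\<^sup>2)"
      proof (intro mult_left_mono add_mono mult_right_mono)
        have "c\<^sub>M * lam \<le> max c\<^sub>M 1 * lam" using lam_pos by (intro mult_right_mono) auto
        then show "g s \<le> max c\<^sub>M 1 * lam" using g(2) by (simp add: mult.commute)
        show "(P s)\<^sup>2 \<le> max c\<^sub>M 1 * (P s)\<^sup>2"
          using mult_right_mono[of 1 "max c\<^sub>M 1" "(P s)\<^sup>2"] by simp
      qed auto
      also have "\<dots> = exp (V / \<gamma>) * max c\<^sub>M 1 * E s" by (simp add: E_def algebra_simps)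
      finally have "E r * min \<gamma> 1 \<le> exp (V / \<gamma>) * max c\<^sub>M 1 * E s" by (simp add: mult.commute)
      then show ?thesis using gam by (simp add: K1_def pos_le_divide_eq)
    qed
    have Elow: "lam / (H * K1) \<le> E s" if s: "s \<in> {0<..<H}" for s
    proof -
      have "lam * integral {0..H} (\<lambda>y. (U y)\<^sup>2) = integral {0..H} (\<lambda>y. lam * (U y)\<^sup>2)" by simp
      also have "\<dots> \<le> integral {0..H} (\<lambda>y. K1 * E s)"
      proof (rule integral_mono_negligible[OF N(1)])
        show "(\<lambda>y. lam * (U y)\<^sup>2) integrable_on {0..H}"
          by (intro integrable_continuous_real continuous_intros Uc)
        fix y assume "y \<in> {0..H} - N"
        then have y: "y \<in> {0<..<H}" using N by (auto simp: less_le)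
        have "lam * (U y)\<^sup>2 \<le> E y" by (simp add: E_def)
        then show "lam * (U y)\<^sup>2 \<le> K1 * E s" using Ecomp[OF y s] by simp
      qed auto
      also have "\<dots> = H * (K1 * E s)" using H by simp
      finally show ?thesis using H K1 normH by (simp add: pos_divide_le_eq mult_ac)
    qed
    define h where "h y = (U y * P y) * (2 * \<eta> y * \<eta>' y) + (\<eta> y)\<^sup>2 * (P y * du y + U y * w y)" for y
    have prim: "primitive_on a b (\<lambda>y. (\<eta> y)\<^sup>2 * (U y * P y)) h"
    proof -
      have "primitive_on a b (\<lambda>y. (\<eta> y)\<^sup>2) (\<lambda>y. 2 * \<eta> y * \<eta>' y)"
      proof (rule primitive_on_C1)
        show "((\<lambda>y. (\<eta> y)\<^sup>2) has_real_derivative 2 * \<eta> y * \<eta>' y) (at y)" for y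
          unfolding \<eta>_def \<eta>'_def by (auto intro!: derivative_eq_intros simp: algebra_simps)
        show "continuous_on UNIV (\<lambda>y. 2 * \<eta> y * \<eta>' y)" by (intro continuous_intros etac)
      qed
      moreover have "primitive_on a b (\<lambda>y. U y * P y) (\<lambda>y. P y * du y + U y * w y)"
        by (rule primitive_on_subinterval[OF primitive_on_mult[OF U P]]) (use ab ab' in auto)
      ultimately show ?thesis unfolding h_def by (rule primitive_on_mult)
    qed
    have h0: "integral {a..b} h = 0"
      using primitive_onD(1)[OF prim, of a b] ab by (simp add: \<eta>_def)
    have hi: "h integrable_on {a..b}" using primitive_onD(2)[OF prim, of a b] ab by simp
    have bound: "lam / (H * K1) * (\<eta> y)\<^sup>2 \<le> 2 * c\<^sub>M * h y + lam * Kc * (U y)\<^sup>2" if y: "y \<in> {a..b} - N" for y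
    proof -
      have y1: "y \<in> {0..H} - N" using y sub by auto
      then have y2: "y \<in> {0<..<H}" using N by (auto simp: less_le)
      have cy: "0 < c y" "c y \<le> c\<^sub>M" using c y2 cm by (force simp: K_class_def)+
      have Py: "P y = c y * du y" and wy: "w y = - ((lam - c y * m\<^sup>2) * U y)" using PN[OF y1] by auto
      have du_y: "du y = P y / c y" using Py cy by simp
      define X where "X = \<eta> y * P y"
      define Y where "Y = \<eta>' y * U y"
      have "(P y)\<^sup>2 / c\<^sub>M \<le> P y * du y"
        unfolding du_y power2_eq_square times_divide_eq_right using cy by (intro divide_left_mono) auto
      moreover have "- lam * (U y)\<^sup>2 \<le> U y * w y"
      proof -
        have "0 \<le> c y * m\<^sup>2 * (U y)\<^sup>2" using cy by simp
        moreover have "U y * w y = - lam * (U y)\<^sup>2 + c y * m\<^sup>2 * (U y)\<^sup>2"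
          unfolding wy by (simp add: power2_eq_square algebra_simps)
        ultimately show ?thesis by linarith
      qed
      ultimately have "(\<eta> y)\<^sup>2 * ((P y)\<^sup>2 / c\<^sub>M - lam * (U y)\<^sup>2) \<le> (\<eta> y)\<^sup>2 * (P y * du y + U y * w y)"
        by (intro mult_left_mono) auto
      then have "X\<^sup>2 / c\<^sub>M - lam * (\<eta> y)\<^sup>2 * (U y)\<^sup>2 + 2 * (X * Y) \<le> h y"
        unfolding h_def X_def Y_def by (simp add: power_mult_distrib algebra_simps)
      then have "2 * c\<^sub>M * (X\<^sup>2 / c\<^sub>M - lam * (\<eta> y)\<^sup>2 * (U y)\<^sup>2 + 2 * (X * Y)) \<le> 2 * c\<^sub>M * h y"
        using cM by (intro mult_left_mono) auto
      \<comment> \<open>Young's inequality for the mixed term \<open>4 c\<^sub>M X Y\<close>, in the form of a completed square.\<close>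
      moreover have "2 * c\<^sub>M * (X\<^sup>2 / c\<^sub>M - lam * (\<eta> y)\<^sup>2 * (U y)\<^sup>2 + 2 * (X * Y))
         = X\<^sup>2 + (X + 2 * c\<^sub>M * Y)\<^sup>2 - 4 * c\<^sub>M\<^sup>2 * Y\<^sup>2 - 2 * c\<^sub>M * lam * (\<eta> y)\<^sup>2 * (U y)\<^sup>2"
        using cM by (simp add: power2_eq_square field_simps)
      moreover have "0 \<le> (X + 2 * c\<^sub>M * Y)\<^sup>2" by simp
      ultimately have X: "X\<^sup>2 \<le> 2 * c\<^sub>M * h y + 4 * c\<^sub>M\<^sup>2 * Y\<^sup>2 + 2 * c\<^sub>M * lam * (\<eta> y)\<^sup>2 * (U y)\<^sup>2"
        by linarith
      have "lam / (H * K1) * (\<eta> y)\<^sup>2 \<le> E y * (\<eta> y)\<^sup>2"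
        using Elow[OF y2] by (intro mult_right_mono) auto
      also have "\<dots> = lam * (\<eta> y)\<^sup>2 * (U y)\<^sup>2 + X\<^sup>2"
        by (simp add: E_def X_def power_mult_distrib algebra_simps)
      also have "\<dots> \<le> 2 * c\<^sub>M * h y + (lam * (\<eta> y)\<^sup>2 + 4 * c\<^sub>M\<^sup>2 * (\<eta>' y)\<^sup>2 + 2 * c\<^sub>M * lam * (\<eta> y)\<^sup>2) * (U y)\<^sup>2"
        using X by (simp add: Y_def power_mult_distrib algebra_simps)
      also have "(lam * (\<eta> y)\<^sup>2 + 4 * c\<^sub>M\<^sup>2 * (\<eta>' y)\<^sup>2 + 2 * c\<^sub>M * lam * (\<eta> y)\<^sup>2) * (U y)\<^sup>2 \<le> lam * Kc * (U y)\<^sup>2"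
      proof (rule mult_right_mono)
        have yab: "y \<in> {a..b}" using y by auto
        have "lam * (\<eta> y)\<^sup>2 + 4 * c\<^sub>M\<^sup>2 * (\<eta>' y)\<^sup>2 + 2 * c\<^sub>M * lam * (\<eta> y)\<^sup>2
          \<le> lam * L ^ 4 + 4 * c\<^sub>M\<^sup>2 * L\<^sup>2 + 2 * c\<^sub>M * lam * L ^ 4"
          using eta_bd[OF yab] lam_pos cM by (intro add_mono mult_left_mono) auto
        also have "4 * c\<^sub>M\<^sup>2 * L\<^sup>2 \<le> lam / lam0 * (4 * c\<^sub>M\<^sup>2 * L\<^sup>2)"
          using mult_right_mono[of 1 "lam / lam0" "4 * c\<^sub>M\<^sup>2 * L\<^sup>2"] lam(2) lam0 by simp
        finally show "lam * (\<eta> y)\<^sup>2 + 4 * c\<^sub>M\<^sup>2 * (\<eta>' y)\<^sup>2 + 2 * c\<^sub>M * lam * (\<eta> y)\<^sup>2 \<le> lam * Kc"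
          unfolding Kc_def using lam0 by (simp add: power2_eq_square field_simps)
      qed auto
      finally show ?thesis by simp
    qed
    have U2i: "(\<lambda>y. (U y)\<^sup>2) integrable_on {a..b}"
      by (intro integrable_continuous_real continuous_intros Uab)
    have "lam / (H * K1) * J = integral {a..b} (\<lambda>y. lam / (H * K1) * (\<eta> y)\<^sup>2)"
      by (simp add: J_def)
    also have "\<dots> \<le> integral {a..b} (\<lambda>y. 2 * c\<^sub>M * h y + lam * Kc * (U y)\<^sup>2)"
    proof (rule integral_mono_negligible[OF N(1)])
      show "(\<lambda>y. lam / (H * K1) * (\<eta> y)\<^sup>2) integrable_on {a..b}"
        by (intro integrable_continuous_real continuous_intros etac)
      show "(\<lambda>y. 2 * c\<^sub>M * h y + lam * Kc * (U y)\<^sup>2) integrable_on {a..b}"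
        by (intro Henstock_Kurzweil_Integration.integrable_add integrable_on_mult_right hi U2i)
    qed (use bound in blast)
    also have "\<dots> = lam * Kc * I"
      using hi U2i h0
      by (subst Henstock_Kurzweil_Integration.integral_add) (auto intro: integrable_on_mult_right simp: I_def)
    finally have "lam * (J / (H * K1)) \<le> lam * (Kc * I)" by (simp add: mult_ac)
    then have "J / (H * K1) \<le> Kc * I" by (simp only: mult_le_cancel_left_pos[OF lam_pos])
    then have "J / (H * K1 * Kc) \<le> I"
      unfolding divide_divide_eq_left[symmetric] pos_divide_le_eq[OF Kc] by (simp only: mult.commute)
    then show ?thesis unfolding f_def normab by simp
  qed
  ultimately show ?thesis by blast
qed

section \<open>Norms over products and subdomains\<close>

lemma completion_measurable_AE:
  fixes f g :: "'a \<Rightarrow> real"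
  assumes ae: "AE x in M. f x = g x" and g: "g \<in> borel_measurable M"
  shows "f \<in> borel_measurable (completion M)"
proof (rule measurableI)
  fix A :: "real set" assume A: "A \<in> sets borel"
  have "AE x in completion M. x \<in> g -` A \<inter> space M \<longleftrightarrow> x \<in> f -` A \<inter> space M"
    by (rule AE_completion) (use ae in \<open>auto elim!: eventually_mono\<close>)
  moreover have "g -` A \<inter> space M \<in> sets (completion M)"
    using measurable_sets[OF g A] by auto
  ultimately show "f -` A \<inter> space (completion M) \<in> sets (completion M)"
    using completion.in_sets_AE[where A="g -` A \<inter> space M" and B="f -` A \<inter> space M"] by auto
qed auto

text \<open>Tonelli's theorem is applied to Borel functions that agree with \<open>f\<^sup>2\<close> and \<open>g\<^sup>2\<close> almost everywhere,
  since the Lebesgue measure on a product is not the product of the Lebesgue measures but its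
  completion.\<close>

lemma L2_norm_product:
  fixes f :: "'a::euclidean_space \<Rightarrow> real" and g :: "'b::euclidean_space \<Rightarrow> real"
  assumes S: "open S" and T: "open T" and f: "f \<in> borel_measurable (lebesgue_on S)"
    and g: "g \<in> borel_measurable (lebesgue_on T)"
  shows "L2_norm (S \<times> T) (\<lambda>(x, y). f x * g y) = L2_norm S f * L2_norm T g"
proof -
  define F where "F x = (if x \<in> S then f x else 0)\<^sup>2" for x
  define G where "G x = (if x \<in> T then g x else 0)\<^sup>2" for x
  have Sl: "S \<in> sets lebesgue" "T \<in> sets lebesgue" "S \<times> T \<in> sets lebesgue"
  proof -
    have "X \<in> sets lebesgue" if "open X" for X :: "'c::euclidean_space set" using that by auto
    then show "S \<in> sets lebesgue" "T \<in> sets lebesgue" "S \<times> T \<in> sets lebesgue"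
      using S T open_Times[OF S T] by blast+
  qed
  have Fm: "F \<in> borel_measurable lebesgue" and Gm: "G \<in> borel_measurable lebesgue"
    unfolding F_def[abs_def] G_def[abs_def]
    by (intro borel_measurable_power borel_measurable_if_I f g Sl)+
  obtain F0 where F0[measurable]: "F0 \<in> borel_measurable lborel" and FF0: "AE x in lborel. F x = F0 x"
    using completion_ex_borel_measurable_real[OF Fm] by blast
  obtain G0 where G0[measurable]: "G0 \<in> borel_measurable lborel" and GG0: "AE x in lborel. G x = G0 x"
    using completion_ex_borel_measurable_real[OF Gm] by blast
  define Q where "Q z = F (fst z) * G (snd z)" for z
  define Q0 where "Q0 z = F0 (fst z) * G0 (snd z)" for z
  have FG: "AE z in lborel. F (fst z) = F0 (fst z) \<and> G (snd z) = G0 (snd z)"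
  proof -
    obtain N1 where N1: "N1 \<in> null_sets lborel" "{x. F x \<noteq> F0 x} \<subseteq> N1"
      using FF0 unfolding eventually_ae_filter by auto
    obtain N2 where N2: "N2 \<in> null_sets lborel" "{x. G x \<noteq> G0 x} \<subseteq> N2"
      using GG0 unfolding eventually_ae_filter by auto
    have [measurable]: "N1 \<in> sets borel" "N2 \<in> sets borel" using N1 N2 by auto
    have "AE z in lborel \<Otimes>\<^sub>M lborel. fst z \<notin> N1 \<and> snd z \<notin> N2"
    proof (rule lborel_pair.AE_pair_measure)
      have "{z \<in> space (lborel \<Otimes>\<^sub>M lborel). fst z \<notin> N1 \<and> snd z \<notin> N2} = (- N1) \<times> (- N2)"
        by (auto simp: space_pair_measure)
      moreover have "(- N1) \<times> (- N2) \<in> sets (lborel \<Otimes>\<^sub>M lborel)"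
        by (intro pair_measureI) auto
      ultimately show "{z \<in> space (lborel \<Otimes>\<^sub>M lborel). fst z \<notin> N1 \<and> snd z \<notin> N2} \<in> sets (lborel \<Otimes>\<^sub>M lborel)"
        by simp
      show "AE x in lborel. AE y in lborel. fst (x, y) \<notin> N1 \<and> snd (x, y) \<notin> N2"
        using AE_not_in[OF N1(1)] AE_not_in[OF N2(1)] by (auto elim!: eventually_mono)
    qed
    then show ?thesis
      unfolding lborel_prod by eventually_elim (use N1(2) N2(2) in auto)
  qed
  have QQ0: "AE z in lborel. Q z = Q0 z"
    using FG by eventually_elim (simp add: Q_def Q0_def)
  have Q0m: "Q0 \<in> borel_measurable lborel"
    unfolding Q0_def[abs_def] lborel_prod[symmetric] by measurable
  have Qm: "Q \<in> borel_measurable lebesgue"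
    by (rule completion_measurable_AE[OF QQ0 Q0m])
  have nonneg: "0 \<le> F x" "0 \<le> G y" "0 \<le> Q z" for x y z by (auto simp: F_def G_def Q_def)
  have "(\<integral>\<^sup>+z. ennreal (Q z) \<partial>lebesgue) = (\<integral>\<^sup>+z. ennreal (Q z) \<partial>lborel)"
    by (rule nn_integral_completion)
  also have "\<dots> = (\<integral>\<^sup>+z. ennreal (F0 (fst z)) * ennreal (G0 (snd z)) \<partial>(lborel \<Otimes>\<^sub>M lborel))"
  proof -
    have "AE z in lborel. ennreal (Q z) = ennreal (F0 (fst z)) * ennreal (G0 (snd z))"
      using FG by eventually_elim (metis Q_def ennreal_mult nonneg(1,2))
    then show ?thesis unfolding lborel_prod by (rule nn_integral_cong_AE)
  qed
  also have "\<dots> = (\<integral>\<^sup>+x. \<integral>\<^sup>+y. ennreal (F0 x) * ennreal (G0 y) \<partial>lborel \<partial>lborel)"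
    by (subst lborel.nn_integral_fst[symmetric]) simp_all
  also have "\<dots> = (\<integral>\<^sup>+x. ennreal (F0 x) \<partial>lborel) * (\<integral>\<^sup>+y. ennreal (G0 y) \<partial>lborel)"
    by (simp add: nn_integral_cmult nn_integral_multc)
  also have "(\<integral>\<^sup>+x. ennreal (F0 x) \<partial>lborel) = (\<integral>\<^sup>+x. ennreal (F x) \<partial>lebesgue)"
    unfolding nn_integral_completion
    by (rule nn_integral_cong_AE) (use FF0 in \<open>auto elim!: eventually_mono\<close>)
  also have "(\<integral>\<^sup>+y. ennreal (G0 y) \<partial>lborel) = (\<integral>\<^sup>+y. ennreal (G y) \<partial>lebesgue)"
    unfolding nn_integral_completion
    by (rule nn_integral_cong_AE) (use GG0 in \<open>auto elim!: eventually_mono\<close>)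
  finally have "(\<integral>z. Q z \<partial>lebesgue) = (\<integral>x. F x \<partial>lebesgue) * (\<integral>y. G y \<partial>lebesgue)"
    using Qm Fm Gm nonneg by (simp add: integral_eq_nn_integral enn2real_mult)
  moreover have "(\<integral>x. F x \<partial>lebesgue) = (\<integral>x. (f x)\<^sup>2 \<partial>lebesgue_on S)"
  proof -
    have "F = (\<lambda>x. if x \<in> S then (f x)\<^sup>2 else 0)" by (auto simp: F_def)
    then show ?thesis by (simp add: Lebesgue_Measure.integral_restrict_UNIV[OF Sl(1)])
  qed
  moreover have "(\<integral>x. G x \<partial>lebesgue) = (\<integral>x. (g x)\<^sup>2 \<partial>lebesgue_on T)"
  proof -
    have "G = (\<lambda>x. if x \<in> T then (g x)\<^sup>2 else 0)" by (auto simp: G_def)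
    then show ?thesis by (simp add: Lebesgue_Measure.integral_restrict_UNIV[OF Sl(2)])
  qed
  moreover have "(\<integral>z. Q z \<partial>lebesgue) = (\<integral>z. (case z of (x, y) \<Rightarrow> f x * g y)\<^sup>2 \<partial>lebesgue_on (S \<times> T))"
  proof -
    have "Q = (\<lambda>z. if z \<in> S \<times> T then (case z of (x, y) \<Rightarrow> f x * g y)\<^sup>2 else 0)"
      by (auto simp: Q_def F_def G_def power_mult_distrib fun_eq_iff)
    then show ?thesis
      using Lebesgue_Measure.integral_restrict_UNIV[OF Sl(3), of "\<lambda>z. (case z of (x, y) \<Rightarrow> f x * g y)\<^sup>2"] by simp
  qed
  ultimately show ?thesis by (simp add: L2_norm_def real_sqrt_mult)
qed

lemma L2_norm_mono:
  assumes "open S" "open T" "S \<subseteq> T" "f \<in> L2 T"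
  shows "L2_norm S f \<le> L2_norm T f"
  unfolding L2_norm_def
  by (intro real_sqrt_le_mono integral_mono_lebesgue_on_AE) (use assms in \<open>auto simp: L2_def\<close>)

lemma L2_subset:
  assumes "open S" "open T" "S \<subseteq> T" "f \<in> L2 T"
  shows "f \<in> L2 S"
proof -
  have "set_integrable lebesgue T (\<lambda>x. (f x)\<^sup>2)"
    using assms by (auto simp: L2_def set_integrable_def integrable_restrict_space)
  then have "set_integrable lebesgue S (\<lambda>x. (f x)\<^sup>2)"
    by (rule set_integrable_subset) (use assms in auto)
  then show ?thesis
    using assms measurable_restrict_mono[OF _ assms(3)]
    by (auto simp: L2_def set_integrable_def integrable_restrict_space)
qed

lemma L2_norm_eq_0_iff_AE:
  assumes "f \<in> L2 S"
  shows "L2_norm S f = 0 \<longleftrightarrow> (AE x in lebesgue_on S. f x = 0)"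
  using assms integral_nonneg_eq_0_iff_AE[of "lebesgue_on S" "\<lambda>x. (f x)\<^sup>2"]
  by (simp add: L2_norm_def L2_def)

section \<open>Lower bounds for the eigenfunctions\<close>

text \<open>The nonconcentration hypothesis says nothing about finitely many eigenfunctions; for these the norm
  over \<open>\<omega>\<close> is positive by unique continuation.\<close>

lemma eigenfunctions_lower_bound:
  fixes \<Omega> \<omega> :: "'a::euclidean_space set"
  assumes \<Omega>: "open \<Omega>" "bounded \<Omega>" "connected \<Omega>"
    and eig: "\<And>k. eigenfunction \<Omega> (dirichlet_laplacian \<Omega>) (lam k) (\<phi> k)"
    and nrm: "\<And>k. L2_norm \<Omega> (\<phi> k) = 1"
    and \<omega>: "open \<omega>" "\<omega> \<noteq> {}" "\<omega> \<subseteq> \<Omega>"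
    and conc: "liminf (\<lambda>k. ereal ((L2_norm \<omega> (\<phi> k))\<^sup>2 / (L2_norm \<Omega> (\<phi> k))\<^sup>2)) > 0"
  shows "\<exists>p>0. \<forall>k. p \<le> L2_norm \<omega> (\<phi> k)"
proof -
  define r where "r k = L2_norm \<omega> (\<phi> k)" for k
  have dl: "dirichlet_laplacian \<Omega> (\<phi> k) (\<lambda>x. lam k * \<phi> k x)" for k
    using eig by (simp add: eigenfunction_def)
  have L2: "\<phi> k \<in> L2 \<Omega>" for k using dl by (auto simp: dirichlet_laplacian_def H10_def H1_def)
  have r0: "r k > 0" for k
  proof (rule ccontr)
    assume "\<not> r k > 0"
    moreover have "r k \<ge> 0" by (simp add: r_def L2_norm_def)
    ultimately have "L2_norm \<omega> (\<phi> k) = 0" by (simp add: r_def)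
    then have "AE x in lebesgue_on \<omega>. \<phi> k x = 0"
      using L2_norm_eq_0_iff_AE L2_subset[OF \<omega>(1) \<Omega>(1) \<omega>(3) L2] by blast
    then have "AE x in lebesgue_on \<Omega>. \<phi> k x = 0"
      by (rule unique_continuation[OF \<Omega> dl \<omega>])
    then show False using nrm[of k] L2_norm_eq_0_iff_AE[OF L2[of k]] by simp
  qed
  obtain d where d: "0 < d" "ereal d < liminf (\<lambda>k. ereal ((r k)\<^sup>2))"
    using ereal_dense2[OF conc] by (auto simp: r_def nrm)
  have "\<forall>\<^sub>F k in sequentially. d < (r k)\<^sup>2"
    using less_LiminfD[OF d(2)] by simp
  then obtain K where K: "\<And>k. k \<ge> K \<Longrightarrow> d < (r k)\<^sup>2"
    by (auto simp: eventually_sequentially)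
  define p where "p = Min (insert (sqrt d) (r ` {..<K}))"
  have "p > 0" unfolding p_def using d(1) r0 by (subst Min_gr_iff) auto
  moreover have "p \<le> r k" for k
  proof (cases "k < K")
    case True
    then show ?thesis unfolding p_def by (intro Min_le) auto
  next
    case False
    have "sqrt d \<le> r k"
      using K[of k] False r0[of k] by (intro real_le_lsqrt[OF _ less_imp_le]) auto
    moreover have "p \<le> sqrt d" unfolding p_def by (intro Min_le) auto
    ultimately show ?thesis by linarith
  qed
  ultimately show ?thesis unfolding r_def by blast
qed

theorem theoremA:
  fixes \<Omega>' \<omega>' :: "(real ^ 'n) set"
    and \<mu> :: "nat \<Rightarrow> real" and \<phi> :: "nat \<Rightarrow> real ^ 'n \<Rightarrow> real"
    and H c\<^sub>m c\<^sub>M \<epsilon> V a b :: real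
  assumes "smooth_bounded_domain \<Omega>'" and "H > 0"
    and "dirichlet_eigensystem \<Omega>' \<mu> \<phi>"
    and "0 < c\<^sub>m" and "c\<^sub>m < c\<^sub>M" and "\<epsilon> > 0" and "V > 0"
    and "a < b" and "{a<..<b} \<subseteq> {0<..<H}"
    and "open \<omega>'" and "\<omega>' \<noteq> {}" and "\<omega>' \<subseteq> \<Omega>'"
    and "\<omega>' \<noteq> \<Omega>' \<Longrightarrow>
      liminf (\<lambda>k. ereal ((L2_norm \<omega>' (\<phi> k))\<^sup>2 / (L2_norm \<Omega>' (\<phi> k))\<^sup>2)) > 0"
  shows "\<exists>f>0. \<forall>c \<in> K_class H c\<^sub>m c\<^sub>M V. \<forall>(m, lam) \<in> A_eps H c\<^sub>M \<epsilon> \<mu> c. \<forall>k u.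
      \<mu> k = m \<longrightarrow> eigenfunction {0<..<H} (A_op H c m) lam u \<longrightarrow> L2_norm {0<..<H} u = 1 \<longrightarrow>
      (let v = (\<lambda>(x, y). \<phi> k x * u y);
           ratio = L2_norm (\<omega>' \<times> {a<..<b}) v / L2_norm (\<Omega>' \<times> {0<..<H}) v
       in f \<le> ratio \<and> ratio \<le> 1)"
proof -
  have \<Omega>: "open \<Omega>'" "bounded \<Omega>'" "connected \<Omega>'"
    using assms(1) by (auto simp: smooth_bounded_domain_def)
  have mu: "\<And>k. \<mu> k > 0" "incseq \<mu>"
    and eig: "\<And>k. eigenfunction \<Omega>' (dirichlet_laplacian \<Omega>') ((\<mu> k)\<^sup>2) (\<phi> k)"
    and orth: "\<And>k. L2_inner \<Omega>' (\<phi> k) (\<phi> k) = 1"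
    using assms(3) by (auto simp: dirichlet_eigensystem_def)
  have nrm: "L2_norm \<Omega>' (\<phi> k) = 1" for k
    using orth[of k] by (simp add: L2_norm_def L2_inner_def power2_eq_square)
  have phiL2: "\<phi> k \<in> L2 \<Omega>'" for k
    using eig[of k] by (auto simp: eigenfunction_def dirichlet_laplacian_def H10_def H1_def)
  obtain p where p: "p > 0" "\<And>k. p \<le> L2_norm \<omega>' (\<phi> k)"
  proof (cases "\<omega>' = \<Omega>'")
    case True
    then show ?thesis using that[of 1] nrm by simp
  next
    case False
    show ?thesis
      using eigenfunctions_lower_bound[OF \<Omega> eig nrm assms(10-12) assms(13)[OF False]] that by blast
  qed
  define lam0 where "lam0 = (c\<^sub>M + \<epsilon>) * (\<mu> 0)\<^sup>2"
  have cMe: "c\<^sub>M + \<epsilon> > 0" using assms(4-6) by linarith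
  have lam0: "lam0 > 0" unfolding lam0_def using cMe mu(1)[of 0] by simp
  obtain q where q: "q > 0" and q_le: "\<And>c m lam u. c \<in> K_class H c\<^sub>m c\<^sub>M V \<Longrightarrow> lam \<ge> (c\<^sub>M + \<epsilon>) * m\<^sup>2 \<Longrightarrow>
      lam \<ge> lam0 \<Longrightarrow> A_op H c m u (\<lambda>y. lam * u y) \<Longrightarrow> L2_norm {0<..<H} u = 1 \<Longrightarrow> q \<le> L2_norm {a<..<b} u"
    using sturm_liouville_lower_bound[OF assms(2,4-9) lam0] by blast
  have main: "p * q \<le> ratio \<and> ratio \<le> 1"
    if c: "c \<in> K_class H c\<^sub>m c\<^sub>M V" and ml: "(m, lam) \<in> A_eps H c\<^sub>M \<epsilon> \<mu> c"
      and u: "eigenfunction {0<..<H} (A_op H c m) lam u" "L2_norm {0<..<H} u = 1"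
      and ratio: "ratio = L2_norm (\<omega>' \<times> {a<..<b}) (\<lambda>(x, y). \<phi> k x * u y) /
        L2_norm (\<Omega>' \<times> {0<..<H}) (\<lambda>(x, y). \<phi> k x * u y)" for c m lam k u ratio
  proof -
    obtain j where j: "m = \<mu> j" "lam \<ge> (c\<^sub>M + \<epsilon>) * (\<mu> j)\<^sup>2" using ml by (auto simp: A_eps_def)
    have "(\<mu> 0)\<^sup>2 \<le> (\<mu> j)\<^sup>2" using mu(1)[of 0] incseqD[OF mu(2), of 0 j] by (intro power_mono) auto
    then have "lam0 \<le> (c\<^sub>M + \<epsilon>) * (\<mu> j)\<^sup>2" unfolding lam0_def using cMe by (intro mult_left_mono) auto
    then have lam: "lam \<ge> lam0" "lam \<ge> (c\<^sub>M + \<epsilon>) * m\<^sup>2" using j by auto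
    have A: "A_op H c m u (\<lambda>y. lam * u y)" using u(1) by (simp add: eigenfunction_def)
    have uL2: "u \<in> L2 {0<..<H}" using A by (auto simp: A_op_def H10_def H1_def)
    have u_ab: "q \<le> L2_norm {a<..<b} u" by (rule q_le[OF c lam(2,1) A u(2)])
    have "L2_norm (\<Omega>' \<times> {0<..<H}) (\<lambda>(x, y). \<phi> k x * u y) = 1"
      using L2_norm_product[OF \<Omega>(1), of "{0<..<H}" "\<phi> k" u] phiL2[of k] uL2 nrm[of k] u(2)
      by (simp add: L2_def)
    moreover have "L2_norm (\<omega>' \<times> {a<..<b}) (\<lambda>(x, y). \<phi> k x * u y) = L2_norm \<omega>' (\<phi> k) * L2_norm {a<..<b} u"
      using L2_norm_product[OF assms(10), of "{a<..<b}" "\<phi> k" u]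
        L2_subset[OF assms(10) \<Omega>(1) assms(12) phiL2[of k]] L2_subset[OF _ _ assms(9) uL2]
      by (simp add: L2_def)
    ultimately have R: "ratio = L2_norm \<omega>' (\<phi> k) * L2_norm {a<..<b} u" using ratio by simp
    have "p * q \<le> ratio"
      unfolding R using p q u_ab by (intro mult_mono) (auto simp: L2_norm_def)
    moreover have "ratio \<le> 1 * 1"
      unfolding R
      using L2_norm_mono[OF assms(10) \<Omega>(1) assms(12) phiL2[of k]] L2_norm_mono[OF _ _ assms(9) uL2] nrm[of k] u(2)
      by (intro mult_mono) (auto simp: L2_norm_def)
    ultimately show ?thesis by simp
  qed
  show ?thesis
  proof (intro exI[of _ "p * q"] conjI ballI)
    show "p * q > 0" using p q by simp
    fix c z assume c: "c \<in> K_class H c\<^sub>m c\<^sub>M V" and z: "z \<in> A_eps H c\<^sub>M \<epsilon> \<mu> c"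
    obtain m lam where zml: "z = (m, lam)" by (cases z)
    show "case z of (m, lam) \<Rightarrow> \<forall>k u. \<mu> k = m \<longrightarrow> eigenfunction {0<..<H} (A_op H c m) lam u \<longrightarrow>
      L2_norm {0<..<H} u = 1 \<longrightarrow>
      (let v = (\<lambda>(x, y). \<phi> k x * u y);
           ratio = L2_norm (\<omega>' \<times> {a<..<b}) v / L2_norm (\<Omega>' \<times> {0<..<H}) v
       in p * q \<le> ratio \<and> ratio \<le> 1)"
      unfolding zml Let_def prod.case
      using main[OF c z[unfolded zml]] by blast
  qed
qed

end
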